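(* The pro-isomorphic zeta function of $\Gamma=\Gamma_{t^2}$ is $$\zeta^{\wedge}_\Gamma(s)=\frac{\zeta(3s-8)\,\zeta(4s-11)\,\zeta(5s-12)\,\zeta(4s-10)}{\zeta(8s-20)},$$ where $\zeta(s)$ denotes the Riemann zeta function; in particular, it admits meromorphic continuation to the entire complex plane and has abscissa of convergence $3$, with a double pole at $s=3$. Furthermore, $$\sum_{n=1}^N a_n^\wedge(\Gamma)\sim c_{t^2}\,N^3\log N\qquad\text{as } N\to\infty,$$ where $c_{t^2}=\frac{5\,\zeta(3)}{12\pi^2}\approx 0.050747$.
   Context: $\Gamma_{t^2}$ is the group $\langle x_1,x_2,y_1,y_2,z_1,z_2\mid [x_1,y_1]=[x_2,y_2]=z_1,\ [x_1,y_2]=z_2,\ [x_2,y_1]=1,\ [x_i,x_j]=[y_i,y_j]=[x_i,z_j]=[y_i,z_j]=[z_1,z_2]=1\ (1\le i,j\le 2)\rangle$, a torsion-free class-two nilpotent group of Hirsch length $6$. For a finitely generated nilpotent group $\Gamma$, let $a_n^\wedge(\Gamma)$ be the number of subgroups $\Delta\le\Gamma$ with $|\Gamma:\Delta|=n$ and $\widehat\Delta\cong\widehat\Gamma$, where $\widehat{\ }$ denotes profinite completion. The pro-isomorphic zeta function is the Dirichlet series $\zeta_\Gamma^\wedge(s)=\sum_{n=1}^\infty a_n^\wedge(\Gamma)\,n^{-s}$. *)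

theory Defs
  imports
    "HOL-Complex_Analysis.Complex_Analysis"
    "HOL-Algebra.Product_Groups"
    "HOL-Library.Landau_Symbols"
begin

section \<open>Groups given by generators and relations\<close>

text \<open>A word is a list of letters \<open>(a, True)\<close>, standing for \<open>a\<close>, and \<open>(a, False)\<close>, standing for
  the inverse of \<open>a\<close>. A relation \<open>u = v\<close> is the pair of words \<open>(u, v)\<close>; the presented group consists
  of the words modulo the congruence generated by free cancellation and the relations. Every
  element of the type \<^typ>\<open>'g\<close> is a generator.\<close>

type_synonym 'g word = "('g \<times> bool) list"

definition gen :: "'g \<Rightarrow> 'g word" where
  "gen a = [(a, True)]"

definition comm :: "'g \<Rightarrow> 'g \<Rightarrow> 'g word" where
  "comm a b = [(a, False), (b, False), (a, True), (b, True)]"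

inductive_set word_cong :: "('g word \<times> 'g word) set \<Rightarrow> ('g word \<times> 'g word) set"
  for R :: "('g word \<times> 'g word) set" where
  refl: "(u, u) \<in> word_cong R"
| sym: "(u, v) \<in> word_cong R \<Longrightarrow> (v, u) \<in> word_cong R"
| trans: "(u, v) \<in> word_cong R \<Longrightarrow> (v, w) \<in> word_cong R \<Longrightarrow> (u, w) \<in> word_cong R"
| cancel: "(u @ [(a, e), (a, \<not> e)] @ v, u @ v) \<in> word_cong R"
| rel: "(r, s) \<in> R \<Longrightarrow> (u @ r @ v, u @ s @ v) \<in> word_cong R"

definition presented_group :: "('g word \<times> 'g word) set \<Rightarrow> 'g word set monoid" where
  "presented_group R =
     \<lparr>carrier = UNIV // word_cong R,
      monoid.mult = (\<lambda>A B. \<Union>u\<in>A. \<Union>v\<in>B. word_cong R `` {u @ v}),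
      one = word_cong R `` {[]}\<rparr>"


section \<open>The group \<open>\<Gamma>\<close>\<close>

datatype idx = One | Two

datatype generator = X idx | Y idx | Z idx

definition \<Gamma>_rels :: "(generator word \<times> generator word) set" where
  "\<Gamma>_rels =
     {(comm (X One) (Y One), gen (Z One)),
      (comm (X Two) (Y Two), gen (Z One)),
      (comm (X One) (Y Two), gen (Z Two)),
      (comm (X Two) (Y One), []),
      (comm (Z One) (Z Two), [])}
     \<union> {(comm (X i) (X j), []) | i j. True}
     \<union> {(comm (Y i) (Y j), []) | i j. True}
     \<union> {(comm (X i) (Z j), []) | i j. True}
     \<union> {(comm (Y i) (Z j), []) | i j. True}"

definition \<Gamma>_t2 :: "generator word set monoid" where
  "\<Gamma>_t2 = presented_group \<Gamma>_rels"


section \<open>Profinite completion\<close>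

definition fin_index_normal :: "('a, 'b) monoid_scheme \<Rightarrow> 'a set set" where
  "fin_index_normal G = {N. N \<lhd> G \<and> finite (rcosets\<^bsub>G\<^esub> N)}"

text \<open>The inverse limit of the finite quotients of \<open>G\<close>. For \<open>N \<subseteq> M\<close>, the transition map
  sends a coset of \<open>N\<close> to the unique coset of \<open>M\<close> containing it.\<close>

definition profinite_completion ::
  "('a, 'b) monoid_scheme \<Rightarrow> ('a set \<Rightarrow> 'a set) monoid" where
  "profinite_completion G =
     (let P = product_group (fin_index_normal G) (\<lambda>N. G Mod N)
      in P\<lparr>carrier := {f \<in> carrier P.
             \<forall>N \<in> fin_index_normal G. \<forall>M \<in> fin_index_normal G. N \<subseteq> M \<longrightarrow> f N \<subseteq> f M}\<rparr>)"

definition profinite_topology :: "('a, 'b) monoid_scheme \<Rightarrow> ('a set \<Rightarrow> 'a set) topology" where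
  "profinite_topology G =
     subtopology
       (product_topology (\<lambda>N. discrete_topology (carrier (G Mod N))) (fin_index_normal G))
       (carrier (profinite_completion G))"

text \<open>Isomorphism of profinite completions is isomorphism of topological groups.\<close>

definition iso_profinite_completions ::
  "('a, 'b) monoid_scheme \<Rightarrow> ('c, 'd) monoid_scheme \<Rightarrow> bool" where
  "iso_profinite_completions G H \<longleftrightarrow>
     (\<exists>\<phi> \<in> iso (profinite_completion G) (profinite_completion H).
        homeomorphic_map (profinite_topology G) (profinite_topology H) \<phi>)"


section \<open>Dirichlet series and zeta functions\<close>

definition dirichlet_term :: "(nat \<Rightarrow> complex) \<Rightarrow> complex \<Rightarrow> nat \<Rightarrow> complex" where
  "dirichlet_term a s k = a (Suc k) / of_nat (Suc k) powr s"

definition dirichlet_series :: "(nat \<Rightarrow> complex) \<Rightarrow> complex \<Rightarrow> complex" where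
  "dirichlet_series a s = (\<Sum>k. dirichlet_term a s k)"

definition abscissa_of_convergence :: "(nat \<Rightarrow> complex) \<Rightarrow> ereal" where
  "abscissa_of_convergence a = Inf {ereal (Re s) | s. summable (dirichlet_term a s)}"

text \<open>The Riemann zeta function as the meromorphic continuation of its Dirichlet series.
  The normalisation in \<^const>\<open>nicely_meromorphic_on\<close> (removable singularities are removed, the
  value at a pole is 0) makes the continuation unique as a total function.\<close>

definition riemann_zeta :: "complex \<Rightarrow> complex" where
  "riemann_zeta = (THE f. f nicely_meromorphic_on UNIV \<and>
                     (\<forall>s. Re s > 1 \<longrightarrow> f s = dirichlet_series (\<lambda>_. 1) s))"

text \<open>Coset sets of infinite index have cardinality 0, so they are not counted for \<open>n \<ge> 1\<close>.\<close>

definition proiso_subgroups :: "('a, 'b) monoid_scheme \<Rightarrow> nat \<Rightarrow> 'a set set" where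
  "proiso_subgroups G n =
     {\<Delta>. subgroup \<Delta> G \<and> card (rcosets\<^bsub>G\<^esub> \<Delta>) = n \<and>
          iso_profinite_completions (G\<lparr>carrier := \<Delta>\<rparr>) G}"

definition proiso_count :: "('a, 'b) monoid_scheme \<Rightarrow> nat \<Rightarrow> nat" where
  "proiso_count G n = card (proiso_subgroups G n)"

definition proiso_zeta :: "('a, 'b) monoid_scheme \<Rightarrow> complex \<Rightarrow> complex" where
  "proiso_zeta G = dirichlet_series (\<lambda>n. of_nat (proiso_count G n))"

end

theory Submission
  imports Defs "HOL-Number_Theory.Cong" "HOL-Computational_Algebra.Squarefree" "HOL-Real_Asymp.Real_Asymp"
begin

text \<open>
  Write \<open>R = \<int>[t]/t\<^sup>2\<close>. Collecting the generators as \<open>\<alpha> = u1 + v1 t\<close> (from \<open>x\<^sub>1, x\<^sub>2\<close>),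
  \<open>\<beta> = u2 + v2 t\<close> (from \<open>y\<^sub>2, y\<^sub>1\<close>) and \<open>\<gamma> = w2 + w1 t\<close> (from \<open>z\<^sub>2, z\<^sub>1\<close>) identifies \<open>\<Gamma>\<close> with the
  Heisenberg group over \<open>R\<close>, in which \<open>\<gamma>\<close>-coordinates of a product receive the extra term \<open>\<alpha> \<beta>'\<close>
  (\<open>\<Gamma>_t2_iso_heis\<close>). The proof counts the relevant subgroups of this group exactly and then
  does analysis on the resulting formula.

  If \<open>\<Delta>\<close> and \<open>\<Gamma>\<close> have isomorphic profinite completions, then \<open>\<Delta>\<close> maps onto
  every finite quotient of \<open>\<Gamma>\<close> (\<open>iso_profinite_imp_same_finite_quotients\<close>), in particular onto
  the Heisenberg group over \<open>(\<int>/p)[t]/t\<^sup>2\<close> for each prime \<open>p\<close>. This alone is decisive. A subgroup \<open>\<Delta>\<close> of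
  finite index has three lattices in \<open>\<int>\<^sup>2\<close>: the top one of the values \<open>(u1, u2)\<close>, the middle one of
  the values \<open>(v1, v2)\<close> where \<open>u1 = u2 = 0\<close>, and the bottom one \<open>\<Delta> \<inter> Z(\<Gamma>)\<close>. The surjections
  modulo all \<open>p\<close> force the top lattice to be \<open>k \<Lambda>\<close> and the middle lattice to be \<open>m \<Lambda>\<close>, with the same
  primitive lattice \<open>\<Lambda>\<close>, spanned by \<open>(a, b)\<close> and \<open>(0, c)\<close> in Hermite normal form, and the bottom
  lattice to be the one generated by the commutators. Then \<open>\<Delta>\<close> is the image of an injective endomorphism
  \<open>\<theta>\<close> of \<open>\<Gamma>\<close> (\<open>eq_range_\<theta>\<close>), so it is even isomorphic to \<open>\<Gamma>\<close>.

  The index is \<open>m\<^sup>3 k\<^sup>5 (a c)\<^sup>4\<close>. For a given shape \<open>(k, m, a, b, c)\<close> the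
  subgroup is determined by its four generators, two of which are lifted through the middle lattice and
  all four through the bottom lattice; this gives \<open>m\<^sup>8 k\<^sup>1\<^sup>2 (a c)\<^sup>1\<^sup>0\<close> subgroups. Since the number of primitive
  \<open>\<Lambda>\<close> of determinant \<open>d\<close> is the sum of \<open>e\<close> over \<open>d = q e\<close> with squarefree \<open>q\<close> (\<open>card_prim_forms\<close>),
  the number of subgroups of index \<open>n\<close> is the sum of \<open>m\<^sup>8 k\<^sup>1\<^sup>2 q\<^sup>1\<^sup>0 e\<^sup>1\<^sup>1\<close> over \<open>n = m\<^sup>3 k\<^sup>5 (q e)\<^sup>4\<close>
  with squarefree \<open>q\<close> (\<open>proiso_count_\<Gamma>_t2\<close>).

  The fourfold sum turns the Dirichlet series into a product of four independent
  sums over \<open>m\<close>, \<open>k\<close>, \<open>q\<close> and \<open>e\<close>. Three of them are zeta values, and the sum over squarefree \<open>q\<close> is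
  \<open>\<zeta>(4s - 10) / \<zeta>(8s - 20)\<close>. The continuation of \<open>\<zeta>\<close> comes from the alternating series
  \<open>(1 - 2\<^bsup>1-s\<^esup>) \<zeta>(s)\<close>, to which the Euler transform is applied as often as necessary. At \<open>s = 3\<close> exactly the
  factors \<open>\<zeta>(3s - 8)\<close> and \<open>\<zeta>(4s - 11)\<close> have a pole, and it is simple.

  The sum of \<open>m\<^sup>8 e\<^sup>1\<^sup>1\<close> over \<open>m\<^sup>3 e\<^sup>4 \<le> x\<close> is elementary: it is
  \<open>x\<^sup>3 ln x / 36 + O(x\<^sup>3)\<close>. Summing dilates of such a function over \<open>q\<close> and \<open>k\<close> multiplies the constant
  by \<open>\<zeta>(2) / \<zeta>(4) = 15 / \<pi>\<^sup>2\<close> and by \<open>\<zeta>(3)\<close> (\<open>cubic_log_dilation_sum\<close>), by dominated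
  convergence.
\<close>


section \<open>Profinite completions and finite quotients\<close>

lemma carrier_profinite:
  "carrier (profinite_completion G) =
     {f \<in> (\<Pi>\<^sub>E N\<in>fin_index_normal G. rcosets\<^bsub>G\<^esub> N).
        \<forall>N\<in>fin_index_normal G. \<forall>M\<in>fin_index_normal G. N \<subseteq> M \<longrightarrow> f N \<subseteq> f M}"
  by (simp add: profinite_completion_def product_group_def FactGroup_def Let_def)

lemma mult_profinite:
  "f \<otimes>\<^bsub>profinite_completion G\<^esub> g = (\<lambda>N\<in>fin_index_normal G. f N <#>\<^bsub>G\<^esub> g N)"
  by (simp add: profinite_completion_def product_group_def FactGroup_def Let_def)

lemma topspace_profinite: "topspace (profinite_topology G) = carrier (profinite_completion G)"
  by (auto simp: profinite_topology_def carrier_profinite FactGroup_def)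

lemma fin_index_normalD:
  assumes "N \<in> fin_index_normal G"
  shows "N \<lhd> G" "finite (rcosets\<^bsub>G\<^esub> N)" "subgroup N G"
  using assms by (auto simp: fin_index_normal_def normal_imp_subgroup)

text \<open>A finite quotient of \<open>G\<close> is, up to isomorphism, one of the factors of the
  inverse limit.\<close>

lemma kernel_in_fin_index_normal:
  assumes "group G" "group Q" "\<pi> \<in> hom G Q" "\<pi> ` carrier G = carrier Q" "finite (carrier Q)"
  shows "kernel G Q \<pi> \<in> fin_index_normal G"
    and "(\<lambda>X. the_elem (\<pi> ` X)) \<in> iso (G Mod kernel G Q \<pi>) Q"
proof -
  interpret group_hom G Q \<pi>
    using assms by (simp add: group_hom_def group_hom_axioms_def)
  show iso: "(\<lambda>X. the_elem (\<pi> ` X)) \<in> iso (G Mod kernel G Q \<pi>) Q"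
    using FactGroup_iso_set assms(4) by blast
  then have "bij_betw (\<lambda>X. the_elem (\<pi> ` X)) (rcosets\<^bsub>G\<^esub> (kernel G Q \<pi>)) (carrier Q)"
    by (simp add: iso_def FactGroup_def)
  then have "finite (rcosets\<^bsub>G\<^esub> (kernel G Q \<pi>))" using assms(5) bij_betw_finite by blast
  then show "kernel G Q \<pi> \<in> fin_index_normal G"
    by (simp add: fin_index_normal_def normal_kernel)
qed

lemma (in group) rcos_Int:
  assumes "subgroup N G" "subgroup M G" "x \<in> carrier G"
  shows "(N \<inter> M) #> x = (N #> x) \<inter> (M #> x)"
proof -
  have NM: "N \<subseteq> carrier G" "M \<subseteq> carrier G" using assms subgroup.subset by auto
  then have "n = m" if "n \<in> N" "m \<in> M" "n \<otimes> x = m \<otimes> x" for n m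
    using that assms(3) by (metis right_cancel subsetD)
  then show ?thesis unfolding r_coset_def by blast
qed

lemma (in group) fin_index_normal_Int:
  assumes "N \<in> fin_index_normal G" "M \<in> fin_index_normal G"
  shows "N \<inter> M \<in> fin_index_normal G"
proof -
  note N = fin_index_normalD[OF assms(1)] and M = fin_index_normalD[OF assms(2)]
  have "rcosets (N \<inter> M) \<subseteq> (\<lambda>(A, B). A \<inter> B) ` ((rcosets N) \<times> (rcosets M))"
    using rcos_Int[OF N(3) M(3)] by (fastforce simp: RCOSETS_def image_iff)
  then have "finite (rcosets (N \<inter> M))" using N(2) M(2) finite_subset by blast
  moreover have "N \<inter> M \<lhd> G"
    unfolding normal_inv_iff
  proof (intro conjI ballI)
    show "subgroup (N \<inter> M) G" using N(3) M(3) subgroups_Inter_pair by blast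
    fix x h assume "x \<in> carrier G" "h \<in> N \<inter> M"
    then show "x \<otimes> h \<otimes> inv x \<in> N \<inter> M" using N(1) M(1) by (auto simp: normal_inv_iff)
  qed
  ultimately show ?thesis by (simp add: fin_index_normal_def)
qed

lemma (in group) carrier_fin_index_normal: "carrier G \<in> fin_index_normal G"
proof -
  have "rcosets (carrier G) = {carrier G}"
    using coset_join2[OF _ subgroup_self] one_closed by (auto simp: RCOSETS_def)
  then show ?thesis using normal_self by (simp add: fin_index_normal_def)
qed

text \<open>The subgroups that index the inverse limit are directed downwards.\<close>

lemma (in group) fin_index_normal_Inter:
  assumes "finite F" "F \<subseteq> fin_index_normal G"
  shows "\<exists>M\<in>fin_index_normal G. \<forall>N\<in>F. M \<subseteq> N"
  using assms
proof induction
  case empty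
  then show ?case using carrier_fin_index_normal by blast
next
  case (insert N F)
  then obtain M where "M \<in> fin_index_normal G" "\<forall>N\<in>F. M \<subseteq> N" by auto
  then show ?case using insert.prems fin_index_normal_Int by (intro bexI[of _ "N \<inter> M"]) auto
qed

text \<open>The canonical map of a group into its completion.\<close>

definition profinite_embedding :: "('a, 'b) monoid_scheme \<Rightarrow> 'a \<Rightarrow> 'a set \<Rightarrow> 'a set" where
  "profinite_embedding G x = (\<lambda>N\<in>fin_index_normal G. N #>\<^bsub>G\<^esub> x)"

lemma (in group) profinite_embedding_closed:
  assumes "x \<in> carrier G"
  shows "profinite_embedding G x \<in> carrier (profinite_completion G)"
proof -
  have "N #> x \<in> rcosets N" if "N \<in> fin_index_normal G" for N
    using that assms fin_index_normalD(3) by (intro rcosetsI) (auto dest: subgroup.subset)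
  moreover have "N #> x \<subseteq> M #> x" if "N \<subseteq> M" for N M using that by (auto simp: r_coset_def)
  ultimately show ?thesis by (auto simp: carrier_profinite profinite_embedding_def)
qed

lemma (in group) profinite_embedding_mult:
  assumes "x \<in> carrier G" "y \<in> carrier G"
  shows "profinite_embedding G (x \<otimes> y) =
           profinite_embedding G x \<otimes>\<^bsub>profinite_completion G\<^esub> profinite_embedding G y"
  using assms normal.rcos_sum[OF fin_index_normalD(1)[where G = G], of _ x y]
  by (simp add: mult_profinite profinite_embedding_def fun_eq_iff)

text \<open>A basic open set restricts only finitely many coordinates. These are all determined by
  the coordinate at one subgroup \<open>M\<close> below them, and the value there is the coset of an
  element of \<open>G\<close>.\<close>

lemma (in group) profinite_embedding_dense:
  assumes "openin (profinite_topology G) U" "U \<noteq> {}"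
  shows "\<exists>x\<in>carrier G. profinite_embedding G x \<in> U"
proof -
  let ?I = "fin_index_normal G" and ?T = "\<lambda>N. discrete_topology (carrier (G Mod N))"
  obtain V where V: "openin (product_topology ?T ?I) V" "U = V \<inter> carrier (profinite_completion G)"
    using assms(1) by (auto simp: profinite_topology_def openin_subtopology)
  obtain \<xi> where \<xi>: "\<xi> \<in> V" "\<xi> \<in> carrier (profinite_completion G)" using assms(2) V(2) by auto
  obtain W where W: "finite {N \<in> ?I. W N \<noteq> topspace (?T N)}" "\<xi> \<in> Pi\<^sub>E ?I W" "Pi\<^sub>E ?I W \<subseteq> V"
    using V(1)[unfolded openin_product_topology_alt, rule_format, OF \<xi>(1)] by (elim exE conjE)
  obtain M where M: "M \<in> ?I" "\<And>N. N \<in> ?I \<Longrightarrow> W N \<noteq> topspace (?T N) \<Longrightarrow> M \<subseteq> N"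
    using fin_index_normal_Inter[OF W(1)] by auto
  have "\<xi> M \<in> rcosets M" using \<xi>(2) M(1) by (auto simp: carrier_profinite)
  then obtain x where x: "x \<in> carrier G" "\<xi> M = M #> x" by (auto simp: RCOSETS_def)
  have "N #> x \<in> W N" if N: "N \<in> ?I" for N
  proof (cases "W N = topspace (?T N)")
    case True
    then show ?thesis
      using x(1) fin_index_normalD(3)[OF N]
      by (auto simp: FactGroup_def intro!: rcosetsI dest: subgroup.subset)
  next
    case False
    then have "\<xi> M \<subseteq> \<xi> N" using M N \<xi>(2) by (auto simp: carrier_profinite)
    moreover have "x \<in> \<xi> M"
      using x fin_index_normalD(3)[OF M(1)] by (simp add: rcos_self)
    moreover have "\<xi> N \<in> rcosets N" using \<xi>(2) N by (auto simp: carrier_profinite)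
    ultimately have "\<xi> N = N #> x"
      using repr_independence fin_index_normalD(3)[OF N] unfolding RCOSETS_def by blast
    then show ?thesis using W(2) N by (auto simp: PiE_iff)
  qed
  then have "profinite_embedding G x \<in> V" using W(3) by (auto simp: profinite_embedding_def PiE_iff)
  then show ?thesis using x(1) V(2) profinite_embedding_closed by auto
qed

text \<open>Evaluation at the kernel of \<open>\<pi>\<close> is a continuous homomorphism from the
  completion of \<open>G\<close> onto the finite discrete group \<open>Q\<close>. Composed with the
  isomorphism of completions its fibres are open and nonempty in the completion of \<open>D\<close>,
  so each of them meets the dense image of \<open>D\<close>.\<close>

theorem iso_profinite_imp_same_finite_quotients:
  assumes D: "group D" and G: "group G" and Q: "group Q" "finite (carrier Q)"
    and iso: "iso_profinite_completions D G"
    and \<pi>: "\<pi> \<in> hom G Q" "\<pi> ` carrier G = carrier Q"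
  shows "\<exists>\<rho>\<in>hom D Q. \<rho> ` carrier D = carrier Q"
proof -
  interpret D: group D by fact
  interpret G: group G by fact
  obtain \<Phi> where \<Phi>: "\<Phi> \<in> iso (profinite_completion D) (profinite_completion G)"
    "homeomorphic_map (profinite_topology D) (profinite_topology G) \<Phi>"
    using iso by (auto simp: iso_profinite_completions_def)
  define N where "N = kernel G Q \<pi>"
  define \<tau> where "\<tau> = (\<lambda>X. the_elem (\<pi> ` X))"
  have N: "N \<in> fin_index_normal G" and \<tau>: "\<tau> \<in> iso (G Mod N) Q"
    using kernel_in_fin_index_normal[OF G Q(1) \<pi> Q(2)] by (auto simp: N_def \<tau>_def)
  \<comment> \<open>The composite of the embedding of \<open>D\<close>, the isomorphism of
    completions and evaluation at the kernel of \<open>\<pi>\<close>.\<close>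
  define \<rho> where "\<rho> x = \<tau> (\<Phi> (profinite_embedding D x) N)" for x
  have \<Phi>_closed: "\<Phi> f \<in> carrier (profinite_completion G)" if "f \<in> carrier (profinite_completion D)" for f
    using \<Phi>(1) that by (auto simp: iso_def hom_def)
  have eval: "f N \<in> carrier (G Mod N)" if "f \<in> carrier (profinite_completion G)" for f
    using that N by (auto simp: carrier_profinite FactGroup_def)
  have "\<rho> \<in> hom D Q"
  proof (rule homI)
    show "\<rho> x \<in> carrier Q" if "x \<in> carrier D" for x
      using \<tau> eval[OF \<Phi>_closed[OF D.profinite_embedding_closed[OF that]]]
      by (auto simp: \<rho>_def iso_def hom_def)
    show "\<rho> (x \<otimes>\<^bsub>D\<^esub> y) = \<rho> x \<otimes>\<^bsub>Q\<^esub> \<rho> y" if "x \<in> carrier D" "y \<in> carrier D" for x y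
    proof -
      note cl = D.profinite_embedding_closed[OF that(1)] D.profinite_embedding_closed[OF that(2)]
      have "\<Phi> (profinite_embedding D (x \<otimes>\<^bsub>D\<^esub> y)) =
          \<Phi> (profinite_embedding D x) \<otimes>\<^bsub>profinite_completion G\<^esub> \<Phi> (profinite_embedding D y)"
        using \<Phi>(1) cl that by (simp add: D.profinite_embedding_mult iso_def hom_def)
      then have "\<Phi> (profinite_embedding D (x \<otimes>\<^bsub>D\<^esub> y)) N =
          \<Phi> (profinite_embedding D x) N \<otimes>\<^bsub>G Mod N\<^esub> \<Phi> (profinite_embedding D y) N"
        using N by (simp add: mult_profinite FactGroup_def)
      then show ?thesis
        using \<tau> eval[OF \<Phi>_closed[OF cl(1)]] eval[OF \<Phi>_closed[OF cl(2)]]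
        by (simp add: \<rho>_def iso_def hom_def)
    qed
  qed
  moreover have "\<exists>x\<in>carrier D. \<rho> x = q" if q: "q \<in> carrier Q" for q
  proof -
    obtain C where C: "C \<in> carrier (G Mod N)" "\<tau> C = q"
      using \<tau> q by (force simp: iso_def bij_betw_def)
    define V where "V = {f \<in> carrier (profinite_completion G). f N = C}"
    have "continuous_map (product_topology (\<lambda>N. discrete_topology (carrier (G Mod N))) (fin_index_normal G))
            (discrete_topology (carrier (G Mod N))) (\<lambda>f. f N)"
      by (rule continuous_map_product_projection[OF N])
    then have "continuous_map (profinite_topology G) (discrete_topology (carrier (G Mod N))) (\<lambda>f. f N)"
      unfolding profinite_topology_def by (rule continuous_map_from_subtopology)
    from openin_continuous_map_preimage[OF this, of "{C}"] have V: "openin (profinite_topology G) V"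
      using C(1) by (simp add: V_def topspace_profinite)
    obtain g where g: "g \<in> carrier G" "C = N #>\<^bsub>G\<^esub> g"
      using C(1) by (auto simp: FactGroup_def RCOSETS_def)
    then have gV: "profinite_embedding G g \<in> V"
      using N by (simp add: V_def G.profinite_embedding_closed) (simp add: profinite_embedding_def)
    define U where "U = {f \<in> topspace (profinite_topology D). \<Phi> f \<in> V}"
    have "openin (profinite_topology D) U"
      unfolding U_def by (rule openin_continuous_map_preimage[OF homeomorphic_imp_continuous_map[OF \<Phi>(2)] V])
    moreover have "U \<noteq> {}"
    proof -
      have "profinite_embedding G g \<in> \<Phi> ` carrier (profinite_completion D)"
        using gV homeomorphic_imp_surjective_map[OF \<Phi>(2)] by (simp add: V_def topspace_profinite)
      then show ?thesis using gV by (auto simp: U_def topspace_profinite)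
    qed
    ultimately obtain x where x: "x \<in> carrier D" "profinite_embedding D x \<in> U"
      using D.profinite_embedding_dense by blast
    then have "\<rho> x = q" using C(2) by (simp add: U_def V_def \<rho>_def)
    then show ?thesis using x(1) by blast
  qed
  ultimately show ?thesis by (intro bexI[of _ \<rho>]) (auto simp: hom_def)
qed

text \<open>The map of completions induced by \<open>\<phi>\<close>: the coordinate at
  \<open>N\<close> is the image of the coordinate at the preimage of \<open>N\<close>.\<close>

definition push_profinite ::
  "('a, 'b) monoid_scheme \<Rightarrow> ('c, 'd) monoid_scheme \<Rightarrow> ('a \<Rightarrow> 'c) \<Rightarrow> ('a set \<Rightarrow> 'a set) \<Rightarrow> 'c set \<Rightarrow> 'c set" where
  "push_profinite D G \<phi> f = (\<lambda>N\<in>fin_index_normal G. \<phi> ` f {x \<in> carrier D. \<phi> x \<in> N})"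

text \<open>An isomorphism together with a two-sided inverse, which makes every lemma about
  \<open>\<phi>\<close> available for \<open>\<psi>\<close> as well (\<open>swap\<close>).\<close>

locale group_iso =
  fixes D :: "('a, 'b) monoid_scheme" and G :: "('c, 'd) monoid_scheme" and \<phi> \<psi>
  assumes D: "group D" and G: "group G" and \<phi>: "\<phi> \<in> hom D G" and \<psi>: "\<psi> \<in> hom G D"
    and \<psi>\<phi>: "\<And>x. x \<in> carrier D \<Longrightarrow> \<psi> (\<phi> x) = x" and \<phi>\<psi>: "\<And>y. y \<in> carrier G \<Longrightarrow> \<phi> (\<psi> y) = y"
begin

lemma swap: "group_iso G D \<psi> \<phi>"
  using D G \<phi> \<psi> \<psi>\<phi> \<phi>\<psi> by (auto simp: group_iso_def)

lemma closed: "x \<in> carrier D \<Longrightarrow> \<phi> x \<in> carrier G" "y \<in> carrier G \<Longrightarrow> \<psi> y \<in> carrier D"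
  using \<phi> \<psi> by (auto simp: hom_def)

lemma preimage_fin_index_normal:
  assumes "N \<in> fin_index_normal G"
  shows "{x \<in> carrier D. \<phi> x \<in> N} \<in> fin_index_normal D"
proof -
  note N = fin_index_normalD[OF assms]
  interpret G: group G by (rule G)
  interpret N: normal N G by (rule N(1))
  have h: "(\<lambda>x. N #>\<^bsub>G\<^esub> \<phi> x) \<in> hom D (G Mod N)"
    using Group.hom_compose[OF \<phi> N.r_coset_hom_Mod] by (simp add: comp_def)
  have s: "(\<lambda>x. N #>\<^bsub>G\<^esub> \<phi> x) ` carrier D = carrier (G Mod N)"
  proof
    show "(\<lambda>x. N #>\<^bsub>G\<^esub> \<phi> x) ` carrier D \<subseteq> carrier (G Mod N)" using h by (auto simp: hom_def)
    show "carrier (G Mod N) \<subseteq> (\<lambda>x. N #>\<^bsub>G\<^esub> \<phi> x) ` carrier D"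
    proof
      fix C assume "C \<in> carrier (G Mod N)"
      then obtain y where "y \<in> carrier G" "C = N #>\<^bsub>G\<^esub> y" by (auto simp: FactGroup_def RCOSETS_def)
      then show "C \<in> (\<lambda>x. N #>\<^bsub>G\<^esub> \<phi> x) ` carrier D"
        using closed \<phi>\<psi> by (intro image_eqI[of _ _ "\<psi> y"]) auto
    qed
  qed
  have "kernel D (G Mod N) (\<lambda>x. N #>\<^bsub>G\<^esub> \<phi> x) = {x \<in> carrier D. \<phi> x \<in> N}"
    using closed G.coset_join1[OF _ _ N(3)] G.coset_join2[OF _ N(3)] subgroup.subset[OF N(3)]
    by (auto simp: kernel_def FactGroup_def)
  then show ?thesis
    using kernel_in_fin_index_normal(1)[OF D N.factorgroup_is_group h s] N(2) by (simp add: FactGroup_def)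
qed

lemma image_rcos:
  assumes "N \<in> fin_index_normal G" "x \<in> carrier D"
  shows "\<phi> ` ({x \<in> carrier D. \<phi> x \<in> N} #>\<^bsub>D\<^esub> x) = N #>\<^bsub>G\<^esub> \<phi> x"
proof -
  have N: "N \<subseteq> carrier G" using fin_index_normalD(3)[OF assms(1)] by (rule subgroup.subset)
  have "\<phi> (n \<otimes>\<^bsub>D\<^esub> x) = \<phi> n \<otimes>\<^bsub>G\<^esub> \<phi> x" if "n \<in> carrier D" for n
    using \<phi> that assms(2) by (simp add: hom_def)
  moreover have "\<exists>m. m \<in> carrier D \<and> \<phi> m = n" if "n \<in> N" for n
    using that N closed(2) \<phi>\<psi> by blast
  ultimately show ?thesis unfolding r_coset_def by (auto simp: image_iff) metis
qed

lemma push_closed: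
  assumes "f \<in> carrier (profinite_completion D)"
  shows "push_profinite D G \<phi> f \<in> carrier (profinite_completion G)"
proof -
  interpret G: group G by (rule G)
  have "\<phi> ` f {x \<in> carrier D. \<phi> x \<in> N} \<in> rcosets\<^bsub>G\<^esub> N" if N: "N \<in> fin_index_normal G" for N
  proof -
    have "f {x \<in> carrier D. \<phi> x \<in> N} \<in> rcosets\<^bsub>D\<^esub> {x \<in> carrier D. \<phi> x \<in> N}"
      using assms preimage_fin_index_normal[OF N] by (auto simp: carrier_profinite)
    then obtain x where "x \<in> carrier D" "f {x \<in> carrier D. \<phi> x \<in> N} = {x \<in> carrier D. \<phi> x \<in> N} #>\<^bsub>D\<^esub> x"
      by (auto simp: RCOSETS_def)
    then show ?thesis
      using image_rcos[OF N] closed(1) subgroup.subset[OF fin_index_normalD(3)[OF N]] by (auto intro: G.rcosetsI)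
  qed
  moreover have "\<phi> ` f {x \<in> carrier D. \<phi> x \<in> N} \<subseteq> \<phi> ` f {x \<in> carrier D. \<phi> x \<in> M}"
    if "N \<in> fin_index_normal G" "M \<in> fin_index_normal G" "N \<subseteq> M" for N M
  proof (rule image_mono)
    have "{x \<in> carrier D. \<phi> x \<in> N} \<subseteq> {x \<in> carrier D. \<phi> x \<in> M}" using that by auto
    then show "f {x \<in> carrier D. \<phi> x \<in> N} \<subseteq> f {x \<in> carrier D. \<phi> x \<in> M}"
      using assms preimage_fin_index_normal that by (auto simp: carrier_profinite)
  qed
  ultimately show ?thesis by (auto simp: carrier_profinite push_profinite_def)
qed

lemma profinite_value_subset:
  assumes "f \<in> carrier (profinite_completion D)" "N \<in> fin_index_normal D"
  shows "f N \<subseteq> carrier D"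
proof -
  interpret D: group D by (rule D)
  have "f N \<in> rcosets\<^bsub>D\<^esub> N" using assms by (auto simp: carrier_profinite)
  then show ?thesis using D.rcosets_part_G fin_index_normalD(3)[OF assms(2)] by blast
qed

lemma push_hom: "push_profinite D G \<phi> \<in> hom (profinite_completion D) (profinite_completion G)"
proof (rule homI[OF push_closed])
  fix f g assume f: "f \<in> carrier (profinite_completion D)" and g: "g \<in> carrier (profinite_completion D)"
  have "\<phi> ` (A <#>\<^bsub>D\<^esub> B) = \<phi> ` A <#>\<^bsub>G\<^esub> \<phi> ` B" if "A \<subseteq> carrier D" "B \<subseteq> carrier D" for A B
  proof -
    have "\<phi> (a \<otimes>\<^bsub>D\<^esub> b) = \<phi> a \<otimes>\<^bsub>G\<^esub> \<phi> b" if "a \<in> A" "b \<in> B" for a b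
      using \<phi> that \<open>A \<subseteq> _\<close> \<open>B \<subseteq> _\<close> by (simp add: hom_def subset_iff)
    then show ?thesis unfolding set_mult_def by (auto simp: image_iff) metis
  qed
  then show "push_profinite D G \<phi> (f \<otimes>\<^bsub>profinite_completion D\<^esub> g) =
      push_profinite D G \<phi> f \<otimes>\<^bsub>profinite_completion G\<^esub> push_profinite D G \<phi> g"
    using preimage_fin_index_normal profinite_value_subset[OF f] profinite_value_subset[OF g]
    by (auto simp: mult_profinite push_profinite_def fun_eq_iff)
qed

lemma push_push:
  assumes "f \<in> carrier (profinite_completion D)"
  shows "push_profinite G D \<psi> (push_profinite D G \<phi> f) = f"
proof
  interpret inv: group_iso G D \<psi> \<phi> by (rule swap)
  fix N
  show "push_profinite G D \<psi> (push_profinite D G \<phi> f) N = f N"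
  proof (cases "N \<in> fin_index_normal D")
    case True
    have N: "N \<subseteq> carrier D" using fin_index_normalD(3)[OF True] by (rule subgroup.subset)
    have "{x \<in> carrier D. \<phi> x \<in> {y \<in> carrier G. \<psi> y \<in> N}} = N"
      using N closed \<psi>\<phi> by auto
    moreover have "\<psi> ` \<phi> ` f N = f N"
      using profinite_value_subset[OF assms True] \<psi>\<phi> by (force simp: image_iff)
    ultimately show ?thesis
      using True inv.preimage_fin_index_normal[OF True] by (simp add: push_profinite_def)
  next
    case False
    then show ?thesis using assms by (auto simp: push_profinite_def carrier_profinite PiE_iff extensional_def)
  qed
qed

text \<open>Each coordinate of the induced map is a coordinate of the argument, followed by a map
  between discrete spaces.\<close>

lemma push_continuous:
  "continuous_map (profinite_topology D) (profinite_topology G) (push_profinite D G \<phi>)"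
proof -
  have "continuous_map (profinite_topology D) (discrete_topology (carrier (G Mod N)))
          (\<lambda>f. push_profinite D G \<phi> f N)" if N: "N \<in> fin_index_normal G" for N
  proof -
    let ?P = "{x \<in> carrier D. \<phi> x \<in> N}"
    have "continuous_map (profinite_topology D) (discrete_topology (carrier (D Mod ?P))) (\<lambda>f. f ?P)"
      unfolding profinite_topology_def
      by (intro continuous_map_from_subtopology continuous_map_product_projection preimage_fin_index_normal N)
    then have c: "openin (profinite_topology D) {f \<in> carrier (profinite_completion D). f ?P \<in> V}"
      if "V \<subseteq> carrier (D Mod ?P)" for V
      using openin_continuous_map_preimage that by (fastforce simp: topspace_profinite)
    have dom: "f ?P \<in> carrier (D Mod ?P)" if "f \<in> carrier (profinite_completion D)" for f
      using that preimage_fin_index_normal[OF N] by (auto simp: carrier_profinite FactGroup_def)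
    show ?thesis
      unfolding continuous_map_def
    proof (intro conjI allI impI)
      show "(\<lambda>f. push_profinite D G \<phi> f N) \<in> topspace (profinite_topology D)
              \<rightarrow> topspace (discrete_topology (carrier (G Mod N)))"
        using push_closed N by (auto simp: topspace_profinite carrier_profinite FactGroup_def)
      fix U
      have "{f \<in> topspace (profinite_topology D). push_profinite D G \<phi> f N \<in> U} =
          {f \<in> carrier (profinite_completion D). f ?P \<in> {C \<in> carrier (D Mod ?P). \<phi> ` C \<in> U}}"
        using N dom by (auto simp: topspace_profinite push_profinite_def)
      then show "openin (profinite_topology D) {f \<in> topspace (profinite_topology D). push_profinite D G \<phi> f N \<in> U}"
        using c[of "{C \<in> carrier (D Mod ?P). \<phi> ` C \<in> U}"] by force
    qed
  qed
  then show ?thesis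
    using push_closed unfolding profinite_topology_def[of G]
    by (auto simp: continuous_map_in_subtopology continuous_map_componentwise topspace_profinite
        push_profinite_def)
qed

text \<open>Functoriality: the maps induced by \<open>\<phi>\<close> and \<open>\<psi>\<close> are
  continuous and inverse to each other.\<close>

theorem iso_profinite: "iso_profinite_completions D G"
proof -
  interpret inv: group_iso G D \<psi> \<phi> by (rule swap)
  have "homeomorphic_maps (profinite_topology D) (profinite_topology G)
      (push_profinite D G \<phi>) (push_profinite G D \<psi>)"
    unfolding homeomorphic_maps_def topspace_profinite
    using push_continuous inv.push_continuous push_push inv.push_push by blast
  then have "homeomorphic_map (profinite_topology D) (profinite_topology G) (push_profinite D G \<phi>)"
    by (rule homeomorphic_maps_map[THEN iffD1, THEN conjunct1])
  moreover have "bij_betw (push_profinite D G \<phi>) (carrier (profinite_completion D)) (carrier (profinite_completion G))"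
    by (rule bij_betwI[where g = "push_profinite G D \<psi>"])
      (use push_closed inv.push_closed push_push inv.push_push in auto)
  ultimately show ?thesis
    unfolding iso_profinite_completions_def iso_def using push_hom by blast
qed

end


section \<open>Presented groups and the Heisenberg group over \<open>\<int>[t]/t\<^sup>2\<close>\<close>

lemma equiv_word_cong: "equiv UNIV (word_cong R)"
  by (auto intro!: equivI refl_onI symI transI word_cong.refl intro: word_cong.sym word_cong.trans)

lemma word_cong_context:
  assumes "(u, v) \<in> word_cong R"
  shows "(p @ u @ q, p @ v @ q) \<in> word_cong R"
  using assms
proof induction
  case (cancel u a e v)
  then show ?case using word_cong.cancel[of "p @ u" a e "v @ q" R] by simp
next
  case (rel r s u v)
  then show ?case using word_cong.rel[of r s R "p @ u" "v @ q"] by simp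
qed (auto intro: word_cong.intros)

lemma word_cong_append:
  assumes "(u, u') \<in> word_cong R" "(v, v') \<in> word_cong R"
  shows "(u @ v, u' @ v') \<in> word_cong R"
  using word_cong_context[OF assms(1), of "[]" v] word_cong_context[OF assms(2), of u' "[]"]
  by (auto intro: word_cong.trans)

definition word_class :: "('g word \<times> 'g word) set \<Rightarrow> 'g word \<Rightarrow> 'g word set" where
  "word_class R w = word_cong R `` {w}"

lemma word_class_eq_iff: "word_class R u = word_class R v \<longleftrightarrow> (u, v) \<in> word_cong R"
  unfolding word_class_def using eq_equiv_class_iff[OF equiv_word_cong] by blast

lemma carrier_presented: "carrier (presented_group R) = range (word_class R)"
  by (auto simp: presented_group_def quotient_def word_class_def)

lemma word_class_closed [simp]: "word_class R w \<in> carrier (presented_group R)"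
  by (simp add: carrier_presented)

lemma one_presented: "\<one>\<^bsub>presented_group R\<^esub> = word_class R []"
  by (simp add: presented_group_def word_class_def)

lemma mult_presented:
  "word_class R u \<otimes>\<^bsub>presented_group R\<^esub> word_class R v = word_class R (u @ v)"
proof -
  have "word_class R (u' @ v') = word_class R (u @ v)"
    if "u' \<in> word_class R u" "v' \<in> word_class R v" for u' v'
    using that word_cong_append[of u u' R v v'] word_class_eq_iff by (auto simp: word_class_def)
  moreover have "u \<in> word_class R u" "v \<in> word_class R v"
    by (auto simp: word_class_def word_cong.refl)
  ultimately have "(\<Union>u'\<in>word_class R u. \<Union>v'\<in>word_class R v. word_class R (u' @ v')) = word_class R (u @ v)"
    by blast
  then show ?thesis by (simp add: presented_group_def word_class_def)
qed

definition inv_word :: "'g word \<Rightarrow> 'g word" where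
  "inv_word w = rev (map (\<lambda>(a, e). (a, \<not> e)) w)"

lemma inv_word_cong: "(inv_word w @ w, []) \<in> word_cong R"
proof (induction w)
  case (Cons l w)
  obtain a e where l: "l = (a, e)" by force
  have "(inv_word w @ [(a, \<not> e), (a, \<not> \<not> e)] @ w, inv_word w @ w) \<in> word_cong R"
    using word_cong.cancel[of "inv_word w" a "\<not> e" w R] by simp
  then show ?case using Cons word_cong.trans by (fastforce simp: inv_word_def l)
qed (simp add: inv_word_def word_cong.refl)

lemma group_presented: "group (presented_group R)"
proof (rule groupI)
  fix x assume "x \<in> carrier (presented_group R)"
  then obtain w where w: "x = word_class R w" by (auto simp: carrier_presented)
  have "word_class R (inv_word w) \<otimes>\<^bsub>presented_group R\<^esub> x = \<one>\<^bsub>presented_group R\<^esub>"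
    by (simp add: w mult_presented one_presented word_class_eq_iff inv_word_cong)
  then show "\<exists>y\<in>carrier (presented_group R). y \<otimes>\<^bsub>presented_group R\<^esub> x = \<one>\<^bsub>presented_group R\<^esub>"
    using word_class_closed by blast
qed (auto simp: carrier_presented mult_presented one_presented)

definition word_eval :: "('h, 'm) monoid_scheme \<Rightarrow> ('g \<Rightarrow> 'h) \<Rightarrow> 'g word \<Rightarrow> 'h" where
  "word_eval H \<phi> w = foldr (\<lambda>(a, e) x. (if e then \<phi> a else inv\<^bsub>H\<^esub> \<phi> a) \<otimes>\<^bsub>H\<^esub> x) w \<one>\<^bsub>H\<^esub>"

lemma word_eval_simps [simp]:
  "word_eval H \<phi> [] = \<one>\<^bsub>H\<^esub>"
  "word_eval H \<phi> ((a, e) # w) = (if e then \<phi> a else inv\<^bsub>H\<^esub> \<phi> a) \<otimes>\<^bsub>H\<^esub> word_eval H \<phi> w"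
  by (auto simp: word_eval_def)

context group
begin

lemma word_eval_closed: "range \<phi> \<subseteq> carrier G \<Longrightarrow> word_eval G \<phi> w \<in> carrier G"
  by (induction w) (auto simp: image_subset_iff)

lemma word_eval_append:
  assumes "range \<phi> \<subseteq> carrier G"
  shows "word_eval G \<phi> (u @ v) = word_eval G \<phi> u \<otimes> word_eval G \<phi> v"
proof (induction u)
  case (Cons l u)
  then show ?case using assms word_eval_closed[OF assms] by (cases l) (auto simp: m_assoc image_subset_iff)
qed (use word_eval_closed[OF assms] in simp)

text \<open>The pairs of words with equal value form a congruence that contains the free
  cancellations and the relations, hence the generated one.\<close>

lemma word_eval_cong:
  assumes \<phi>: "range \<phi> \<subseteq> carrier G"
    and R: "\<And>r s. (r, s) \<in> R \<Longrightarrow> word_eval G \<phi> r = word_eval G \<phi> s"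
    and uv: "(u, v) \<in> word_cong R"
  shows "word_eval G \<phi> u = word_eval G \<phi> v"
  using uv
proof induction
  case (cancel u a e v)
  have "\<phi> a \<in> carrier G" using \<phi> by auto
  then have "word_eval G \<phi> ([(a, e), (a, \<not> e)] @ v) = word_eval G \<phi> v"
    using word_eval_closed[OF \<phi>] by (cases e) (simp_all add: m_assoc[symmetric])
  then show ?case using word_eval_append[OF \<phi>] by simp
qed (auto simp: word_eval_append[OF \<phi>] R)

text \<open>The choice of a representing word is immaterial as soon as the relations hold in the
  target (\<open>presented_lift_word_class\<close>).\<close>

definition presented_lift :: "('g word \<times> 'g word) set \<Rightarrow> ('g \<Rightarrow> 'a) \<Rightarrow> 'g word set \<Rightarrow> 'a" where
  "presented_lift R \<phi> C = word_eval G \<phi> (SOME w. w \<in> C)"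

lemma presented_lift_word_class:
  assumes "range \<phi> \<subseteq> carrier G" "\<And>r s. (r, s) \<in> R \<Longrightarrow> word_eval G \<phi> r = word_eval G \<phi> s"
  shows "presented_lift R \<phi> (word_class R w) = word_eval G \<phi> w"
proof -
  have "w \<in> word_class R w" by (auto simp: word_class_def word_cong.refl)
  then have "(SOME u. u \<in> word_class R w) \<in> word_class R w" by (rule someI)
  then have "(w, SOME u. u \<in> word_class R w) \<in> word_cong R" by (simp add: word_class_def)
  then show ?thesis using word_eval_cong[OF assms] by (simp add: presented_lift_def)
qed

lemma presented_lift_hom:
  assumes "range \<phi> \<subseteq> carrier G" "\<And>r s. (r, s) \<in> R \<Longrightarrow> word_eval G \<phi> r = word_eval G \<phi> s"
  shows "presented_lift R \<phi> \<in> hom (presented_group R) G"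
  using presented_lift_word_class[OF assms] word_eval_closed[OF assms(1)] word_eval_append[OF assms(1)]
  by (auto simp: hom_def carrier_presented mult_presented)

end

lemma word_class_eq_word_eval:
  "word_class R w = word_eval (presented_group R) (\<lambda>a. word_class R (gen a)) w"
proof (induction w)
  case Nil
  then show ?case by (simp add: one_presented)
next
  case (Cons l w)
  interpret group "presented_group R" by (rule group_presented)
  obtain a e where l: "l = (a, e)" by force
  have "word_class R [(a, False)] = inv\<^bsub>presented_group R\<^esub> word_class R (gen a)"
  proof (rule inv_equality[symmetric])
    show "word_class R [(a, False)] \<otimes>\<^bsub>presented_group R\<^esub> word_class R (gen a) = \<one>\<^bsub>presented_group R\<^esub>"
      using word_cong.cancel[of "[]" a False "[]" R]
      by (simp add: gen_def mult_presented one_presented word_class_eq_iff)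
  qed auto
  then have "word_class R [(a, e)] = (if e then word_class R (gen a) else inv\<^bsub>presented_group R\<^esub> word_class R (gen a))"
    by (auto simp: gen_def)
  moreover have "word_class R (l # w) = word_class R [(a, e)] \<otimes>\<^bsub>presented_group R\<^esub> word_class R w"
    by (simp add: mult_presented l)
  ultimately show ?case using Cons by (simp add: l)
qed

lemma presented_relation:
  assumes "(r, s) \<in> R"
  shows "word_eval (presented_group R) (\<lambda>a. word_class R (gen a)) r =
         word_eval (presented_group R) (\<lambda>a. word_class R (gen a)) s"
proof -
  have "(r, s) \<in> word_cong R" using word_cong.rel[OF assms, of "[]" "[]"] by simp
  then show ?thesis using word_class_eq_iff word_class_eq_word_eval by metis
qed

text \<open>A word is a product of letters, so a subgroup containing the generators is everything.
  This reduces statements about all elements of a presented group to its generators.\<close>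

lemma presented_generated:
  assumes "subgroup K (presented_group R)" "\<And>a. word_class R (gen a) \<in> K"
  shows "K = carrier (presented_group R)"
proof -
  have "word_class R w \<in> K" for w
  proof (induction w)
    case Nil
    then show ?case using subgroup.one_closed[OF assms(1)] by (simp add: one_presented)
  next
    case (Cons l w)
    have "word_class R (l # w) = (if snd l then word_class R (gen (fst l))
       else inv\<^bsub>presented_group R\<^esub> word_class R (gen (fst l))) \<otimes>\<^bsub>presented_group R\<^esub> word_class R w"
      by (cases l) (simp add: word_class_eq_word_eval[of R "_ # w"] word_class_eq_word_eval[of R w])
    then show ?case using Cons assms by (auto intro: subgroup.m_closed subgroup.m_inv_closed)
  qed
  then show ?thesis using subgroup.subset[OF assms(1)] by (auto simp: carrier_presented)
qed

text \<open>The tuple \<open>(u1, u2, v1, v2, w2, w1)\<close> stands for the unitriangular matrix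
  over \<open>\<int>[t]/t\<^sup>2\<close> with entries \<open>\<alpha> = u1 + v1 t\<close>,
  \<open>\<beta> = u2 + v2 t\<close> and corner \<open>\<gamma> = w2 + w1 t\<close>. The coordinates
  are ordered by depth, so that the last two form the centre and the last four the subgroup where
  \<open>\<alpha>\<close> and \<open>\<beta>\<close> are multiples of \<open>t\<close>; subgroups are
  triangular with respect to this order.\<close>

type_synonym heis = "int \<times> int \<times> int \<times> int \<times> int \<times> int"

fun hmul :: "heis \<Rightarrow> heis \<Rightarrow> heis" where
  "hmul (u1, u2, v1, v2, w2, w1) (u1', u2', v1', v2', w2', w1') =
     (u1 + u1', u2 + u2', v1 + v1', v2 + v2', w2 + w2' + u1 * u2', w1 + w1' + u1 * v2' + v1 * u2')"

fun hinv :: "heis \<Rightarrow> heis" where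
  "hinv (u1, u2, v1, v2, w2, w1) = (- u1, - u2, - v1, - v2, - w2 + u1 * u2, - w1 + u1 * v2 + v1 * u2)"

abbreviation hone :: heis where "hone \<equiv> (0, 0, 0, 0, 0, 0)"

definition heis_group :: "heis monoid" where
  "heis_group = \<lparr>carrier = UNIV, monoid.mult = hmul, one = hone\<rparr>"

lemma heis_group_simps [simp]:
  "carrier heis_group = UNIV" "x \<otimes>\<^bsub>heis_group\<^esub> y = hmul x y" "\<one>\<^bsub>heis_group\<^esub> = hone"
  by (auto simp: heis_group_def)

lemma hmul_assoc: "hmul (hmul x y) z = hmul x (hmul y z)"
  by (cases x rule: prod_cases6; cases y rule: prod_cases6; cases z rule: prod_cases6) (simp add: algebra_simps)

lemma hmul_one [simp]: "hmul hone x = x" "hmul x hone = x"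
  by (cases x rule: prod_cases6; simp)+

lemma hmul_hinv [simp]: "hmul (hinv x) x = hone" "hmul x (hinv x) = hone"
  by (cases x rule: prod_cases6; simp add: algebra_simps)+

lemma group_heis: "group heis_group"
proof (rule groupI)
  show "\<exists>y\<in>carrier heis_group. y \<otimes>\<^bsub>heis_group\<^esub> x = \<one>\<^bsub>heis_group\<^esub>" for x
    by (rule bexI[of _ "hinv x"]) auto
qed (auto simp: hmul_assoc)

interpretation heis: group heis_group by (rule group_heis)

lemma heis_inv [simp]: "inv\<^bsub>heis_group\<^esub> x = hinv x"
  by (rule heis.inv_equality) auto

text \<open>A family that turns addition into multiplication is the family of powers of its value at
  1.\<close>

lemma (in group) int_pow_eqI:
  assumes "\<And>i j :: int. f (i + j) = f i \<otimes> f j" "\<And>i. f i \<in> carrier G"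
  shows "f 1 [^] i = f i"
proof -
  have "f 0 \<otimes> f 0 = f 0 \<otimes> \<one>" using assms(1)[of 0 0] assms(2) by simp
  then have f0: "f 0 = \<one>" using assms(2) by (metis one_closed inv_solve_left l_inv r_one)
  show ?thesis
  proof (induction i rule: int_induct[where k = 0])
    case (step1 i)
    then show ?case using assms int_pow_mult[of "f 1" i 1] by simp
  next
    case (step2 i)
    have "f (i - 1) = f i \<otimes> inv f 1"
      using assms(1)[of "i - 1" 1] assms(2) by (metis diff_add_cancel inv_solve_right')
    then show ?case using step2 assms(2) int_pow_diff[of "f 1" i 1] by simp
  qed (simp add: f0)
qed

lemma (in group) conj_hom:
  assumes "g \<in> carrier G"
  shows "(\<lambda>x. inv g \<otimes> x \<otimes> g) \<in> hom G G"
proof (rule homI)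
  fix x y assume xy: "x \<in> carrier G" "y \<in> carrier G"
  have "g \<otimes> (inv g \<otimes> (y \<otimes> g)) = y \<otimes> g" using xy assms by (simp add: m_assoc[symmetric])
  then show "inv g \<otimes> (x \<otimes> y) \<otimes> g = inv g \<otimes> x \<otimes> g \<otimes> (inv g \<otimes> y \<otimes> g)"
    using xy assms by (simp add: m_assoc)
qed (use assms in auto)

lemma (in group) conj_int_pow:
  assumes "a \<in> carrier G" "b \<in> carrier G" "d \<in> carrier G" "a \<otimes> b = b \<otimes> d"
  shows "a [^] (i :: int) \<otimes> b = b \<otimes> d [^] i"
proof -
  have "inv b \<otimes> a \<otimes> b = d" using assms by (simp add: m_assoc inv_solve_left')
  then have "inv b \<otimes> a [^] i \<otimes> b = d [^] i"
    using hom_int_pow[OF conj_hom[OF assms(2)] assms(1)] is_group by simp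
  moreover have "b \<otimes> (inv b \<otimes> (a [^] i \<otimes> b)) = a [^] i \<otimes> b"
    using assms by (simp add: m_assoc[symmetric])
  ultimately show ?thesis using assms by (simp add: m_assoc)
qed

lemma (in group) commute_int_pow:
  assumes "a \<in> carrier G" "b \<in> carrier G" "a \<otimes> b = b \<otimes> a"
  shows "a [^] (i :: int) \<otimes> b [^] (j :: int) = b [^] j \<otimes> a [^] i"
  using conj_int_pow[of b "a [^] i" b j] conj_int_pow[of a b a i] assms by simp

text \<open>The identity \<open>[a\<^sup>i, b\<^sup>j] = c\<^bsup>i j\<^esup>\<close> for a central
  commutator \<open>c = [a, b]\<close>, stated without inverses so that it can be used to move powers
  past each other.\<close>

lemma (in group) commutator_int_pow:
  assumes "a \<in> carrier G" "b \<in> carrier G" "c \<in> carrier G"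
    and ab: "a \<otimes> b = b \<otimes> a \<otimes> c" and ca: "c \<otimes> a = a \<otimes> c" and cb: "c \<otimes> b = b \<otimes> c"
  shows "a [^] (i :: int) \<otimes> b [^] (j :: int) = b [^] j \<otimes> a [^] i \<otimes> c [^] (i * j)"
proof -
  let ?A = "a [^] i" and ?C = "c [^] i"
  have cl: "?A \<in> carrier G" "?C \<in> carrier G" using assms by auto
  have "?A \<otimes> b = b \<otimes> (a \<otimes> c) [^] i" using conj_int_pow[of a b "a \<otimes> c"] ab assms(1-3) by (simp add: m_assoc)
  also have "(a \<otimes> c) [^] i = ?C \<otimes> ?A"
    using int_pow_mult_distrib[of a c i] commute_int_pow[OF assms(3,1) ca, of i i] ca assms(1-3) by simp
  finally have "b \<otimes> ?C \<otimes> ?A = ?A \<otimes> b" using cl assms(2) by (simp add: m_assoc)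
  then have "(b \<otimes> ?C) [^] j \<otimes> ?A = ?A \<otimes> b [^] j"
    using conj_int_pow[of "b \<otimes> ?C" ?A b j] cl assms(2) by simp
  moreover have "(b \<otimes> ?C) [^] j = b [^] j \<otimes> c [^] (i * j)"
    using int_pow_mult_distrib[of b ?C j] commute_int_pow[OF assms(3,2) cb, of i 1] cl assms(2,3)
    by (simp add: int_pow_pow)
  moreover have "c [^] (i * j) \<otimes> ?A = ?A \<otimes> c [^] (i * j)" using commute_int_pow[OF assms(3,1) ca] .
  ultimately show ?thesis using assms(1-3) cl by (simp add: m_assoc)
qed

text \<open>Elements of an arbitrary group that satisfy the defining relations of
  \<open>\<Gamma>\<close>, rewritten as rules for exchanging factors.\<close>

locale heis_relations = group G for G (structure) +
  fixes x1 x2 y1 y2 z1 z2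
  assumes carr [simp]: "x1 \<in> carrier G" "x2 \<in> carrier G" "y1 \<in> carrier G" "y2 \<in> carrier G"
      "z1 \<in> carrier G" "z2 \<in> carrier G"
    and x1y1: "x1 \<otimes> y1 = y1 \<otimes> x1 \<otimes> z1" and x2y2: "x2 \<otimes> y2 = y2 \<otimes> x2 \<otimes> z1"
    and x1y2: "x1 \<otimes> y2 = y2 \<otimes> x1 \<otimes> z2" and x2y1: "x2 \<otimes> y1 = y1 \<otimes> x2"
    and x1x2: "x1 \<otimes> x2 = x2 \<otimes> x1" and y1y2: "y1 \<otimes> y2 = y2 \<otimes> y1"
    and central: "\<And>g. g \<in> carrier G \<Longrightarrow> z1 \<otimes> g = g \<otimes> z1" "\<And>g. g \<in> carrier G \<Longrightarrow> z2 \<otimes> g = g \<otimes> z2"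
begin

text \<open>For pairs of exponents these are \<open>z\<^sup>\<gamma>\<close>,
  \<open>x\<^sup>\<alpha>\<close> and \<open>y\<^sup>\<beta>\<close>, where a pair stands for an
  element of \<open>\<int>[t]/t\<^sup>2\<close>; note the order \<open>y2\<close>, \<open>y1\<close>
  and \<open>z2\<close>, \<open>z1\<close>.\<close>

definition "zz \<gamma> = z2 [^] (fst \<gamma> :: int) \<otimes> z1 [^] (snd \<gamma> :: int)"
definition "xx \<alpha> = x1 [^] (fst \<alpha> :: int) \<otimes> x2 [^] (snd \<alpha> :: int)"
definition "yy \<beta> = y2 [^] (fst \<beta> :: int) \<otimes> y1 [^] (snd \<beta> :: int)"

lemma closed [simp]: "zz \<gamma> \<in> carrier G" "xx \<alpha> \<in> carrier G" "yy \<beta> \<in> carrier G"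
  by (auto simp: zz_def xx_def yy_def)

lemma pair_pow_add:
  assumes "a \<in> carrier G" "b \<in> carrier G" "a \<otimes> b = b \<otimes> a"
  shows "a [^] (i + i' :: int) \<otimes> b [^] (j + j' :: int) =
         (a [^] i \<otimes> b [^] j) \<otimes> (a [^] i' \<otimes> b [^] j')"
proof -
  have "b [^] j \<otimes> (a [^] i' \<otimes> b [^] j') = a [^] i' \<otimes> (b [^] j \<otimes> b [^] j')"
    using commute_int_pow[OF assms, of i' j] assms by (metis m_assoc int_pow_closed)
  then show ?thesis using assms by (simp add: int_pow_mult m_assoc)
qed

lemma pairs_add:
  "zz (\<gamma> + \<gamma>') = zz \<gamma> \<otimes> zz \<gamma>'" "xx (\<gamma> + \<gamma>') = xx \<gamma> \<otimes> xx \<gamma>'" "yy (\<gamma> + \<gamma>') = yy \<gamma> \<otimes> yy \<gamma>'"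
  unfolding zz_def xx_def yy_def fst_add snd_add
  by (rule pair_pow_add, simp, simp, rule central(2), simp)
    (rule pair_pow_add, simp, simp, rule x1x2, rule pair_pow_add, simp, simp, rule y1y2[symmetric])

lemma zpow_central:
  assumes "g \<in> carrier G"
  shows "z1 [^] (i :: int) \<otimes> g = g \<otimes> z1 [^] i" "z2 [^] (i :: int) \<otimes> g = g \<otimes> z2 [^] i"
  using commute_int_pow[of z1 g i 1] commute_int_pow[of z2 g i 1] central assms by auto

lemma zz_central:
  assumes "g \<in> carrier G" shows "zz \<gamma> \<otimes> g = g \<otimes> zz \<gamma>"
  using zpow_central[OF assms] assms unfolding zz_def by (metis m_assoc int_pow_closed carr(5,6))

lemma zz_left_commute:
  assumes "g \<in> carrier G" "h \<in> carrier G" shows "zz \<gamma> \<otimes> (g \<otimes> h) = g \<otimes> (zz \<gamma> \<otimes> h)"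
  using zz_central[OF assms(1)] assms by (metis m_assoc closed(1))

text \<open>The relations of \<open>\<Gamma>\<close> in one line: \<open>[x\<^sup>\<alpha>,
  y\<^sup>\<beta>] = z\<^bsup>\<alpha> \<beta>\<^esup>\<close>, with the product taken in
  \<open>\<int>[t]/t\<^sup>2\<close>.\<close>

lemma xx_yy: "xx (a, b) \<otimes> yy (c, d) = yy (c, d) \<otimes> xx (a, b) \<otimes> zz (a * c, a * d + b * c)"
proof -
  let ?x1 = "x1 [^] a" and ?x2 = "x2 [^] b" and ?y2 = "y2 [^] c" and ?y1 = "y1 [^] d"
  have e: "?x2 \<otimes> ?y2 = ?y2 \<otimes> ?x2 \<otimes> zz (0, b * c)" "?x1 \<otimes> ?y2 = ?y2 \<otimes> ?x1 \<otimes> zz (a * c, 0)"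
    "?x1 \<otimes> ?y1 = ?y1 \<otimes> ?x1 \<otimes> zz (0, a * d)" "?x2 \<otimes> ?y1 = ?y1 \<otimes> ?x2"
    using commutator_int_pow[OF _ _ _ x2y2] commutator_int_pow[OF _ _ _ x1y2]
      commutator_int_pow[OF _ _ _ x1y1] commute_int_pow[OF _ _ x2y1] central
    by (simp_all add: zz_def)
  have cl: "?x1 \<in> carrier G" "?x2 \<in> carrier G" "?y1 \<in> carrier G" "?y2 \<in> carrier G" by auto
  have "xx (a, b) \<otimes> yy (c, d) = ?x1 \<otimes> (?x2 \<otimes> ?y2) \<otimes> ?y1" by (simp add: xx_def yy_def m_assoc)
  also have "\<dots> = ?x1 \<otimes> ?y2 \<otimes> (?x2 \<otimes> ?y1) \<otimes> zz (0, b * c)"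
    unfolding e(1) using zz_central[of ?y1] by (simp add: m_assoc)
  also have "\<dots> = ?y2 \<otimes> (?x1 \<otimes> ?y1) \<otimes> ?x2 \<otimes> zz (a * c, 0) \<otimes> zz (0, b * c)"
    unfolding e(2) e(4) using zz_left_commute[of ?y1 "?x2 \<otimes> zz (0, b * c)"]
      zz_left_commute[of ?x2 "zz (0, b * c)"] by (simp add: m_assoc)
  also have "\<dots> = ?y2 \<otimes> ?y1 \<otimes> (?x1 \<otimes> ?x2) \<otimes> (zz (0, a * d) \<otimes> zz (a * c, 0) \<otimes> zz (0, b * c))"
    unfolding e(3) using zz_left_commute[of ?x2] by (simp add: m_assoc)
  also have "zz (0, a * d) \<otimes> zz (a * c, 0) \<otimes> zz (0, b * c) = zz (a * c, a * d + b * c)"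
    by (simp add: pairs_add(1)[symmetric])
  finally show ?thesis by (simp add: xx_def yy_def)
qed

text \<open>Every element of \<open>\<Gamma>\<close> can be collected as \<open>y\<^sup>\<beta>
  x\<^sup>\<alpha> z\<^sup>\<gamma>\<close>. Placing \<open>y\<close> first makes the cross term of a
  product equal to \<open>\<alpha> \<beta>'\<close>, as in \<open>hmul\<close>.\<close>

fun normal_form :: "heis \<Rightarrow> 'a" where
  "normal_form (u1, u2, v1, v2, w2, w1) = yy (u2, v2) \<otimes> xx (u1, v1) \<otimes> zz (w2, w1)"

lemma normal_form_hom: "normal_form \<in> hom heis_group G"
proof (rule homI)
  fix g h :: heis
  obtain u1 u2 v1 v2 w2 w1 where g: "g = (u1, u2, v1, v2, w2, w1)" using prod_cases6 by blast
  obtain u1' u2' v1' v2' w2' w1' where h: "h = (u1', u2', v1', v2', w2', w1')" using prod_cases6 by blast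
  let ?K = "zz (u1 * u2', u1 * v2' + v1 * u2')"
  have "normal_form g \<otimes> normal_form h =
      yy (u2, v2) \<otimes> (xx (u1, v1) \<otimes> yy (u2', v2')) \<otimes> xx (u1', v1') \<otimes> (zz (w2, w1) \<otimes> zz (w2', w1'))"
    using zz_left_commute[of "yy (u2', v2')" "xx (u1', v1') \<otimes> zz (w2', w1')"]
      zz_left_commute[of "xx (u1', v1')" "zz (w2', w1')"] by (simp add: g h m_assoc)
  also have "\<dots> = (yy (u2, v2) \<otimes> yy (u2', v2')) \<otimes> (xx (u1, v1) \<otimes> xx (u1', v1'))
      \<otimes> (?K \<otimes> (zz (w2, w1) \<otimes> zz (w2', w1')))"
    unfolding xx_yy using zz_left_commute[of "xx (u1', v1')"] by (simp add: m_assoc)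
  also have "\<dots> = normal_form (hmul g h)"
    by (simp add: g h pairs_add[symmetric] add_ac)
  finally show "normal_form (g \<otimes>\<^bsub>heis_group\<^esub> h) = normal_form g \<otimes> normal_form h" by simp
qed (auto simp: split_paired_all)

end

lemma heis_pow:
  "(1, 0, 0, 0, 0, 0) [^]\<^bsub>heis_group\<^esub> (i :: int) = (i, 0, 0, 0, 0, 0)"
  "(0, 1, 0, 0, 0, 0) [^]\<^bsub>heis_group\<^esub> i = (0, i, 0, 0, 0, 0)"
  "(0, 0, 1, 0, 0, 0) [^]\<^bsub>heis_group\<^esub> i = (0, 0, i, 0, 0, 0)"
  "(0, 0, 0, 1, 0, 0) [^]\<^bsub>heis_group\<^esub> i = (0, 0, 0, i, 0, 0)"
  "(0, 0, 0, 0, 1, 0) [^]\<^bsub>heis_group\<^esub> i = (0, 0, 0, 0, i, 0)"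
  "(0, 0, 0, 0, 0, 1) [^]\<^bsub>heis_group\<^esub> i = (0, 0, 0, 0, 0, i)"
  by (rule heis.int_pow_eqI[where f = "\<lambda>i. (i, 0, 0, 0, 0, 0)"]
      heis.int_pow_eqI[where f = "\<lambda>i. (0, i, 0, 0, 0, 0)"]
      heis.int_pow_eqI[where f = "\<lambda>i. (0, 0, i, 0, 0, 0)"]
      heis.int_pow_eqI[where f = "\<lambda>i. (0, 0, 0, i, 0, 0)"]
      heis.int_pow_eqI[where f = "\<lambda>i. (0, 0, 0, 0, i, 0)"]
      heis.int_pow_eqI[where f = "\<lambda>i. (0, 0, 0, 0, 0, i)"]; simp)+

fun heis_gen :: "generator \<Rightarrow> heis" where
  "heis_gen (X One) = (1, 0, 0, 0, 0, 0)"
| "heis_gen (Y Two) = (0, 1, 0, 0, 0, 0)"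
| "heis_gen (X Two) = (0, 0, 1, 0, 0, 0)"
| "heis_gen (Y One) = (0, 0, 0, 1, 0, 0)"
| "heis_gen (Z Two) = (0, 0, 0, 0, 1, 0)"
| "heis_gen (Z One) = (0, 0, 0, 0, 0, 1)"

lemma heis_gen_relations:
  assumes "(r, s) \<in> \<Gamma>_rels"
  shows "word_eval heis_group heis_gen r = word_eval heis_group heis_gen s"
proof -
  have "heis_gen (X i) = (if i = One then (1, 0, 0, 0, 0, 0) else (0, 0, 1, 0, 0, 0))"
    "heis_gen (Y i) = (if i = One then (0, 0, 0, 1, 0, 0) else (0, 1, 0, 0, 0, 0))"
    "heis_gen (Z i) = (if i = One then (0, 0, 0, 0, 0, 1) else (0, 0, 0, 0, 1, 0))" for i
    by (cases i; simp)+
  then show ?thesis using assms unfolding \<Gamma>_rels_def by (auto simp: comm_def gen_def)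
qed

text \<open>Only the commutators of \<open>z\<^sub>i\<close> with the generators are relations.
  Centrality in the whole group follows because the centralizer of \<open>z\<^sub>i\<close> is a
  subgroup that contains the generators.\<close>

lemma \<Gamma>_t2_heis_relations:
  defines "g \<equiv> \<lambda>a. word_class \<Gamma>_rels (gen a)"
  shows "heis_relations \<Gamma>_t2 (g (X One)) (g (X Two)) (g (Y One)) (g (Y Two)) (g (Z One)) (g (Z Two))"
proof -
  interpret group \<Gamma>_t2 unfolding \<Gamma>_t2_def by (rule group_presented)
  have cl [simp]: "g a \<in> carrier \<Gamma>_t2" for a by (simp add: g_def \<Gamma>_t2_def)
  have rel: "word_eval \<Gamma>_t2 g r = word_eval \<Gamma>_t2 g s" if "(r, s) \<in> \<Gamma>_rels" for r s
    using presented_relation[OF that] by (simp add: \<Gamma>_t2_def g_def)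
  have comm: "g a \<otimes>\<^bsub>\<Gamma>_t2\<^esub> g b = g b \<otimes>\<^bsub>\<Gamma>_t2\<^esub> g a \<otimes>\<^bsub>\<Gamma>_t2\<^esub> word_eval \<Gamma>_t2 g w" if "(comm a b, w) \<in> \<Gamma>_rels" for a b w
  proof -
    have "inv\<^bsub>\<Gamma>_t2\<^esub> g a \<otimes>\<^bsub>\<Gamma>_t2\<^esub> (inv\<^bsub>\<Gamma>_t2\<^esub> g b \<otimes>\<^bsub>\<Gamma>_t2\<^esub> (g a \<otimes>\<^bsub>\<Gamma>_t2\<^esub> g b)) = word_eval \<Gamma>_t2 g w"
      using rel[OF that] by (simp add: comm_def)
    then show ?thesis by (metis cl inv_closed inv_solve_left m_assoc m_closed)
  qed
  have commute: "g a \<otimes>\<^bsub>\<Gamma>_t2\<^esub> g b = g b \<otimes>\<^bsub>\<Gamma>_t2\<^esub> g a" if "(comm a b, []) \<in> \<Gamma>_rels" for a b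
    using comm[OF that] by simp
  have central: "g (Z i) \<otimes>\<^bsub>\<Gamma>_t2\<^esub> h = h \<otimes>\<^bsub>\<Gamma>_t2\<^esub> g (Z i)" if h: "h \<in> carrier \<Gamma>_t2" for i h
  proof -
    have "g (Z i) \<otimes>\<^bsub>\<Gamma>_t2\<^esub> g a = g a \<otimes>\<^bsub>\<Gamma>_t2\<^esub> g (Z i)" for a
    proof (cases a)
      case (X j)
      then show ?thesis using commute[of "X j" "Z i"] by (auto simp: \<Gamma>_rels_def)
    next
      case (Y j)
      then show ?thesis using commute[of "Y j" "Z i"] by (auto simp: \<Gamma>_rels_def)
    next
      case (Z j)
      have "g (Z One) \<otimes>\<^bsub>\<Gamma>_t2\<^esub> g (Z Two) = g (Z Two) \<otimes>\<^bsub>\<Gamma>_t2\<^esub> g (Z One)"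
        by (rule commute) (auto simp: \<Gamma>_rels_def)
      then show ?thesis using Z by (cases i; cases j) auto
    qed
    moreover have "subgroup {h \<in> carrier \<Gamma>_t2. g (Z i) \<otimes>\<^bsub>\<Gamma>_t2\<^esub> h = h \<otimes>\<^bsub>\<Gamma>_t2\<^esub> g (Z i)} \<Gamma>_t2"
    proof (rule subgroupI)
      fix a assume a: "a \<in> {h \<in> carrier \<Gamma>_t2. g (Z i) \<otimes>\<^bsub>\<Gamma>_t2\<^esub> h = h \<otimes>\<^bsub>\<Gamma>_t2\<^esub> g (Z i)}"
      then have "inv\<^bsub>\<Gamma>_t2\<^esub> a \<otimes>\<^bsub>\<Gamma>_t2\<^esub> (g (Z i) \<otimes>\<^bsub>\<Gamma>_t2\<^esub> a) = g (Z i)"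
        by (auto simp: inv_solve_left')
      then have "inv\<^bsub>\<Gamma>_t2\<^esub> a \<otimes>\<^bsub>\<Gamma>_t2\<^esub> g (Z i) = g (Z i) \<otimes>\<^bsub>\<Gamma>_t2\<^esub> inv\<^bsub>\<Gamma>_t2\<^esub> a"
        using a by (metis (no_types, lifting) cl inv_closed inv_solve_right m_assoc m_closed mem_Collect_eq)
      then show "inv\<^bsub>\<Gamma>_t2\<^esub> a \<in> {h \<in> carrier \<Gamma>_t2. g (Z i) \<otimes>\<^bsub>\<Gamma>_t2\<^esub> h = h \<otimes>\<^bsub>\<Gamma>_t2\<^esub> g (Z i)}" using a by simp
    next
      fix a b assume "a \<in> {h \<in> carrier \<Gamma>_t2. g (Z i) \<otimes>\<^bsub>\<Gamma>_t2\<^esub> h = h \<otimes>\<^bsub>\<Gamma>_t2\<^esub> g (Z i)}"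
        "b \<in> {h \<in> carrier \<Gamma>_t2. g (Z i) \<otimes>\<^bsub>\<Gamma>_t2\<^esub> h = h \<otimes>\<^bsub>\<Gamma>_t2\<^esub> g (Z i)}"
      then show "a \<otimes>\<^bsub>\<Gamma>_t2\<^esub> b \<in> {h \<in> carrier \<Gamma>_t2. g (Z i) \<otimes>\<^bsub>\<Gamma>_t2\<^esub> h = h \<otimes>\<^bsub>\<Gamma>_t2\<^esub> g (Z i)}"
        by simp (metis cl m_assoc)
    qed (auto intro: exI[of _ "\<one>\<^bsub>\<Gamma>_t2\<^esub>"])
    ultimately have "{h \<in> carrier \<Gamma>_t2. g (Z i) \<otimes>\<^bsub>\<Gamma>_t2\<^esub> h = h \<otimes>\<^bsub>\<Gamma>_t2\<^esub> g (Z i)} = carrier \<Gamma>_t2"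
      by (intro presented_generated[of _ \<Gamma>_rels, folded \<Gamma>_t2_def]) (simp_all add: cl[unfolded g_def] g_def)
    then show ?thesis using h by blast
  qed
  show ?thesis
  proof (unfold_locales)
    show "g (X One) \<otimes>\<^bsub>\<Gamma>_t2\<^esub> g (Y One) = g (Y One) \<otimes>\<^bsub>\<Gamma>_t2\<^esub> g (X One) \<otimes>\<^bsub>\<Gamma>_t2\<^esub> g (Z One)"
      using comm[of "X One" "Y One" "gen (Z One)"] by (simp add: \<Gamma>_rels_def) (simp add: gen_def)
    show "g (X Two) \<otimes>\<^bsub>\<Gamma>_t2\<^esub> g (Y Two) = g (Y Two) \<otimes>\<^bsub>\<Gamma>_t2\<^esub> g (X Two) \<otimes>\<^bsub>\<Gamma>_t2\<^esub> g (Z One)"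
      using comm[of "X Two" "Y Two" "gen (Z One)"] by (simp add: \<Gamma>_rels_def) (simp add: gen_def)
    show "g (X One) \<otimes>\<^bsub>\<Gamma>_t2\<^esub> g (Y Two) = g (Y Two) \<otimes>\<^bsub>\<Gamma>_t2\<^esub> g (X One) \<otimes>\<^bsub>\<Gamma>_t2\<^esub> g (Z Two)"
      using comm[of "X One" "Y Two" "gen (Z Two)"] by (simp add: \<Gamma>_rels_def) (simp add: gen_def)
    show "g (X Two) \<otimes>\<^bsub>\<Gamma>_t2\<^esub> g (Y One) = g (Y One) \<otimes>\<^bsub>\<Gamma>_t2\<^esub> g (X Two)"
      by (rule commute) (auto simp: \<Gamma>_rels_def)
    show "g (X One) \<otimes>\<^bsub>\<Gamma>_t2\<^esub> g (X Two) = g (X Two) \<otimes>\<^bsub>\<Gamma>_t2\<^esub> g (X One)"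
      by (rule commute) (auto simp: \<Gamma>_rels_def)
    show "g (Y One) \<otimes>\<^bsub>\<Gamma>_t2\<^esub> g (Y Two) = g (Y Two) \<otimes>\<^bsub>\<Gamma>_t2\<^esub> g (Y One)"
      by (rule commute) (auto simp: \<Gamma>_rels_def)
  qed (use central in auto)
qed

text \<open>The universal property gives \<open>\<phi>\<close>, the normal form gives
  \<open>\<psi>\<close>. Computing powers in the model shows that \<open>\<phi>\<close> undoes
  \<open>\<psi>\<close>, and \<open>\<psi>\<close> is onto because its image contains the
  generators.\<close>

lemma \<Gamma>_t2_iso_heis:
  obtains \<phi> \<psi> where "\<phi> \<in> hom \<Gamma>_t2 heis_group" "\<psi> \<in> hom heis_group \<Gamma>_t2"
    "\<And>x. x \<in> carrier \<Gamma>_t2 \<Longrightarrow> \<psi> (\<phi> x) = x" "\<And>y. \<phi> (\<psi> y) = y"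
proof -
  define g where "g = (\<lambda>a. word_class \<Gamma>_rels (gen a))"
  interpret H: heis_relations \<Gamma>_t2 "g (X One)" "g (X Two)" "g (Y One)" "g (Y Two)" "g (Z One)" "g (Z Two)"
    unfolding g_def by (rule \<Gamma>_t2_heis_relations)
  define \<phi> where "\<phi> = heis.presented_lift \<Gamma>_rels heis_gen"
  have \<phi>: "\<phi> \<in> hom \<Gamma>_t2 heis_group"
    unfolding \<phi>_def \<Gamma>_t2_def by (rule heis.presented_lift_hom) (auto simp: heis_gen_relations)
  have \<phi>g: "\<phi> (g a) = heis_gen a" for a
    unfolding \<phi>_def g_def
    by (subst heis.presented_lift_word_class) (auto simp: heis_gen_relations gen_def)
  have \<psi>: "H.normal_form \<in> hom heis_group \<Gamma>_t2" by (rule H.normal_form_hom)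
  interpret \<phi>: group_hom \<Gamma>_t2 heis_group \<phi>
    using \<phi> by unfold_locales
  interpret \<psi>: group_hom heis_group \<Gamma>_t2 H.normal_form
    using \<psi> by unfold_locales
  have pow: "\<phi> (g a [^]\<^bsub>\<Gamma>_t2\<^esub> (i :: int)) = heis_gen a [^]\<^bsub>heis_group\<^esub> i" for a i
    using hom_int_pow[OF \<phi>, of "g a" i] H.is_group group_heis \<phi>g by (simp add: g_def \<Gamma>_t2_def)
  have \<phi>\<psi>: "\<phi> (H.normal_form y) = y" for y
  proof (cases y)
    case (fields u1 u2 v1 v2 w2 w1)
    then show ?thesis
      by (simp add: H.xx_def H.yy_def H.zz_def pow heis_pow)
  qed
  have "g a \<in> H.normal_form ` carrier heis_group" for a
  proof -
    have "H.normal_form (heis_gen a) = g a"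
      by (cases a rule: heis_gen.cases) (simp_all add: H.xx_def H.yy_def H.zz_def)
    then show ?thesis by (metis heis_group_simps(1) rangeI)
  qed
  then have surj: "H.normal_form ` carrier heis_group = carrier \<Gamma>_t2"
    using presented_generated[of "H.normal_form ` carrier heis_group" \<Gamma>_rels] \<psi>.img_is_subgroup
    by (simp add: \<Gamma>_t2_def g_def)
  have "H.normal_form (\<phi> x) = x" if "x \<in> carrier \<Gamma>_t2" for x
    using that \<phi>\<psi> unfolding surj[symmetric] by auto
  then show ?thesis using that[OF \<phi> \<psi>] \<phi>\<psi> by blast
qed


section \<open>A family of injective endomorphisms\<close>

lemma (in group) card_rcosets_eq_transversal:
  assumes D: "subgroup D G" and T: "T \<subseteq> carrier G"
    and ex: "\<And>x. x \<in> carrier G \<Longrightarrow> \<exists>d\<in>D. \<exists>t\<in>T. x = d \<otimes> t"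
    and un: "\<And>d d' t t'. d \<in> D \<Longrightarrow> d' \<in> D \<Longrightarrow> t \<in> T \<Longrightarrow> t' \<in> T \<Longrightarrow> d \<otimes> t = d' \<otimes> t' \<Longrightarrow> t = t'"
  shows "card (rcosets D) = card T"
proof -
  have "bij_betw (\<lambda>t. D #> t) T (rcosets D)"
    unfolding bij_betw_def
  proof
    show "inj_on (\<lambda>t. D #> t) T"
    proof (rule inj_onI)
      fix t t' assume t: "t \<in> T" "t' \<in> T" "D #> t = D #> t'"
      then have "t \<in> D #> t'" using rcos_self[of t D] D T by auto
      then obtain d where "d \<in> D" "t = d \<otimes> t'" by (auto simp: r_coset_def)
      then have "\<one> \<otimes> t = d \<otimes> t'" using t T by auto
      then show "t = t'" using un t \<open>d \<in> D\<close> subgroup.one_closed[OF D] by blast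
    qed
    show "(\<lambda>t. D #> t) ` T = rcosets D"
    proof
      show "(\<lambda>t. D #> t) ` T \<subseteq> rcosets D" using T by (auto simp: RCOSETS_def)
      show "rcosets D \<subseteq> (\<lambda>t. D #> t) ` T"
      proof
        fix C assume "C \<in> rcosets D"
        then obtain x where x: "x \<in> carrier G" "C = D #> x" by (auto simp: RCOSETS_def)
        then obtain d t where dt: "d \<in> D" "t \<in> T" "x = d \<otimes> t" using ex by blast
        then have "x \<in> D #> t" by (auto simp: r_coset_def)
        then have "D #> t = D #> x" using repr_independence[of x D t] dt T D by auto
        then show "C \<in> (\<lambda>t. D #> t) ` T" using x dt by auto
      qed
    qed
  qed
  then show ?thesis using bij_betw_same_card by metis
qed

text \<open>The binomial coefficient \<open>i\<close> over 2 for integers \<open>i\<close>. It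
  arises from the cross terms in a power \<open>x\<^sup>i\<close>.\<close>

definition tri :: "int \<Rightarrow> int" where "tri i = i * (i - 1) div 2"

lemma two_tri: "2 * tri i = i * (i - 1)"
  unfolding tri_def by (rule dvd_mult_div_cancel) auto

lemma tri_add: "tri (i + j) = tri i + tri j + i * j"
proof -
  have "2 * tri (i + j) = 2 * (tri i + tri j + i * j)"
    by (simp add: two_tri distrib_left) (simp add: algebra_simps)
  then show ?thesis by simp
qed

lemma tri_0_1 [simp]: "tri 0 = 0" "tri 1 = 0"
  by (simp_all add: tri_def)

fun hpow :: "heis \<Rightarrow> int \<Rightarrow> heis" where
  "hpow (u1, u2, v1, v2, w2, w1) i =
     (i * u1, i * u2, i * v1, i * v2, i * w2 + tri i * (u1 * u2), i * w1 + tri i * (u1 * v2 + v1 * u2))"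

lemma hpow_add: "hpow x (i + j) = hmul (hpow x i) (hpow x j)"
  by (cases x rule: prod_cases6) (simp add: tri_add algebra_simps)

lemma heis_int_pow: "x [^]\<^bsub>heis_group\<^esub> (i :: int) = hpow x i"
proof -
  have "hpow x 1 = x" by (cases x rule: prod_cases6) simp
  then show ?thesis using heis.int_pow_eqI[of "hpow x" i] by (simp add: hpow_add)
qed

text \<open>A shape \<open>(k, m, a, b, c)\<close> prescribes the lattices of a subgroup: the top
  lattice is spanned by \<open>k (a, b)\<close> and \<open>k (0, c)\<close>, the middle lattice by
  \<open>m (a, b)\<close> and \<open>m (0, c)\<close>. The entries of \<open>lifts\<close> are the
  remaining coordinates of four generators.\<close>

type_synonym shape = "int \<times> int \<times> int \<times> int \<times> int"
type_synonym lifts = "(int \<times> int) \<times> (int \<times> int) \<times> (int \<times> int) \<times> (int \<times> int) \<times> (int \<times> int) \<times> (int \<times> int)"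

text \<open>The matrix with rows \<open>(a, b)\<close>, \<open>(0, c)\<close> is in Hermite normal
  form. The gcd condition makes \<open>k\<close> and \<open>m\<close> recoverable from the scaled
  lattices.\<close>

fun valid_shape :: "shape \<Rightarrow> bool" where
  "valid_shape (k, m, a, b, c) \<longleftrightarrow> k > 0 \<and> m > 0 \<and> a > 0 \<and> 0 \<le> b \<and> b < c \<and> gcd a (gcd b c) = 1"

text \<open>The homomorphism that sends the four standard generators (the unit vectors for
  \<open>u1\<close>, \<open>u2\<close>, \<open>v1\<close>, \<open>v2\<close>) to \<open>(k a, k b,
  f11, f12, p11, p12)\<close>, \<open>(0, k c, f21, f22, p21, p22)\<close>, \<open>(0, 0, m a, m b,
  p31, p32)\<close> and \<open>(0, 0, 0, m c, p41, p42)\<close>. The commutators of these elements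
  give the terms with \<open>x\<close> and \<open>y\<close>. The terms quadratic in \<open>i\<close>,
  \<open>j\<close> and \<open>s\<close> come from collecting powers. For generators \<open>e1\<close>
  to \<open>e4\<close> the relations \<open>[e1, e3] = 1\<close> and \<open>[e1, e4] = [e3,
  e2]\<close> are respected because \<open>(m a, m b)\<close> and \<open>(0, m c)\<close> are
  proportional to \<open>(k a, k b)\<close> and \<open>(0, k c)\<close>.\<close>

fun \<theta> :: "shape \<Rightarrow> lifts \<Rightarrow> heis \<Rightarrow> heis" where
  "\<theta> (k, m, a, b, c) ((f11, f12), (f21, f22), (p11, p12), (p21, p22), (p31, p32), (p41, p42)) (i, j, s, l, x, y) =
    (i * (k * a), i * (k * b) + j * (k * c),
     i * f11 + j * f21 + s * (m * a), i * f12 + j * f22 + s * (m * b) + l * (m * c),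
     i * p11 + j * p21 + s * p31 + l * p41 + tri i * (k * a * (k * b)) + x * (k * a * (k * c)),
     i * p12 + j * p22 + s * p32 + l * p42 + tri i * (k * a * f12 + f11 * (k * b)) + tri j * (f21 * (k * c))
       + i * j * (f21 * (k * b)) + i * s * (m * a * (k * b))
       + x * (k * a * f22 - k * b * f21 + f11 * (k * c)) + y * (k * a * (m * c)))"

lemma lifts_cases:
  obtains f11 f12 f21 f22 p11 p12 p21 p22 p31 p32 p41 p42
  where "q = (((f11, f12), (f21, f22), (p11, p12), (p21, p22), (p31, p32), (p41, p42)) :: lifts)"
  by (cases q) auto

lemma \<theta>_mult: "\<theta> sh q (hmul g g') = hmul (\<theta> sh q g) (\<theta> sh q g')"
  by (cases sh rule: prod_cases5; cases q rule: lifts_cases; cases g rule: prod_cases6; cases g' rule: prod_cases6)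
    (simp add: tri_add algebra_simps)

text \<open>Multiplying a generator by elements of the middle or the bottom lattice of the image
  leaves the image of \<open>\<theta>\<close> unchanged. The box contains the reduced
  generators.\<close>

fun lift_box :: "shape \<Rightarrow> lifts set" where
  "lift_box (k, m, a, b, c) =
     (let V = {0..<m * a} \<times> {0..<m * c}; W = {0..<k * a * (k * c)} \<times> {0..<k * a * (m * c)}
      in V \<times> V \<times> W \<times> W \<times> W \<times> W)"

text \<open>A fundamental domain for left multiplication by the image of \<open>\<theta>\<close>,
  since that image is triangular with diagonal entries equal to the lengths of the sides.\<close>

fun coset_box :: "shape \<Rightarrow> heis set" where
  "coset_box (k, m, a, b, c) =
     {0..<k * a} \<times> {0..<k * c} \<times> {0..<m * a} \<times> {0..<m * c} \<times> {0..<k * a * (k * c)} \<times> {0..<k * a * (m * c)}"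

lemma div_rem_unique:
  fixes i i' r r' N :: int
  assumes "i * N + r = i' * N + r'" "0 \<le> r" "r < N" "0 \<le> r'" "r' < N"
  shows "i = i'" "r = r'"
proof -
  have N: "N > 0" using assms by linarith
  have "(r + i * N) div N = (r' + i' * N) div N" using assms(1) by (simp add: add.commute)
  then show "i = i'" using assms N by simp
  then show "r = r'" using assms(1) by simp
qed

lemma div_rem_exists:
  fixes z t N :: int
  assumes "N > 0"
  shows "\<exists>i r. z = t + i * N + r \<and> 0 \<le> r \<and> r < N"
  using assms by (intro exI[of _ "(z - t) div N"] exI[of _ "(z - t) mod N"]) simp

text \<open>Division with remainder, one coordinate after the other. Each quotient fixes the next
  coordinate of \<open>g\<close>, and earlier coordinates enter the later equations only as known
  shifts.\<close>

lemma \<theta>_coset_exists: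
  assumes "valid_shape sh"
  shows "\<exists>g. \<exists>t\<in>coset_box sh. h = hmul (\<theta> sh q g) t"
proof -
  obtain k m a b c where sh: "sh = (k, m, a, b, c)" by (rule prod_cases5)
  obtain f11 f12 f21 f22 p11 p12 p21 p22 p31 p32 p41 p42
    where q: "q = ((f11, f12), (f21, f22), (p11, p12), (p21, p22), (p31, p32), (p41, p42))"
    by (rule lifts_cases)
  obtain X1 X2 X3 X4 X5 X6 where h: "h = (X1, X2, X3, X4, X5, X6)" by (rule prod_cases6)
  have pos: "k * a > 0" "k * c > 0" "m * a > 0" "m * c > 0" "k * a * (k * c) > 0" "k * a * (m * c) > 0"
    using assms by (auto simp: sh)
  obtain i t1 where 1: "X1 = 0 + i * (k * a) + t1" "0 \<le> t1" "t1 < k * a"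
    using div_rem_exists[OF pos(1)] by blast
  obtain j t2 where 2: "X2 = i * (k * b) + j * (k * c) + t2" "0 \<le> t2" "t2 < k * c"
    using div_rem_exists[OF pos(2)] by blast
  obtain s t3 where 3: "X3 = i * f11 + j * f21 + s * (m * a) + t3" "0 \<le> t3" "t3 < m * a"
    using div_rem_exists[OF pos(3)] by blast
  obtain l t4 where 4: "X4 = i * f12 + j * f22 + s * (m * b) + l * (m * c) + t4" "0 \<le> t4" "t4 < m * c"
    using div_rem_exists[OF pos(4)] by blast
  obtain x t5 where 5: "X5 = i * p11 + j * p21 + s * p31 + l * p41 + tri i * (k * a * (k * b)) + i * (k * a) * t2
      + x * (k * a * (k * c)) + t5" "0 \<le> t5" "t5 < k * a * (k * c)"
    using div_rem_exists[OF pos(5)] by blast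
  obtain y t6 where 6: "X6 = i * p12 + j * p22 + s * p32 + l * p42 + tri i * (k * a * f12 + f11 * (k * b)) + tri j * (f21 * (k * c))
       + i * j * (f21 * (k * b)) + i * s * (m * a * (k * b))
       + x * (k * a * f22 - k * b * f21 + f11 * (k * c)) + i * (k * a) * t4 + (i * f11 + j * f21 + s * (m * a)) * t2
       + y * (k * a * (m * c)) + t6" "0 \<le> t6" "t6 < k * a * (m * c)"
    using div_rem_exists[OF pos(6)] by blast
  have "h = hmul (\<theta> sh q (i, j, s, l, x, y)) (t1, t2, t3, t4, t5, t6)"
    unfolding h sh q by (simp add: 1(1) 2(1) 3(1) 4(1) 5(1) 6(1))
  moreover have "(t1, t2, t3, t4, t5, t6) \<in> coset_box sh" using 1 2 3 4 5 6 by (simp add: sh)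
  ultimately show ?thesis by blast
qed

text \<open>Uniqueness of quotient and remainder, one coordinate after the other.\<close>

lemma \<theta>_coset_unique:
  assumes "t \<in> coset_box sh" "t' \<in> coset_box sh" "hmul (\<theta> sh q g) t = hmul (\<theta> sh q g') t'"
  shows "g = g'" "t = t'"
proof -
  obtain k m a b c where sh: "sh = (k, m, a, b, c)" by (rule prod_cases5)
  obtain f11 f12 f21 f22 p11 p12 p21 p22 p31 p32 p41 p42
    where q: "q = ((f11, f12), (f21, f22), (p11, p12), (p21, p22), (p31, p32), (p41, p42))"
    by (rule lifts_cases)
  obtain i j s l x y where g: "g = (i, j, s, l, x, y)" by (rule prod_cases6)
  obtain i' j' s' l' x' y' where g': "g' = (i', j', s', l', x', y')" by (rule prod_cases6)
  obtain t1 t2 t3 t4 t5 t6 where t: "t = (t1, t2, t3, t4, t5, t6)" by (rule prod_cases6)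
  obtain r1 r2 r3 r4 r5 r6 where t': "t' = (r1, r2, r3, r4, r5, r6)" by (rule prod_cases6)
  note b = assms(1,2)[unfolded sh t t', simplified]
  note eq = assms(3)[unfolded sh q g g' t t', simplified]
  have 1: "i = i'" "t1 = r1" using div_rem_unique[of i "k * a" t1 i' r1] eq b by auto
  have 2: "j = j'" "t2 = r2" using div_rem_unique[of j "k * c" t2 j' r2] eq b 1 by auto
  have 3: "s = s'" "t3 = r3" using div_rem_unique[of s "m * a" t3 s' r3] eq b 1 2 by auto
  have 4: "l = l'" "t4 = r4" using div_rem_unique[of l "m * c" t4 l' r4] eq b 1 2 3 by auto
  have 5: "x = x'" "t5 = r5" using div_rem_unique[of x "k * a * (k * c)" t5 x' r5] eq b 1 2 3 4 by auto
  have 6: "y = y'" "t6 = r6" using div_rem_unique[of y "k * a * (m * c)" t6 y' r6] eq b 1 2 3 4 5 by auto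
  show "g = g'" "t = t'" using 1 2 3 4 5 6 by (simp_all add: g g' t t')
qed

lemma hone_in_coset_box: "valid_shape sh \<Longrightarrow> hone \<in> coset_box sh"
  by (cases sh rule: prod_cases5) auto

lemma inj_\<theta>: "valid_shape sh \<Longrightarrow> inj (\<theta> sh q)"
  using \<theta>_coset_unique(1)[of hone sh hone q] hone_in_coset_box by (simp add: inj_def)

lemma \<theta>_one: "\<theta> sh q hone = hone"
  by (cases sh rule: prod_cases5; cases q rule: lifts_cases) simp

lemma \<theta>_inv: "\<theta> sh q (hinv g) = hinv (\<theta> sh q g)"
  using heis.inv_equality[of "\<theta> sh q (hinv g)" "\<theta> sh q g"] \<theta>_mult[of sh q "hinv g" g] by (simp add: \<theta>_one)

lemma subgroup_heisI:
  assumes "hone \<in> D" "\<And>x y. x \<in> D \<Longrightarrow> y \<in> D \<Longrightarrow> hmul x y \<in> D" "\<And>x. x \<in> D \<Longrightarrow> hinv x \<in> D"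
  shows "subgroup D heis_group"
  using assms by (intro heis.subgroupI) auto

lemma subgroup_range_\<theta>: "subgroup (range (\<theta> sh q)) heis_group"
proof (rule subgroup_heisI)
  show "hone \<in> range (\<theta> sh q)" using \<theta>_one rangeI by metis
qed (auto simp: \<theta>_mult[symmetric] \<theta>_inv[symmetric])

text \<open>The product of the diagonal entries \<open>k a\<close>, \<open>k c\<close>, \<open>m
  a\<close>, \<open>m c\<close>, \<open>k\<^sup>2 a c\<close>, \<open>k m a c\<close> of
  \<open>\<theta>\<close>.\<close>

fun shape_index :: "shape \<Rightarrow> int" where
  "shape_index (k, m, a, b, c) = m ^ 3 * k ^ 5 * (a * c) ^ 4"

lemma card_rcosets_range_\<theta>:
  assumes "valid_shape sh"
  shows "card (rcosets\<^bsub>heis_group\<^esub> (range (\<theta> sh q))) = nat (shape_index sh)"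
proof -
  have "card (rcosets\<^bsub>heis_group\<^esub> (range (\<theta> sh q))) = card (coset_box sh)"
  proof (rule heis.card_rcosets_eq_transversal[OF subgroup_range_\<theta>])
    show "\<exists>d\<in>range (\<theta> sh q). \<exists>t\<in>coset_box sh. x = d \<otimes>\<^bsub>heis_group\<^esub> t" for x
      using \<theta>_coset_exists[OF assms, of x q] by auto
    show "t = t'" if dt: "d \<in> range (\<theta> sh q)" "d' \<in> range (\<theta> sh q)" "t \<in> coset_box sh" "t' \<in> coset_box sh"
      "d \<otimes>\<^bsub>heis_group\<^esub> t = d' \<otimes>\<^bsub>heis_group\<^esub> t'" for d d' t t'
    proof -
      obtain g g' where "d = \<theta> sh q g" "d' = \<theta> sh q g'" using dt(1,2) by (elim rangeE)
      then show ?thesis using \<theta>_coset_unique(2)[OF dt(3,4)] dt(5) by simp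
    qed
  qed simp
  also have "card (coset_box sh) = nat (shape_index sh)"
  proof -
    obtain k m a b c where sh: "sh = (k, m, a, b, c)" by (rule prod_cases5)
    have pos: "k > 0" "m > 0" "a > 0" "c > 0" using assms by (auto simp: sh)
    then show ?thesis
      by (simp add: sh card_cartesian_product nat_mult_distrib nat_power_eq)
        (simp add: power_eq_if algebra_simps)
  qed
  finally show ?thesis .
qed

text \<open>Two lifts through the middle lattice of index \<open>m\<^sup>2 a c\<close> and four
  lifts through the bottom lattice of index \<open>m k\<^sup>3 (a c)\<^sup>2\<close>.\<close>

lemma card_lift_box:
  assumes "valid_shape (k, m, a, b, c)"
  shows "card (lift_box (k, m, a, b, c)) = nat m ^ 8 * nat k ^ 12 * (nat a * nat c) ^ 10"
  using assms by (simp add: Let_def card_cartesian_product nat_mult_distrib)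
      (simp add: power_eq_if algebra_simps)

lemma finite_lift_box: "finite (lift_box sh)"
  by (cases sh rule: prod_cases5) (simp add: Let_def)


section \<open>Lattices attached to a subgroup of finite index\<close>

lemma int_subgroup_eq_multiples:
  fixes I :: "int set"
  assumes "\<And>x y. x \<in> I \<Longrightarrow> y \<in> I \<Longrightarrow> x - y \<in> I" "N \<in> I" "N > 0"
  obtains d where "d > 0" "\<And>x. x \<in> I \<longleftrightarrow> d dvd x"
proof -
  define d where "d = int (LEAST n. n > 0 \<and> int n \<in> I)"
  have "nat N > 0 \<and> int (nat N) \<in> I" using assms by simp
  then have d: "d > 0" "d \<in> I"
    using LeastI[of "\<lambda>n. n > 0 \<and> int n \<in> I" "nat N"] by (auto simp: d_def)
  have least: "d \<le> x" if "x \<in> I" "x > 0" for x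
    using Least_le[of "\<lambda>n. n > 0 \<and> int n \<in> I" "nat x"] that by (auto simp: d_def)
  have zero: "0 \<in> I" using assms(1)[OF d(2) d(2)] by simp
  have minus: "- x \<in> I" if "x \<in> I" for x using assms(1)[OF zero that] by simp
  have plus: "x + y \<in> I" if "x \<in> I" "y \<in> I" for x y using assms(1)[OF that(1) minus[OF that(2)]] by simp
  have "i * d \<in> I" for i
  proof (induction i rule: int_induct[where k = 0])
    case (step1 i)
    then show ?case using plus[OF step1(2) d(2)] by (simp add: distrib_right)
  next
    case (step2 i)
    then show ?case using assms(1)[OF step2(2) d(2)] by (simp add: left_diff_distrib)
  qed (use zero in simp)
  then have mult: "x \<in> I" if "d dvd x" for x using that by (metis dvd_def mult.commute)
  have "d dvd x" if "x \<in> I" for x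
  proof -
    have "x mod d \<in> I" using assms(1)[OF that mult[of "x div d * d"]] by (simp add: minus_div_mult_eq_mod)
    moreover have "0 \<le> x mod d" "x mod d < d" using d(1) by auto
    ultimately have "x mod d = 0" using least[of "x mod d"] by linarith
    then show ?thesis by auto
  qed
  then show ?thesis using that[of d] d(1) mult by blast
qed

text \<open>The Hermite normal form in rank two. \<open>A\<close> generates the first coordinates,
  \<open>C\<close> the part with first coordinate 0, and \<open>B\<close> is reduced modulo
  \<open>C\<close>.\<close>

lemma lattice_normal_form:
  fixes L :: "(int \<times> int) set"
  assumes diff: "\<And>x y x' y'. (x, y) \<in> L \<Longrightarrow> (x', y') \<in> L \<Longrightarrow> (x - x', y - y') \<in> L"
    and "(N, y0) \<in> L" "N > 0" "(0, M) \<in> L" "M > 0"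
  obtains A B C where "A > 0" "0 \<le> B" "B < C"
    "\<And>x y. (x, y) \<in> L \<longleftrightarrow> (\<exists>i j. x = i * A \<and> y = i * B + j * C)"
proof -
  obtain A where A: "A > 0" "\<And>x. x \<in> fst ` L \<longleftrightarrow> A dvd x"
  proof (rule int_subgroup_eq_multiples[of "fst ` L" N])
    show "x - y \<in> fst ` L" if "x \<in> fst ` L" "y \<in> fst ` L" for x y
      using that diff by (force simp: image_iff)
    show "N \<in> fst ` L" using assms(2) by force
  qed (use assms in auto)
  obtain C where C: "C > 0" "\<And>y. y \<in> {y. (0, y) \<in> L} \<longleftrightarrow> C dvd y"
  proof (rule int_subgroup_eq_multiples[of "{y. (0, y) \<in> L}" M])
    show "x - y \<in> {y. (0, y) \<in> L}" if "x \<in> {y. (0, y) \<in> L}" "y \<in> {y. (0, y) \<in> L}" for x y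
      using that diff[of 0 x 0 y] by simp
  qed (use assms in auto)
  have "A \<in> fst ` L" using A(2) by simp
  then obtain B0 where B0: "(A, B0) \<in> L" by auto
  define B where "B = B0 mod C"
  have "(0, B0 div C * C) \<in> L" using C(2) by auto
  from diff[OF B0 this] have AB: "(A, B) \<in> L" by (simp add: B_def minus_div_mult_eq_mod)
  have zero: "(0, 0) \<in> L" using diff[OF AB AB] by simp
  have mult: "(i * A, i * B) \<in> L" for i
  proof (induction i rule: int_induct[where k = 0])
    case (step1 i)
    then show ?case using diff[OF step1(2) diff[OF zero AB]] by (simp add: algebra_simps)
  next
    case (step2 i)
    then show ?case using diff[OF step2(2) AB] by (simp add: algebra_simps)
  qed (simp add: zero)
  have "(x, y) \<in> L \<longleftrightarrow> (\<exists>i j. x = i * A \<and> y = i * B + j * C)" for x y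
  proof
    assume xy: "(x, y) \<in> L"
    then have "x \<in> fst ` L" by force
    then have "A dvd x" using A(2) by blast
    then obtain i where i: "x = i * A" by (metis dvd_def mult.commute)
    have "(0, y - i * B) \<in> L" using diff[OF xy mult[of i]] by (simp add: i)
    then have "C dvd y - i * B" using C(2) by blast
    then obtain j where "y - i * B = C * j" by (auto simp: dvd_def)
    then have "y = i * B + j * C" by (simp add: algebra_simps)
    then show "\<exists>i j. x = i * A \<and> y = i * B + j * C" using i by blast
  next
    assume "\<exists>i j. x = i * A \<and> y = i * B + j * C"
    then obtain i j where ij: "x = i * A" "y = i * B + j * C" by blast
    have "(0, - j * C) \<in> L" using C(2)[of "- j * C"] by simp
    from diff[OF mult[of i] this] show "(x, y) \<in> L" by (simp add: ij)
  qed
  moreover have "0 \<le> B" "B < C" using C(1) by (auto simp: B_def)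
  ultimately show ?thesis using that A(1) by blast
qed

lemma lattice_normal_form_unique:
  fixes A B C A' B' C' :: int
  assumes "A > 0" "0 \<le> B" "B < C" "A' > 0" "0 \<le> B'" "B' < C'"
    and eq: "\<And>x y. (\<exists>i j. x = i * A \<and> y = i * B + j * C) \<longleftrightarrow> (\<exists>i j. x = i * A' \<and> y = i * B' + j * C')"
  shows "A = A'" "B = B'" "C = C'"
proof -
  have "\<exists>i j. A = i * A' \<and> B = i * B' + j * C'" using eq[of A B, THEN iffD1] by (metis add_0_right mult_1 mult_zero_left)
  then obtain i j where ij: "A = i * A'" "B = i * B' + j * C'" by blast
  have "\<exists>i j. A' = i * A \<and> B' = i * B + j * C" using eq[of A' B', THEN iffD2] by (metis add_0_right mult_1 mult_zero_left)
  then have "A dvd A'" by auto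
  moreover have "A' dvd A" using ij(1) by simp
  ultimately show A: "A = A'" using zdvd_antisym_nonneg[of A A'] assms(1,4) by linarith
  then have "i = 1" using ij(1) assms(4) by (metis mult_cancel_right1 less_irrefl)
  then have B: "B = B' + j * C'" using ij by simp
  have "\<exists>i j. 0 = i * A' \<and> C = i * B' + j * C'" using eq[of 0 C, THEN iffD1] by (metis add_0_left mult_1 mult_zero_left)
  then have C1: "C' dvd C" using assms(4) by auto
  have "\<exists>i j. 0 = i * A \<and> C' = i * B + j * C" using eq[of 0 C', THEN iffD2] by (metis add_0_left mult_1 mult_zero_left)
  then have "C dvd C'" using assms(1) by auto
  then show C: "C = C'" using C1 assms by (simp add: zdvd_antisym_nonneg)
  show "B = B'" using div_rem_unique(2)[of 0 C' B j B'] B C assms by simp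
qed

definition heis_mod :: "int \<Rightarrow> heis \<Rightarrow> heis" where
  "heis_mod p = (\<lambda>(u1, u2, v1, v2, w2, w1). (u1 mod p, u2 mod p, v1 mod p, v2 mod p, w2 mod p, w1 mod p))"

lemma heis_mod_simp [simp]:
  "heis_mod p (u1, u2, v1, v2, w2, w1) = (u1 mod p, u2 mod p, v1 mod p, v2 mod p, w2 mod p, w1 mod p)"
  by (simp add: heis_mod_def)

text \<open>The Heisenberg group over \<open>(\<int>/p)[t]/t\<^sup>2\<close>, with the reduced
  residues as carrier.\<close>

definition heis_mod_group :: "int \<Rightarrow> heis monoid" where
  "heis_mod_group p = \<lparr>carrier = range (heis_mod p), monoid.mult = (\<lambda>x y. heis_mod p (hmul x y)), one = hone\<rparr>"

lemma heis_mod_group_simps [simp]: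
  "carrier (heis_mod_group p) = range (heis_mod p)" "\<one>\<^bsub>heis_mod_group p\<^esub> = hone"
  "x \<otimes>\<^bsub>heis_mod_group p\<^esub> y = heis_mod p (hmul x y)"
  by (auto simp: heis_mod_group_def)

lemma heis_mod_idem [simp]: "heis_mod p (heis_mod p x) = heis_mod p x"
  by (cases x rule: prod_cases6) simp

lemma heis_mod_hmul_cong:
  assumes "heis_mod p x = heis_mod p x'" "heis_mod p y = heis_mod p y'"
  shows "heis_mod p (hmul x y) = heis_mod p (hmul x' y')"
proof -
  obtain u1 u2 v1 v2 w2 w1 where x: "x = (u1, u2, v1, v2, w2, w1)" by (rule prod_cases6)
  obtain u1' u2' v1' v2' w2' w1' where x': "x' = (u1', u2', v1', v2', w2', w1')" by (rule prod_cases6)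
  obtain r1 r2 s1 s2 t2 t1 where y: "y = (r1, r2, s1, s2, t2, t1)" by (rule prod_cases6)
  obtain r1' r2' s1' s2' t2' t1' where y': "y' = (r1', r2', s1', s2', t2', t1')" by (rule prod_cases6)
  show ?thesis
    using assms unfolding x x' y y' hmul.simps heis_mod_simp prod.inject cong_def[symmetric]
    by (intro conjI cong_add cong_mult) simp_all
qed

lemma heis_mod_hmul:
  "heis_mod p (hmul (heis_mod p x) (heis_mod p y)) = heis_mod p (hmul x y)"
  "heis_mod p (hmul (heis_mod p x) y) = heis_mod p (hmul x y)"
  "heis_mod p (hmul x (heis_mod p y)) = heis_mod p (hmul x y)"
  by (rule heis_mod_hmul_cong; simp)+

lemma group_heis_mod: "group (heis_mod_group p)"
proof (rule groupI)
  have "heis_mod p hone = hone" by simp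
  then show "\<one>\<^bsub>heis_mod_group p\<^esub> \<in> carrier (heis_mod_group p)" by (metis heis_mod_group_simps(1,2) rangeI)
  fix x assume x: "x \<in> carrier (heis_mod_group p)"
  then show "\<one>\<^bsub>heis_mod_group p\<^esub> \<otimes>\<^bsub>heis_mod_group p\<^esub> x = x" by auto
  show "\<exists>y\<in>carrier (heis_mod_group p). y \<otimes>\<^bsub>heis_mod_group p\<^esub> x = \<one>\<^bsub>heis_mod_group p\<^esub>"
    by (rule bexI[of _ "heis_mod p (hinv x)"]) (auto simp: heis_mod_hmul)
qed (auto simp: heis_mod_hmul hmul_assoc)

lemma heis_mod_hom: "heis_mod p \<in> hom heis_group (heis_mod_group p)"
  by (rule homI; simp only: heis_group_simps heis_mod_group_simps heis_mod_hmul rangeI)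

lemma finite_heis_mod_group:
  assumes "p > 0" shows "finite (carrier (heis_mod_group p))"
proof (rule finite_subset)
  show "carrier (heis_mod_group p) \<subseteq> {0..<p} \<times> {0..<p} \<times> {0..<p} \<times> {0..<p} \<times> {0..<p} \<times> {0..<p}"
    using assms by (auto simp: heis_mod_def)
qed auto

lemma heis_mod_fixed:
  assumes "x \<in> range (heis_mod p)" shows "heis_mod p x = x"
  using assms by auto

lemma additive_mod_eq_mult:
  fixes f :: "int \<Rightarrow> int"
  assumes "\<And>i j. [f (i + j) = f i + f j] (mod p)"
  shows "[f i = i * f 1] (mod p)"
proof (induction i rule: int_induct[where k = 0])
  case base
  have "[f 0 + 0 = f 0 + f 0] (mod p)" using assms[of 0 0] by simp
  then show ?case by (metis cong_add_lcancel cong_sym mult_zero_left)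
next
  case (step1 i)
  then show ?case using cong_trans[OF assms[of i 1] cong_add[OF step1(2) cong_refl[of "f 1"]]]
    by (simp add: algebra_simps)
next
  case (step2 i)
  have "[f (i - 1) + f 1 = i * f 1] (mod p)"
    using cong_trans[OF cong_sym[OF assms[of "i - 1" 1]]] step2(2) by simp
  then have "[f (i - 1) + f 1 - f 1 = i * f 1 - f 1] (mod p)" by (rule cong_diff) simp
  then show ?case by (simp add: algebra_simps)
qed

text \<open>The commutator of \<open>(\<alpha>, \<beta>, \<gamma>)\<close> and \<open>(\<alpha>',
  \<beta>', \<gamma>')\<close> is \<open>\<alpha> \<beta>' - \<alpha>' \<beta>\<close> in
  \<open>\<int>[t]/t\<^sup>2\<close>. It is written as \<open>(x y) (y x)\<^sup>-\<^sup>1\<close>,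
  which needs only closure of a subgroup under products and inverses.\<close>

lemma commutator_eq:
  "hmul (hmul (u1, u2, v1, v2, w2, w1) (u1', u2', v1', v2', w2', w1'))
     (hinv (hmul (u1', u2', v1', v2', w2', w1') (u1, u2, v1, v2, w2, w1))) =
   (0, 0, 0, 0, u1 * u2' - u2 * u1', u1 * v2' - u2 * v1' + v1 * u2' - v2 * u1')"
  by (simp add: algebra_simps)

locale heis_subgroup =
  fixes D assumes D: "subgroup D heis_group"
begin

lemma closed: "hone \<in> D" "x \<in> D \<Longrightarrow> y \<in> D \<Longrightarrow> hmul x y \<in> D" "x \<in> D \<Longrightarrow> hinv x \<in> D"
  using D subgroup.one_closed[OF D] subgroup.m_closed[OF D] subgroup.m_inv_closed[OF D] by auto

lemma hpow_closed: "x \<in> D \<Longrightarrow> hpow x i \<in> D"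
  using heis.subgroup_int_pow_closed[OF D, of x i] by (simp add: heis_int_pow)

lemma commutator_closed: "x \<in> D \<Longrightarrow> y \<in> D \<Longrightarrow> hmul (hmul x y) (hinv (hmul y x)) \<in> D"
  using closed by blast

definition "top_lattice = {(u1, u2). \<exists>v1 v2 w2 w1. (u1, u2, v1, v2, w2, w1) \<in> D}"
definition "mid_lattice = {(v1, v2). \<exists>w2 w1. (0, 0, v1, v2, w2, w1) \<in> D}"
definition "bottom_lattice = {(w2, w1). (0, 0, 0, 0, w2, w1) \<in> D}"

lemma lattice_diff:
  "(x, y) \<in> top_lattice \<Longrightarrow> (x', y') \<in> top_lattice \<Longrightarrow> (x - x', y - y') \<in> top_lattice"
  "(x, y) \<in> mid_lattice \<Longrightarrow> (x', y') \<in> mid_lattice \<Longrightarrow> (x - x', y - y') \<in> mid_lattice"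
  "(x, y) \<in> bottom_lattice \<Longrightarrow> (x', y') \<in> bottom_lattice \<Longrightarrow> (x - x', y - y') \<in> bottom_lattice"
proof -
  have *: "hmul g (hinv h) \<in> D" if "g \<in> D" "h \<in> D" for g h using that closed by blast
  show "(x, y) \<in> top_lattice \<Longrightarrow> (x', y') \<in> top_lattice \<Longrightarrow> (x - x', y - y') \<in> top_lattice"
    using * unfolding top_lattice_def by fastforce
  show "(x, y) \<in> mid_lattice \<Longrightarrow> (x', y') \<in> mid_lattice \<Longrightarrow> (x - x', y - y') \<in> mid_lattice"
    using * unfolding mid_lattice_def by fastforce
  show "(x, y) \<in> bottom_lattice \<Longrightarrow> (x', y') \<in> bottom_lattice \<Longrightarrow> (x - x', y - y') \<in> bottom_lattice"
    using * unfolding bottom_lattice_def by fastforce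
qed

end

locale finite_index_heis_subgroup = heis_subgroup +
  assumes fin: "finite (rcosets\<^bsub>heis_group\<^esub> D)"
begin

text \<open>Two of the powers of \<open>g\<close> lie in the same coset, since there are only
  finitely many cosets.\<close>

lemma power_in_D: "\<exists>N>0. hpow g N \<in> D"
proof -
  have "(\<lambda>n :: nat. D #>\<^bsub>heis_group\<^esub> hpow g (int n)) ` UNIV \<subseteq> rcosets\<^bsub>heis_group\<^esub> D"
    by (auto simp: RCOSETS_def)
  then have "finite ((\<lambda>n :: nat. D #>\<^bsub>heis_group\<^esub> hpow g (int n)) ` UNIV)" using fin finite_subset by blast
  then have "\<not> inj (\<lambda>n :: nat. D #>\<^bsub>heis_group\<^esub> hpow g (int n))" using finite_imageD infinite_UNIV_nat by blast
  then obtain i j :: nat where "i \<noteq> j" "D #>\<^bsub>heis_group\<^esub> hpow g (int i) = D #>\<^bsub>heis_group\<^esub> hpow g (int j)"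
    unfolding inj_def by blast
  then obtain i j :: nat where ij: "i < j" "D #>\<^bsub>heis_group\<^esub> hpow g (int i) = D #>\<^bsub>heis_group\<^esub> hpow g (int j)"
    by (cases i j rule: linorder_cases) auto
  have "hpow g (int j) \<in> D #>\<^bsub>heis_group\<^esub> hpow g (int i)" using heis.rcos_self[OF _ D] ij(2) by simp
  then obtain d where d: "d \<in> D" "hpow g (int j) = hmul d (hpow g (int i))" by (auto simp: r_coset_def)
  have "hmul (hpow g (int j - int i)) (hpow g (int i)) = hmul d (hpow g (int i))"
    using hpow_add[of g "int j - int i" "int i"] d(2) by simp
  then have "hpow g (int j - int i) = d" using heis.right_cancel[of "hpow g (int i)"] by simp
  then show ?thesis using d(1) ij(1) by (intro exI[of _ "int j - int i"]) simp
qed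

lemma lattices_normal_form:
  obtains A B C A2 B2 C2 A3 B3 C3 where
    "A > 0" "0 \<le> B" "B < C" "\<And>x y. (x, y) \<in> top_lattice \<longleftrightarrow> (\<exists>i j. x = i * A \<and> y = i * B + j * C)"
    "A2 > 0" "0 \<le> B2" "B2 < C2" "\<And>x y. (x, y) \<in> mid_lattice \<longleftrightarrow> (\<exists>i j. x = i * A2 \<and> y = i * B2 + j * C2)"
    "A3 > 0" "0 \<le> B3" "B3 < C3" "\<And>x y. (x, y) \<in> bottom_lattice \<longleftrightarrow> (\<exists>i j. x = i * A3 \<and> y = i * B3 + j * C3)"
proof -
  obtain n1 n2 n3 n4 n5 n6 where n: "n1 > 0" "hpow (1, 0, 0, 0, 0, 0) n1 \<in> D" "n2 > 0" "hpow (0, 1, 0, 0, 0, 0) n2 \<in> D"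
    "n3 > 0" "hpow (0, 0, 1, 0, 0, 0) n3 \<in> D" "n4 > 0" "hpow (0, 0, 0, 1, 0, 0) n4 \<in> D"
    "n5 > 0" "hpow (0, 0, 0, 0, 1, 0) n5 \<in> D" "n6 > 0" "hpow (0, 0, 0, 0, 0, 1) n6 \<in> D"
    using power_in_D by metis
  have t: "(n1, 0) \<in> top_lattice" "(0, n2) \<in> top_lattice" using n by (auto simp: top_lattice_def)
  have m: "(n3, 0) \<in> mid_lattice" "(0, n4) \<in> mid_lattice" using n by (auto simp: mid_lattice_def)
  have b: "(n5, 0) \<in> bottom_lattice" "(0, n6) \<in> bottom_lattice" using n by (auto simp: bottom_lattice_def)
  show ?thesis
    by (rule lattice_normal_form[OF lattice_diff(1) t(1) n(1) t(2) n(3)], assumption, assumption,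
        rule lattice_normal_form[OF lattice_diff(2) m(1) n(5) m(2) n(7)], assumption, assumption,
        rule lattice_normal_form[OF lattice_diff(3) b(1) n(9) b(2) n(11)], assumption, assumption,
        rule that) assumption+
qed

end


section \<open>Surjections onto the Heisenberg group modulo \<open>p\<close>\<close>

text \<open>A fixed surjection \<open>\<rho>\<close> of \<open>D\<close> onto the Heisenberg group
  modulo \<open>p\<close>. It is an abstract surjection, in general not the reduction of coordinates;
  it constrains the lattices of \<open>D\<close> through commutators.\<close>

locale heis_subgroup_mod = heis_subgroup +
  fixes p :: int and \<rho>
  assumes p: "p > 1"
    and \<rho>_hom: "\<rho> \<in> hom (heis_group\<lparr>carrier := D\<rparr>) (heis_mod_group p)"
    and \<rho>_surj: "\<rho> ` D = range (heis_mod p)"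
begin

lemma \<rho>_mult: "x \<in> D \<Longrightarrow> y \<in> D \<Longrightarrow> \<rho> (hmul x y) = heis_mod p (hmul (\<rho> x) (\<rho> y))"
  using \<rho>_hom by (simp add: hom_def)

lemma \<rho>_mod: "x \<in> D \<Longrightarrow> heis_mod p (\<rho> x) = \<rho> x"
  using \<rho>_surj heis_mod_fixed by blast

lemma \<rho>_onto: "\<exists>x\<in>D. \<rho> x = heis_mod p y"
  using \<rho>_surj by (metis imageE rangeI)

lemma mod_fixed_dvd: "(a :: int) mod p = a \<Longrightarrow> p dvd a \<Longrightarrow> a = 0"
  by (simp add: dvd_eq_mod_eq_0)

text \<open>The elements that commute with the images of the unit vectors for \<open>u1\<close> and
  \<open>u2\<close> have \<open>\<alpha> = \<beta> = 0\<close>, because these commutators are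
  \<open>\<beta>\<close> and \<open>\<alpha>\<close> up to sign.\<close>

lemma central_image:
  assumes x: "x \<in> D" and comm: "\<And>y. y \<in> D \<Longrightarrow> \<rho> (hmul x y) = \<rho> (hmul y x)"
  obtains t2 t1 where "\<rho> x = (0, 0, 0, 0, t2, t1)"
proof -
  obtain a1 a2 b1 b2 t2 t1 where rx: "\<rho> x = (a1, a2, b1, b2, t2, t1)" by (rule prod_cases6)
  have fixed: "a1 mod p = a1" "a2 mod p = a2" "b1 mod p = b1" "b2 mod p = b2"
    using \<rho>_mod[OF x] by (auto simp: rx)
  obtain y where y: "y \<in> D" "\<rho> y = heis_mod p (1, 0, 0, 0, 0, 0)" using \<rho>_onto by blast
  obtain z where z: "z \<in> D" "\<rho> z = heis_mod p (0, 1, 0, 0, 0, 0)" using \<rho>_onto by blast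
  have "(t2 + a2) mod p = t2 mod p" "(t1 + b2) mod p = t1 mod p"
    using comm[OF y(1)] p by (simp_all add: \<rho>_mult x y rx add_ac)
  then have "p dvd a2" "p dvd b2" by (simp_all add: mod_eq_dvd_iff)
  moreover have "(t2 + a1) mod p = t2 mod p" "(t1 + b1) mod p = t1 mod p"
    using comm[OF z(1)] p by (simp_all add: \<rho>_mult x z rx add_ac)
  then have "p dvd a1" "p dvd b1" by (simp_all add: mod_eq_dvd_iff)
  ultimately show ?thesis using that mod_fixed_dvd fixed rx by metis
qed

lemma bottom_image:
  assumes "(w2, w1) \<in> bottom_lattice"
  obtains t2 t1 where "\<rho> (0, 0, 0, 0, w2, w1) = (0, 0, 0, 0, t2, t1)" "t2 mod p = t2" "t1 mod p = t1"
proof -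
  have x: "(0, 0, 0, 0, w2, w1) \<in> D" using assms by (simp add: bottom_lattice_def)
  have "hmul (0, 0, 0, 0, w2, w1) y = hmul y (0, 0, 0, 0, w2, w1)" for y
    by (cases y rule: prod_cases6) simp
  then obtain t2 t1 where "\<rho> (0, 0, 0, 0, w2, w1) = (0, 0, 0, 0, t2, t1)"
    using central_image[OF x] by metis
  then show ?thesis using that \<rho>_mod[OF x] by simp
qed

text \<open>By \<open>bottom_image\<close> the restriction of \<open>\<rho>\<close> to the central
  elements of \<open>D\<close> has values in the centre. These are its two coordinates, additive
  modulo \<open>p\<close>.\<close>

definition "char2 w = fst (snd (snd (snd (snd (\<rho> (0, 0, 0, 0, fst w, snd w))))))"
definition "char1 w = snd (snd (snd (snd (snd (\<rho> (0, 0, 0, 0, fst w, snd w))))))"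

lemma chars_add:
  assumes "(w2, w1) \<in> bottom_lattice" "(w2', w1') \<in> bottom_lattice"
  shows "[char2 (w2 + w2', w1 + w1') = char2 (w2, w1) + char2 (w2', w1')] (mod p)"
    "[char1 (w2 + w2', w1 + w1') = char1 (w2, w1) + char1 (w2', w1')] (mod p)"
proof -
  obtain t2 t1 where t: "\<rho> (0, 0, 0, 0, w2, w1) = (0, 0, 0, 0, t2, t1)" using bottom_image[OF assms(1)] by blast
  obtain t2' t1' where t': "\<rho> (0, 0, 0, 0, w2', w1') = (0, 0, 0, 0, t2', t1')" using bottom_image[OF assms(2)] by blast
  have "\<rho> (hmul (0, 0, 0, 0, w2, w1) (0, 0, 0, 0, w2', w1')) =
      heis_mod p (hmul (0, 0, 0, 0, t2, t1) (0, 0, 0, 0, t2', t1'))"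
    using \<rho>_mult[of "(0, 0, 0, 0, w2, w1)" "(0, 0, 0, 0, w2', w1')"] assms
    by (simp add: bottom_lattice_def t t')
  then show "[char2 (w2 + w2', w1 + w1') = char2 (w2, w1) + char2 (w2', w1')] (mod p)"
    "[char1 (w2 + w2', w1 + w1') = char1 (w2, w1) + char1 (w2', w1')] (mod p)"
    by (simp_all add: char1_def char2_def t t' cong_def)
qed

text \<open>Modulo \<open>p\<close> every central element is a single commutator, that of
  \<open>\<alpha> = 1\<close> and \<open>\<beta> = t2 + t1 t\<close>. Preimages in \<open>D\<close> of
  these two elements have a commutator in \<open>D\<close> that \<open>\<rho>\<close> maps to the
  given value.\<close>

lemma commutators_onto:
  obtains u1 u2 u1' u2' w1 where "(u1, u2) \<in> top_lattice" "(u1', u2') \<in> top_lattice"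
    "(u1 * u2' - u2 * u1', w1) \<in> bottom_lattice"
    "[char2 (u1 * u2' - u2 * u1', w1) = t2] (mod p)" "[char1 (u1 * u2' - u2 * u1', w1) = t1] (mod p)"
proof -
  obtain y where y: "y \<in> D" "\<rho> y = heis_mod p (1, 0, 0, 0, 0, 0)" using \<rho>_onto by blast
  obtain z where z: "z \<in> D" "\<rho> z = heis_mod p (0, t2, 0, t1, 0, 0)" using \<rho>_onto by blast
  obtain u1 u2 v1 v2 r2 r1 where yc: "y = (u1, u2, v1, v2, r2, r1)" by (rule prod_cases6)
  obtain u1' u2' v1' v2' r2' r1' where zc: "z = (u1', u2', v1', v2', r2', r1')" by (rule prod_cases6)
  define w1 where "w1 = u1 * v2' - u2 * v1' + v1 * u2' - v2 * u1'"
  define x where "x = hmul (hmul y z) (hinv (hmul z y))"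
  have xc: "x = (0, 0, 0, 0, u1 * u2' - u2 * u1', w1)"
    unfolding x_def yc zc w1_def by (rule commutator_eq)
  have xD: "x \<in> D" unfolding x_def using y z by (simp add: commutator_closed)
  have w: "(u1 * u2' - u2 * u1', w1) \<in> bottom_lattice" using xD by (simp add: xc bottom_lattice_def)
  obtain s2 s1 where s: "\<rho> x = (0, 0, 0, 0, s2, s1)" using bottom_image[OF w] xc by metis
  have "hmul x (hmul z y) = hmul y z" by (simp add: x_def hmul_assoc)
  then have "\<rho> (hmul x (hmul z y)) = \<rho> (hmul y z)" by simp
  then have "heis_mod p (hmul (\<rho> x) (heis_mod p (hmul (\<rho> z) (\<rho> y)))) = heis_mod p (hmul (\<rho> y) (\<rho> z))"
    using xD y z closed by (simp add: \<rho>_mult)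
  then have "s2 mod p = t2 mod p" "s1 mod p = t1 mod p"
    using p by (simp_all add: s y(2) z(2))
  then have "[char2 (u1 * u2' - u2 * u1', w1) = t2] (mod p)" "[char1 (u1 * u2' - u2 * u1', w1) = t1] (mod p)"
    using s by (simp_all add: char1_def char2_def cong_def xc)
  moreover have "(u1, u2) \<in> top_lattice" "(u1', u2') \<in> top_lattice"
    using y(1) z(1) unfolding yc zc top_lattice_def by blast+
  ultimately show ?thesis using that w by blast
qed

text \<open>The bottom lattice has rank 2, and \<open>\<rho>\<close> maps it onto the centre
  \<open>(\<int>/p)\<^sup>2\<close>. By counting, the induced map on \<open>(\<int>/p)\<^sup>2\<close>
  is injective, so the kernel of \<open>\<rho>\<close> on the lattice consists of the multiples of
  \<open>p\<close>.\<close>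

lemma bottom_kernel:
  assumes gens: "\<And>x y. (x, y) \<in> bottom_lattice \<longleftrightarrow> (\<exists>i j. x = i * A \<and> y = i * B + j * C)"
    and w: "(w2, w1) \<in> bottom_lattice" "[char2 (w2, w1) = 0] (mod p)" "[char1 (w2, w1) = 0] (mod p)"
  shows "\<exists>w2' w1'. (w2', w1') \<in> bottom_lattice \<and> w2 = p * w2' \<and> w1 = p * w1'"
proof -
  have expand: "[\<phi> (i * A, i * B + j * C) = i * \<phi> (A, B) + j * \<phi> (0, C)] (mod p)"
    if add: "\<And>w2 w1 w2' w1'. (w2, w1) \<in> bottom_lattice \<Longrightarrow> (w2', w1') \<in> bottom_lattice \<Longrightarrow>
        [\<phi> (w2 + w2', w1 + w1') = \<phi> (w2, w1) + \<phi> (w2', w1')] (mod p)" for \<phi> :: "int \<times> int \<Rightarrow> int" and i j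
  proof -
    have b1: "(i * A, i * B) \<in> bottom_lattice" for i using gens by (metis add.right_neutral mult_zero_left)
    have b2: "(0, j * C) \<in> bottom_lattice" for j using gens by (metis add.left_neutral mult_zero_left)
    have "[\<phi> (i * A, i * B) = i * \<phi> (A, B)] (mod p)"
      using additive_mod_eq_mult[of "\<lambda>i. \<phi> (i * A, i * B)" p i] add[OF b1 b1] by (simp add: distrib_right)
    moreover have "[\<phi> (0, j * C) = j * \<phi> (0, C)] (mod p)"
      using additive_mod_eq_mult[of "\<lambda>j. \<phi> (0, j * C)" p j] add[OF b2 b2] by (simp add: distrib_right)
    ultimately have "[\<phi> (i * A, i * B) + \<phi> (0, j * C) = i * \<phi> (A, B) + j * \<phi> (0, C)] (mod p)" by (rule cong_add)
    then show ?thesis using cong_trans[OF add[OF b1 b2]] by simp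
  qed
  note ex2 = expand[of char2, OF chars_add(1)] and ex1 = expand[of char1, OF chars_add(2)]
  \<comment> \<open>The map that \<open>\<rho>\<close> induces on exponent vectors modulo
    \<open>p\<close>.\<close>
  define M where "M = (\<lambda>(i, j). ((i * char2 (A, B) + j * char2 (0, C)) mod p, (i * char1 (A, B) + j * char1 (0, C)) mod p))"
  let ?S = "{0..<p} \<times> {0..<p}"
  have M_red: "M (i mod p, j mod p) = M (i, j)" for i j
  proof -
    have "[i mod p * r + j mod p * s = i * r + j * s] (mod p)" for r s
      by (intro cong_add cong_mult cong_refl) (simp_all add: cong_def)
    then show ?thesis by (simp add: M_def cong_def)
  qed
  have "?S \<subseteq> M ` ?S"
  proof
    fix t assume "t \<in> ?S"
    then obtain t2 t1 where t: "t = (t2, t1)" "t2 mod p = t2" "t1 mod p = t1" by force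
    obtain w2 w1 where w: "(w2, w1) \<in> bottom_lattice" "[char2 (w2, w1) = t2] (mod p)" "[char1 (w2, w1) = t1] (mod p)"
      using commutators_onto[of t2 t1] by metis
    then obtain i j where "w2 = i * A" "w1 = i * B + j * C" using gens by blast
    then have "M (i, j) = t"
      using w(2,3) ex2[of i j] ex1[of i j] t by (simp add: M_def cong_def)
    then have "M (i mod p, j mod p) = t" using M_red by simp
    then show "t \<in> M ` ?S" using p by (intro image_eqI[of _ _ "(i mod p, j mod p)"]) auto
  qed
  then have inj: "inj_on M ?S" by (intro finite_surj_inj) auto
  obtain i j where ij: "w2 = i * A" "w1 = i * B + j * C" using gens w(1) by blast
  have "M (i mod p, j mod p) = M (0, 0)"
    using w(2,3) ex2[of i j] ex1[of i j] unfolding M_red ij by (simp add: M_def cong_def)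
  from inj_onD[OF inj this] have "(i mod p, j mod p) = (0, 0)" using p by simp
  then obtain i' j' where ij': "i = p * i'" "j = p * j'" by (auto simp: mod_eq_0_iff_dvd dvd_def)
  have "(i' * A, i' * B + j' * C) \<in> bottom_lattice" using gens by blast
  then show ?thesis using ij ij' by (intro exI[of _ "i' * A"] exI[of _ "i' * B + j' * C"]) (simp add: algebra_simps)
qed

text \<open>The same counting argument in rank 4: modulo its central elements \<open>D\<close> is
  generated by four elements, and \<open>\<rho>\<close> induces a surjection of
  \<open>(\<int>/p)\<^sup>4\<close> to itself, which is therefore injective. An element of
  \<open>D\<close> with \<open>u1 = u2 = 0\<close> whose image is central thus has all exponents
  divisible by \<open>p\<close>.\<close>

lemma mid_kernel:
  assumes top: "\<And>x y. (x, y) \<in> top_lattice \<longleftrightarrow> (\<exists>i j. x = i * A \<and> y = i * B + j * C)" "A > 0" "C > 0"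
    and mid: "\<And>x y. (x, y) \<in> mid_lattice \<longleftrightarrow> (\<exists>i j. x = i * A2 \<and> y = i * B2 + j * C2)" "A2 > 0" "C2 > 0"
    and h: "h = (0, 0, v1, v2, w2, w1)" "h \<in> D" "\<rho> h = (0, 0, 0, 0, t2, t1)"
  shows "\<exists>v1' v2'. (v1', v2') \<in> mid_lattice \<and> v1 = p * v1' \<and> v2 = p * v2'"
proof -
  have "(A, B) \<in> top_lattice" "(0, C) \<in> top_lattice" "(A2, B2) \<in> mid_lattice" "(0, C2) \<in> mid_lattice"
    using top mid by (metis add.right_neutral add.left_neutral mult_zero_left mult_1)+
  then obtain g1 g2 h1 h2 f1 f2 f3 f4 f5 f6 f7 f8 e1 e2 e3 e4 where
    g: "g1 = (A, B, f1, f2, f3, f4)" "g1 \<in> D" "g2 = (0, C, f5, f6, f7, f8)" "g2 \<in> D"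
      "h1 = (0, 0, A2, B2, e1, e2)" "h1 \<in> D" "h2 = (0, 0, 0, C2, e3, e4)" "h2 \<in> D"
    unfolding top_lattice_def mid_lattice_def by blast
  have decomp: "\<exists>i j s l z2 z1. (0, 0, 0, 0, z2, z1) \<in> D \<and>
      x = hmul (hpow g1 i) (hmul (hpow g2 j) (hmul (hpow h1 s) (hmul (hpow h2 l) (0, 0, 0, 0, z2, z1))))"
    if x: "x \<in> D" for x
  proof -
    obtain u1 u2 x3 x4 x5 x6 where xc: "x = (u1, u2, x3, x4, x5, x6)" by (rule prod_cases6)
    then have "(u1, u2) \<in> top_lattice" using x unfolding top_lattice_def by blast
    then obtain i j where ij: "u1 = i * A" "u2 = i * B + j * C" using top by blast
    \<comment> \<open>Strip off the powers of the four generators one after the other; what remains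
      is central.\<close>
    define x' where "x' = hmul (hinv (hpow g2 j)) (hmul (hinv (hpow g1 i)) x)"
    have x'D: "x' \<in> D" unfolding x'_def using x g by (intro closed hpow_closed) auto
    obtain y3 y4 y5 y6 where x'c: "x' = (0, 0, y3, y4, y5, y6)" by (simp add: x'_def g(1,3) xc ij)
    have "(y3, y4) \<in> mid_lattice" using x'D x'c unfolding mid_lattice_def by blast
    then obtain s l where sl: "y3 = s * A2" "y4 = s * B2 + l * C2" using mid by blast
    define x'' where "x'' = hmul (hinv (hpow h2 l)) (hmul (hinv (hpow h1 s)) x')"
    have x''D: "x'' \<in> D" unfolding x''_def using x'D g by (intro closed hpow_closed) auto
    obtain z2 z1 where x''c: "x'' = (0, 0, 0, 0, z2, z1)" by (simp add: x''_def g(5,7) x'c sl)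
    have cancel: "hmul g (hmul (hinv g) y) = y" for g y by (simp add: hmul_assoc[symmetric])
    have "hmul (hpow g1 i) (hmul (hpow g2 j) (hmul (hpow h1 s) (hmul (hpow h2 l) x''))) = x"
      unfolding x''_def x'_def by (simp add: cancel del: hpow.simps hinv.simps)
    then show ?thesis using x''D unfolding x''c by metis
  qed
  have expand: "\<exists>z2 z1. x = hmul (hpow g1 i) (hmul (hpow g2 j) (hmul (hpow h1 s) (hmul (hpow h2 l) (0, 0, 0, 0, z2, z1))))
      \<and> (0, 0, 0, 0, z2, z1) \<in> D \<Longrightarrow>
      [\<phi> x = i * \<phi> g1 + j * \<phi> g2 + s * \<phi> h1 + l * \<phi> h2] (mod p)"
    if all_add: "\<forall>x\<in>D. \<forall>y\<in>D. [\<phi> (hmul x y) = \<phi> x + \<phi> y] (mod p)"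
      and all_zero: "\<forall>z2 z1. (0, 0, 0, 0, z2, z1) \<in> D \<longrightarrow> \<phi> (0, 0, 0, 0, z2, z1) = 0"
    for \<phi> :: "heis \<Rightarrow> int" and x i j s l
  proof -
    note add = all_add[rule_format] and zero = all_zero[rule_format]
    assume "\<exists>z2 z1. x = hmul (hpow g1 i) (hmul (hpow g2 j) (hmul (hpow h1 s) (hmul (hpow h2 l) (0, 0, 0, 0, z2, z1))))
      \<and> (0, 0, 0, 0, z2, z1) \<in> D"
    then obtain z2 z1 where x: "x = hmul (hpow g1 i) (hmul (hpow g2 j) (hmul (hpow h1 s) (hmul (hpow h2 l) (0, 0, 0, 0, z2, z1))))"
      and zD: "(0, 0, 0, 0, z2, z1) \<in> D" by blast
    have pow: "[\<phi> (hpow y i) = i * \<phi> y] (mod p)" if "y \<in> D" for y i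
    proof -
      have "hpow y 1 = y" by (cases y rule: prod_cases6) simp
      then show ?thesis
        using additive_mod_eq_mult[of "\<lambda>i. \<phi> (hpow y i)" p i] add[OF hpow_closed[OF that] hpow_closed[OF that]]
        by (simp add: hpow_add)
    qed
    have 4: "[\<phi> (hmul (hpow h2 l) (0, 0, 0, 0, z2, z1)) = l * \<phi> h2] (mod p)"
      using add[OF hpow_closed[OF g(8)] zD] zero[OF zD] pow[OF g(8)] by (metis add.right_neutral cong_trans)
    have 3: "[\<phi> (hmul (hpow h1 s) (hmul (hpow h2 l) (0, 0, 0, 0, z2, z1))) = s * \<phi> h1 + l * \<phi> h2] (mod p)"
      by (rule cong_trans[OF add cong_add[OF pow 4]]) (use g zD in \<open>auto intro!: closed hpow_closed simp del: hpow.simps hmul.simps\<close>)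
    have 2: "[\<phi> (hmul (hpow g2 j) (hmul (hpow h1 s) (hmul (hpow h2 l) (0, 0, 0, 0, z2, z1)))) = j * \<phi> g2 + (s * \<phi> h1 + l * \<phi> h2)] (mod p)"
      by (rule cong_trans[OF add cong_add[OF pow 3]]) (use g zD in \<open>auto intro!: closed hpow_closed simp del: hpow.simps hmul.simps\<close>)
    have "[\<phi> x = i * \<phi> g1 + (j * \<phi> g2 + (s * \<phi> h1 + l * \<phi> h2))] (mod p)"
      unfolding x by (rule cong_trans[OF add cong_add[OF pow 2]]) (use g zD in \<open>auto intro!: closed hpow_closed simp del: hpow.simps hmul.simps\<close>)
    then show ?thesis by (simp add: add.assoc)
  qed
  define \<phi>1 where "\<phi>1 x = fst (\<rho> x)" for x
  define \<phi>2 where "\<phi>2 x = fst (snd (\<rho> x))" for x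
  define \<phi>3 where "\<phi>3 x = fst (snd (snd (\<rho> x)))" for x
  define \<phi>4 where "\<phi>4 x = fst (snd (snd (snd (\<rho> x))))" for x
  note \<phi>_defs = \<phi>1_def \<phi>2_def \<phi>3_def \<phi>4_def
  have "[\<phi>1 (hmul x y) = \<phi>1 x + \<phi>1 y] (mod p) \<and> [\<phi>2 (hmul x y) = \<phi>2 x + \<phi>2 y] (mod p) \<and>
    [\<phi>3 (hmul x y) = \<phi>3 x + \<phi>3 y] (mod p) \<and> [\<phi>4 (hmul x y) = \<phi>4 x + \<phi>4 y] (mod p)"
    if "x \<in> D" "y \<in> D" for x y
    by (cases "\<rho> x" rule: prod_cases6; cases "\<rho> y" rule: prod_cases6; simp add: \<phi>_defs \<rho>_mult that cong_def)
  then have add: "\<forall>x\<in>D. \<forall>y\<in>D. [\<phi>1 (hmul x y) = \<phi>1 x + \<phi>1 y] (mod p)" "\<forall>x\<in>D. \<forall>y\<in>D. [\<phi>2 (hmul x y) = \<phi>2 x + \<phi>2 y] (mod p)"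
    "\<forall>x\<in>D. \<forall>y\<in>D. [\<phi>3 (hmul x y) = \<phi>3 x + \<phi>3 y] (mod p)" "\<forall>x\<in>D. \<forall>y\<in>D. [\<phi>4 (hmul x y) = \<phi>4 x + \<phi>4 y] (mod p)"
    by blast+
  have "\<phi>1 (0, 0, 0, 0, z2, z1) = 0 \<and> \<phi>2 (0, 0, 0, 0, z2, z1) = 0 \<and>
    \<phi>3 (0, 0, 0, 0, z2, z1) = 0 \<and> \<phi>4 (0, 0, 0, 0, z2, z1) = 0" if "(0, 0, 0, 0, z2, z1) \<in> D" for z2 z1
  proof -
    have "(z2, z1) \<in> bottom_lattice" using that by (simp add: bottom_lattice_def)
    then obtain t2 t1 where "\<rho> (0, 0, 0, 0, z2, z1) = (0, 0, 0, 0, t2, t1)" using bottom_image by blast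
    then show ?thesis by (simp add: \<phi>_defs)
  qed
  then have zero: "\<forall>z2 z1. (0, 0, 0, 0, z2, z1) \<in> D \<longrightarrow> \<phi>1 (0, 0, 0, 0, z2, z1) = 0"
    "\<forall>z2 z1. (0, 0, 0, 0, z2, z1) \<in> D \<longrightarrow> \<phi>2 (0, 0, 0, 0, z2, z1) = 0"
    "\<forall>z2 z1. (0, 0, 0, 0, z2, z1) \<in> D \<longrightarrow> \<phi>3 (0, 0, 0, 0, z2, z1) = 0"
    "\<forall>z2 z1. (0, 0, 0, 0, z2, z1) \<in> D \<longrightarrow> \<phi>4 (0, 0, 0, 0, z2, z1) = 0"
    by blast+
  note ex = expand[of \<phi>1, OF add(1) zero(1)] expand[of \<phi>2, OF add(2) zero(2)]
    expand[of \<phi>3, OF add(3) zero(3)] expand[of \<phi>4, OF add(4) zero(4)]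
  define lin where "lin \<phi> i j s l = (i * \<phi> g1 + j * \<phi> g2 + s * \<phi> h1 + l * \<phi> h2) mod p"
    for \<phi> :: "heis \<Rightarrow> int" and i j s l
  define M where "M = (\<lambda>(i, j, s, l). (lin \<phi>1 i j s l, lin \<phi>2 i j s l, lin \<phi>3 i j s l, lin \<phi>4 i j s l))"
  let ?S = "{0..<p} \<times> {0..<p} \<times> {0..<p} \<times> {0..<p}"
  have M_red: "M (i mod p, j mod p, s mod p, l mod p) = M (i, j, s, l)" for i j s l
  proof -
    have "[i mod p * a + j mod p * b + s mod p * c + l mod p * d = i * a + j * b + s * c + l * d] (mod p)" for a b c d
      by (intro cong_add cong_mult cong_refl) (simp_all add: cong_def)
    then show ?thesis by (simp add: M_def lin_def cong_def)
  qed
  have M_eq: "M (i, j, s, l) = (\<phi>1 x mod p, \<phi>2 x mod p, \<phi>3 x mod p, \<phi>4 x mod p)"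
    if "\<exists>z2 z1. x = hmul (hpow g1 i) (hmul (hpow g2 j) (hmul (hpow h1 s) (hmul (hpow h2 l) (0, 0, 0, 0, z2, z1))))
      \<and> (0, 0, 0, 0, z2, z1) \<in> D" for x i j s l
    using ex(1)[OF that] ex(2)[OF that] ex(3)[OF that] ex(4)[OF that]
    by (simp add: M_def lin_def cong_def)
  have "?S \<subseteq> M ` ?S"
  proof
    fix t assume "t \<in> ?S"
    then obtain t1 t2 t3 t4 where t: "t = (t1, t2, t3, t4)" "t1 mod p = t1" "t2 mod p = t2" "t3 mod p = t3" "t4 mod p = t4"
      by force
    obtain x where x: "x \<in> D" "\<rho> x = heis_mod p (t1, t2, t3, t4, 0, 0)" using \<rho>_onto by blast
    obtain i j s l where ijsl: "\<exists>z2 z1. x = hmul (hpow g1 i) (hmul (hpow g2 j) (hmul (hpow h1 s) (hmul (hpow h2 l) (0, 0, 0, 0, z2, z1))))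
      \<and> (0, 0, 0, 0, z2, z1) \<in> D" using decomp[OF x(1)] by blast
    have "M (i mod p, j mod p, s mod p, l mod p) = t"
      unfolding M_red M_eq[OF ijsl] by (simp add: \<phi>_defs x(2) t)
    then show "t \<in> M ` ?S" using p by (intro image_eqI[of _ _ "(i mod p, j mod p, s mod p, l mod p)"]) auto
  qed
  then have inj: "inj_on M ?S" by (intro finite_surj_inj) auto
  obtain i j s l z2 z1 where ijsl: "h = hmul (hpow g1 i) (hmul (hpow g2 j) (hmul (hpow h1 s) (hmul (hpow h2 l) (0, 0, 0, 0, z2, z1))))"
      "(0, 0, 0, 0, z2, z1) \<in> D" using decomp[OF h(2)] by blast
  then have "M (i mod p, j mod p, s mod p, l mod p) = (\<phi>1 h mod p, \<phi>2 h mod p, \<phi>3 h mod p, \<phi>4 h mod p)"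
    unfolding M_red by (intro M_eq) blast
  also have "\<dots> = M (0, 0, 0, 0)" by (simp add: \<phi>_defs h(3) M_def lin_def)
  finally have M0: "M (i mod p, j mod p, s mod p, l mod p) = M (0, 0, 0, 0)" .
  from inj_onD[OF inj M0] have "(i mod p, j mod p, s mod p, l mod p) = (0, 0, 0, 0)" using p by simp
  then obtain s' l' where sl: "s = p * s'" "l = p * l'" by (auto simp: mod_eq_0_iff_dvd dvd_def)
  have "i * A = 0" "i * B + j * C = 0" and v: "v1 = i * f1 + j * f5 + s * A2" "v2 = i * f2 + j * f6 + s * B2 + l * C2"
    using ijsl(1) unfolding h(1) g(1,3,5,7) by simp_all
  then have "i = 0" "j = 0" using top(2,3) by auto
  then have "v1 = p * (s' * A2)" "v2 = p * (s' * B2 + l' * C2)" using v by (simp_all add: sl algebra_simps)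
  moreover have "(s' * A2, s' * B2 + l' * C2) \<in> mid_lattice" using mid(1) by blast
  ultimately show ?thesis by blast
qed

end


section \<open>Subgroups with all Heisenberg quotients are images of endomorphisms\<close>

text \<open>The centre is generated by commutators of these four elements.\<close>

lemma heis_generated:
  assumes K: "subgroup K heis_group"
    and "(1, 0, 0, 0, 0, 0) \<in> K" "(0, 1, 0, 0, 0, 0) \<in> K" "(0, 0, 1, 0, 0, 0) \<in> K" "(0, 0, 0, 1, 0, 0) \<in> K"
  shows "g \<in> K"
proof -
  interpret heis_subgroup K by (rule heis_subgroup.intro) (rule K)
  have z2: "(0, 0, 0, 0, 1, 0) \<in> K" using commutator_closed[OF assms(2,3)] by simp
  have z1: "(0, 0, 0, 0, 0, 1) \<in> K" using commutator_closed[OF assms(2,5)] by simp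
  obtain u1 u2 v1 v2 w2 w1 where g: "g = (u1, u2, v1, v2, w2, w1)" by (rule prod_cases6)
  note pow = hpow_closed[OF assms(2), of u1] hpow_closed[OF assms(3), of u2] hpow_closed[OF assms(4), of v1]
    hpow_closed[OF assms(5), of v2] hpow_closed[OF z2, of w2] hpow_closed[OF z1, of w1]
  have "hmul (hpow (0, 1, 0, 0, 0, 0) u2) (hmul (hpow (0, 0, 0, 1, 0, 0) v2) (hmul (hpow (1, 0, 0, 0, 0, 0) u1)
      (hmul (hpow (0, 0, 1, 0, 0, 0) v1) (hmul (hpow (0, 0, 0, 0, 1, 0) w2) (hpow (0, 0, 0, 0, 0, 1) w1))))) \<in> K"
    by (intro closed pow)
  then show ?thesis by (simp add: g)
qed

text \<open>The finite quotients through which the profinite completion enters the classification.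
  Groups with the same completion as \<open>\<Gamma>\<close> have them, and conversely they already
  force a subgroup of finite index to be isomorphic to \<open>\<Gamma>\<close>.\<close>

definition has_heis_quotients :: "heis set \<Rightarrow> bool" where
  "has_heis_quotients D \<longleftrightarrow> (\<forall>p. prime p \<longrightarrow>
     (\<exists>\<rho>\<in>hom (heis_group\<lparr>carrier := D\<rparr>) (heis_mod_group p). \<rho> ` D = range (heis_mod p)))"

locale good_heis_subgroup = finite_index_heis_subgroup +
  assumes quotients: "has_heis_quotients D"
begin

lemma mod_quotient:
  assumes "prime (p :: int)"
  obtains \<rho> where "heis_subgroup_mod D p \<rho>"
proof -
  obtain \<rho> where "\<rho> \<in> hom (heis_group\<lparr>carrier := D\<rparr>) (heis_mod_group p)" "\<rho> ` D = range (heis_mod p)"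
    using quotients assms unfolding has_heis_quotients_def by blast
  then have "heis_subgroup_mod D p \<rho>"
    using prime_gt_1_int[OF assms] D by unfold_locales auto
  then show ?thesis by (rule that)
qed

text \<open>The commutator of the two generators of the top lattice has first coordinate \<open>A
  C\<close>, so \<open>A3\<close> divides \<open>A C\<close>. Suppose that a prime \<open>p\<close>
  divides the quotient. The first coordinates of all commutators are multiples of \<open>A C\<close>,
  hence of \<open>p A3\<close>. Some commutator has the same image under \<open>\<rho>\<close> as
  \<open>(A3, B3)\<close>; the difference is divisible by \<open>p\<close> in the bottom lattice, so
  that \<open>p A3\<close> divides \<open>A3\<close>.\<close>

lemma bottom_leading:
  assumes top: "A > 0" "C > 0" "\<And>x y. (x, y) \<in> top_lattice \<longleftrightarrow> (\<exists>i j. x = i * A \<and> y = i * B + j * C)"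
    and bot: "A3 > 0" "\<And>x y. (x, y) \<in> bottom_lattice \<longleftrightarrow> (\<exists>i j. x = i * A3 \<and> y = i * B3 + j * C3)"
  shows "A3 = A * C"
proof -
  have "(A, B) \<in> top_lattice" "(0, C) \<in> top_lattice"
    using top(3) by (metis add.right_neutral add.left_neutral mult_zero_left mult_1)+
  then obtain f1 f2 f3 f4 f5 f6 f7 f8 where
    g: "(A, B, f1, f2, f3, f4) \<in> D" "(0, C, f5, f6, f7, f8) \<in> D"
    unfolding top_lattice_def by blast
  have "\<exists>y. (A * C, y) \<in> bottom_lattice"
    using commutator_closed[OF g] unfolding commutator_eq bottom_lattice_def by auto
  then obtain i where i: "A * C = i * A3" using bot(2) by blast
  then have "i > 0" using top(1,2) bot(1) by (metis mult_pos_pos zero_less_mult_pos2)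
  have "i = 1"
  proof (rule ccontr)
    assume "i \<noteq> 1"
    then have "\<not> is_unit i" using \<open>i > 0\<close> by auto
    then obtain p where pr: "prime p" "p dvd i" using prime_divisor_exists \<open>i > 0\<close> by (metis less_irrefl)
    obtain \<rho> where "heis_subgroup_mod D p \<rho>" using mod_quotient[OF pr(1)] by blast
    then interpret heis_subgroup_mod D p \<rho> .
    have c: "(A3, B3) \<in> bottom_lattice" using bot(2) by (metis add.right_neutral mult_zero_left mult_1)
    obtain u1 u2 u1' u2' w1 where u: "(u1, u2) \<in> top_lattice" "(u1', u2') \<in> top_lattice"
      "(u1 * u2' - u2 * u1', w1) \<in> bottom_lattice"
      "[char2 (u1 * u2' - u2 * u1', w1) = char2 (A3, B3)] (mod p)"
      "[char1 (u1 * u2' - u2 * u1', w1) = char1 (A3, B3)] (mod p)"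
      using commutators_onto by blast
    define x2 where "x2 = u1 * u2' - u2 * u1'"
    obtain r s r' s' where "u1 = r * A" "u2 = r * B + s * C" "u1' = r' * A" "u2' = r' * B + s' * C"
      using u(1,2) top(3) by metis
    then have x2: "x2 = (r * s' - s * r') * (A * C)" by (simp add: x2_def algebra_simps)
    note u' = u(3,4,5)[folded x2_def]
    have diff: "(A3 - x2, B3 - w1) \<in> bottom_lattice" using lattice_diff(3)[OF c u'(1)] .
    have "[char2 (A3 - x2, B3 - w1) + char2 (x2, w1) = 0 + char2 (x2, w1)] (mod p)"
      using chars_add(1)[OF diff u'(1)] u'(2) by (simp add: cong_def)
    then have c2: "[char2 (A3 - x2, B3 - w1) = 0] (mod p)" using cong_add_rcancel by blast
    have "[char1 (A3 - x2, B3 - w1) + char1 (x2, w1) = 0 + char1 (x2, w1)] (mod p)"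
      using chars_add(2)[OF diff u'(1)] u'(3) by (simp add: cong_def)
    then have c1: "[char1 (A3 - x2, B3 - w1) = 0] (mod p)" using cong_add_rcancel by blast
    obtain w2' w1' where "(w2', w1') \<in> bottom_lattice" "A3 - x2 = p * w2'"
      using bottom_kernel[OF bot(2) diff c2 c1] by blast
    moreover from this(1) obtain n where "w2' = n * A3" using bot(2) by blast
    ultimately have n: "A3 - x2 = p * (n * A3)" by simp
    obtain q where q: "i = p * q" using pr(2) by (auto simp: dvd_def)
    have "A3 * (1 - p * (n + (r * s' - s * r') * q)) = 0"
      using n unfolding x2 i q by (simp add: algebra_simps)
    then have "1 = p * (n + (r * s' - s * r') * q)" using bot(1) by simp
    then have "p dvd 1" by (metis dvd_triv_left)
    then show False using pr(1) by (simp add: prime_int_iff zdvd1_eq)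
  qed
  then show ?thesis using i by simp
qed

text \<open>Take an element \<open>h\<close> of \<open>D\<close> with \<open>u1 = u2 = 0\<close>
  whose commutators with \<open>D\<close> are all \<open>p\<close>-th powers of central elements of
  \<open>D\<close>. Since \<open>\<rho>\<close> kills those powers, \<open>\<rho> h\<close> is
  central, and \<open>mid_kernel\<close> applies.\<close>

lemma mid_divisible:
  assumes top: "A > 0" "C > 0" "\<And>x y. (x, y) \<in> top_lattice \<longleftrightarrow> (\<exists>i j. x = i * A \<and> y = i * B + j * C)"
    and mid: "A2 > 0" "C2 > 0" "\<And>x y. (x, y) \<in> mid_lattice \<longleftrightarrow> (\<exists>i j. x = i * A2 \<and> y = i * B2 + j * C2)"
    and bot: "\<And>x y. (x, y) \<in> bottom_lattice \<longleftrightarrow> (\<exists>i j. x = i * A3 \<and> y = i * B3 + j * C3)"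
    and p: "prime p" and v: "(v1, v2) \<in> mid_lattice"
    and dvd: "\<And>u1 u2. (u1, u2) \<in> top_lattice \<Longrightarrow> p * C3 dvd u1 * v2 - u2 * v1"
  shows "\<exists>v1' v2'. (v1', v2') \<in> mid_lattice \<and> v1 = p * v1' \<and> v2 = p * v2'"
proof -
  obtain \<rho> where "heis_subgroup_mod D p \<rho>" using mod_quotient[OF p] by blast
  then interpret heis_subgroup_mod D p \<rho> .
  obtain w2 w1 where h: "(0, 0, v1, v2, w2, w1) \<in> D" using v by (auto simp: mid_lattice_def)
  have "\<rho> (hmul (0, 0, v1, v2, w2, w1) y) = \<rho> (hmul y (0, 0, v1, v2, w2, w1))" if y: "y \<in> D" for y
  proof -
    obtain u1 u2 y3 y4 y5 y6 where yc: "y = (u1, u2, y3, y4, y5, y6)" by (rule prod_cases6)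
    have "(u1, u2) \<in> top_lattice" using y unfolding yc top_lattice_def by blast
    from dvd[OF this] obtain r where "u1 * v2 - u2 * v1 = p * C3 * r" by (auto simp: dvd_def)
    then have r: "u1 * v2 - u2 * v1 = p * (r * C3)" by simp
    have b: "(0, i * (r * C3)) \<in> bottom_lattice" for i
      using bot[of 0 "i * (r * C3)"] by (metis add.left_neutral mult.assoc mult_zero_left)
    have "[char2 (0, p * (r * C3)) = p * char2 (0, 1 * (r * C3))] (mod p)"
      "[char1 (0, p * (r * C3)) = p * char1 (0, 1 * (r * C3))] (mod p)"
      using additive_mod_eq_mult[of "\<lambda>i. char2 (0, i * (r * C3))" p p]
        additive_mod_eq_mult[of "\<lambda>i. char1 (0, i * (r * C3))" p p]
        chars_add[OF b b] by (simp_all add: distrib_right)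
    moreover obtain t2 t1 where t: "\<rho> (0, 0, 0, 0, 0, p * (r * C3)) = (0, 0, 0, 0, t2, t1)" "t2 mod p = t2" "t1 mod p = t1"
      using bottom_image[OF b] by blast
    ultimately have "t2 = 0" "t1 = 0" by (simp_all add: char1_def char2_def cong_def)
    then have one: "\<rho> (0, 0, 0, 0, 0, p * (r * C3)) = hone" using t(1) by simp
    have zD: "(0, 0, 0, 0, 0, p * (r * C3)) \<in> D" using b[of p] by (simp add: bottom_lattice_def)
    have "hmul y (0, 0, v1, v2, w2, w1) = hmul (hmul (0, 0, v1, v2, w2, w1) y) (0, 0, 0, 0, 0, p * (r * C3))"
      using r by (simp add: yc algebra_simps)
    then have "\<rho> (hmul y (0, 0, v1, v2, w2, w1)) = heis_mod p (\<rho> (hmul (0, 0, v1, v2, w2, w1) y))"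
      using \<rho>_mult[OF closed(2)[OF h y] zD] one by simp
    then show ?thesis using \<rho>_mod[OF closed(2)[OF h y]] by simp
  qed
  then obtain t2 t1 where "\<rho> (0, 0, v1, v2, w2, w1) = (0, 0, 0, 0, t2, t1)" using central_image[OF h] by blast
  from mid_kernel[OF top(3,1,2) mid(3,1,2) HOL.refl h this] show ?thesis .
qed

text \<open>The middle lattice is \<open>C3 / (A C)\<close> times the top lattice. For one
  inclusion, the determinant of a top vector and a middle vector is a commutator, hence a multiple of
  \<open>C3\<close>, and the dual of the top lattice under the determinant form is \<open>1 / (A
  C)\<close> times itself. For the other, take the least \<open>N > 0\<close> such that \<open>N C3 /
  (A C)\<close> times the given top vector is in the middle lattice. A prime factor of
  \<open>N\<close> could be divided out by \<open>mid_divisible\<close>, so \<open>N =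
  1\<close>.\<close>

lemma mid_characterization:
  assumes top: "A > 0" "C > 0" "\<And>x y. (x, y) \<in> top_lattice \<longleftrightarrow> (\<exists>i j. x = i * A \<and> y = i * B + j * C)"
    and mid: "A2 > 0" "C2 > 0" "\<And>x y. (x, y) \<in> mid_lattice \<longleftrightarrow> (\<exists>i j. x = i * A2 \<and> y = i * B2 + j * C2)"
    and bot: "A3 > 0" "C3 > 0" "\<And>x y. (x, y) \<in> bottom_lattice \<longleftrightarrow> (\<exists>i j. x = i * A3 \<and> y = i * B3 + j * C3)"
  shows mid_scaled: "(v1, v2) \<in> mid_lattice \<Longrightarrow> \<exists>l1 l2. (l1, l2) \<in> top_lattice \<and> A * C * v1 = C3 * l1 \<and> A * C * v2 = C3 * l2"
    and mid_onto: "(l1, l2) \<in> top_lattice \<Longrightarrow> \<exists>v1 v2. (v1, v2) \<in> mid_lattice \<and> A * C * v1 = C3 * l1 \<and> A * C * v2 = C3 * l2"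
proof -
  show "\<exists>l1 l2. (l1, l2) \<in> top_lattice \<and> A * C * v1 = C3 * l1 \<and> A * C * v2 = C3 * l2" if v: "(v1, v2) \<in> mid_lattice"
  proof -
    obtain w2 w1 where h: "(0, 0, v1, v2, w2, w1) \<in> D" using v by (auto simp: mid_lattice_def)
    have "C3 dvd u1 * v2 - u2 * v1" if u: "(u1, u2) \<in> top_lattice" for u1 u2
    proof -
      obtain y3 y4 y5 y6 where y: "(u1, u2, y3, y4, y5, y6) \<in> D" using u by (auto simp: top_lattice_def)
      have "(0, u1 * v2 - u2 * v1) \<in> bottom_lattice"
        using commutator_closed[OF y h] unfolding commutator_eq bottom_lattice_def by simp
      then obtain i j where "0 = i * A3" "u1 * v2 - u2 * v1 = i * B3 + j * C3" using bot(3) by blast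
      then show ?thesis using bot(1) by auto
    qed
    moreover have "(A, B) \<in> top_lattice" "(0, C) \<in> top_lattice"
      using top(3) by (metis add.right_neutral add.left_neutral mult_zero_left mult_1)+
    ultimately have "C3 dvd A * v2 - B * v1" "C3 dvd 0 * v2 - C * v1" by blast+
    then obtain r1 r2 where r: "A * v2 - B * v1 = C3 * r1" "- C * v1 = C3 * r2" by (auto simp: dvd_def)
    have e1: "A * C * v1 = C3 * (- r2 * A)"
    proof -
      have "A * C * v1 = - A * (- C * v1)" by simp
      then show ?thesis unfolding r(2) by simp
    qed
    have e2: "A * C * v2 = C3 * (- r2 * B + r1 * C)"
    proof -
      have "A * C * v2 = C * (A * v2 - B * v1) - B * (- C * v1)" by (simp add: algebra_simps)
      then show ?thesis unfolding r by (simp add: algebra_simps)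
    qed
    have "(- r2 * A, - r2 * B + r1 * C) \<in> top_lattice" using top(3) by blast
    then show ?thesis using e1 e2 by blast
  qed
  show "\<exists>v1 v2. (v1, v2) \<in> mid_lattice \<and> A * C * v1 = C3 * l1 \<and> A * C * v2 = C3 * l2" if l: "(l1, l2) \<in> top_lattice"
  proof -
    \<comment> \<open>\<open>N (C3 / (A C)) l\<close> lies in the middle lattice; such
      \<open>N\<close> exist because that lattice has finite index.\<close>
    define P where "P N \<longleftrightarrow> N > 0 \<and> (\<exists>v1 v2. (v1, v2) \<in> mid_lattice \<and> A * C * v1 = int N * (C3 * l1) \<and> A * C * v2 = int N * (C3 * l2))" for N
    have multiple: "(A2 * C2 * x, A2 * C2 * y) \<in> mid_lattice" for x y
    proof -
      have "A2 * C2 * x = (C2 * x) * A2" "A2 * C2 * y = (C2 * x) * B2 + (A2 * y - x * B2) * C2" by (simp_all add: algebra_simps)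
      then show ?thesis using mid(3) by blast
    qed
    have "P (nat (A * C * (A2 * C2)))"
      unfolding P_def using top(1,2) mid(1,2) multiple[of "C3 * l1" "C3 * l2"]
      by (intro conjI exI[of _ "A2 * C2 * (C3 * l1)"] exI[of _ "A2 * C2 * (C3 * l2)"]) (auto simp: zero_less_mult_iff)
    then obtain N where N: "P N" and minimal: "\<And>n. P n \<Longrightarrow> N \<le> n"
      using LeastI[of P] Least_le[of P] by blast
    have "N = 1"
    proof (rule ccontr)
      assume "N \<noteq> 1"
      then obtain p where p: "prime p" "p dvd N" using prime_factor_nat by blast
      then obtain N' where N': "N = p * N'" by (auto simp: dvd_def)
      obtain v1 v2 where v: "(v1, v2) \<in> mid_lattice" "A * C * v1 = int N * (C3 * l1)" "A * C * v2 = int N * (C3 * l2)"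
        using N by (auto simp: P_def)
      have "int p * C3 dvd u1 * v2 - u2 * v1" if u: "(u1, u2) \<in> top_lattice" for u1 u2
      proof -
        obtain i j i' j' where ij: "u1 = i * A" "u2 = i * B + j * C" "l1 = i' * A" "l2 = i' * B + j' * C"
          using u l top(3) by metis
        have "A * C * (u1 * v2 - u2 * v1) = u1 * (A * C * v2) - u2 * (A * C * v1)" by (simp add: algebra_simps)
        also have "\<dots> = int N * C3 * (u1 * l2 - u2 * l1)" unfolding v(2,3) by (simp add: algebra_simps)
        also have "u1 * l2 - u2 * l1 = A * C * (i * j' - j * i')" unfolding ij by (simp add: algebra_simps)
        finally have "A * C * (u1 * v2 - u2 * v1) = A * C * (int N * C3 * (i * j' - j * i'))" by (simp add: algebra_simps)
        then have "u1 * v2 - u2 * v1 = int N * C3 * (i * j' - j * i')" using top(1,2) by simp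
        then show ?thesis unfolding N' by simp
      qed
      then obtain v1' v2' where v': "(v1', v2') \<in> mid_lattice" "v1 = int p * v1'" "v2 = int p * v2'"
        using mid_divisible[OF top mid bot(3) _ v(1), of "int p"] p(1) by auto
      have "int p * (A * C * v1') = int p * (int N' * (C3 * l1))" "int p * (A * C * v2') = int p * (int N' * (C3 * l2))"
        using v(2,3) unfolding v'(2,3) N' by (simp_all add: algebra_simps)
      then have "A * C * v1' = int N' * (C3 * l1)" "A * C * v2' = int N' * (C3 * l2)"
        using prime_gt_0_nat[OF p(1)] by simp_all
      moreover have "N' > 0" using N N' by (cases N') (auto simp: P_def)
      ultimately have "P N'" using v'(1) unfolding P_def by blast
      then have "N \<le> N'" by (rule minimal)
      then show False using N' prime_gt_1_nat[OF p(1)] \<open>N' > 0\<close> by simp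
    qed
    then show ?thesis using N by (simp add: P_def)
  qed
qed

lemma top_reduce:
  assumes mid: "A2 > 0" "C2 > 0" "\<And>x y. (x, y) \<in> mid_lattice \<longleftrightarrow> (\<exists>i j. x = i * A2 \<and> y = i * B2 + j * C2)"
    and "(u1, u2) \<in> top_lattice"
  obtains v1 v2 w2 w1 where "(u1, u2, v1, v2, w2, w1) \<in> D" "0 \<le> v1" "v1 < A2" "0 \<le> v2" "v2 < C2"
proof -
  obtain y3 y4 y5 y6 where y: "(u1, u2, y3, y4, y5, y6) \<in> D" using assms(4) by (auto simp: top_lattice_def)
  obtain i r where i: "y3 = 0 + i * A2 + r" "0 \<le> r" "r < A2" using div_rem_exists[OF mid(1)] by blast
  obtain j s where j: "y4 = i * B2 + j * C2 + s" "0 \<le> s" "s < C2" using div_rem_exists[OF mid(2)] by blast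
  have "(- i * A2, - i * B2 + - j * C2) \<in> mid_lattice" using mid(3) by blast
  then obtain e2 e1 where "(0, 0, - i * A2, - i * B2 + - j * C2, e2, e1) \<in> D" by (auto simp: mid_lattice_def)
  from closed(2)[OF y this] show ?thesis using that i j by simp
qed

lemma bottom_reduce:
  assumes bot: "A3 > 0" "C3 > 0" "\<And>x y. (x, y) \<in> bottom_lattice \<longleftrightarrow> (\<exists>i j. x = i * A3 \<and> y = i * B3 + j * C3)"
    and y: "(u1, u2, v1, v2, y5, y6) \<in> D"
  obtains w2 w1 where "(u1, u2, v1, v2, w2, w1) \<in> D" "0 \<le> w2" "w2 < A3" "0 \<le> w1" "w1 < C3"
proof -
  obtain i r where i: "y5 = 0 + i * A3 + r" "0 \<le> r" "r < A3" using div_rem_exists[OF bot(1)] by blast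
  obtain j s where j: "y6 = i * B3 + j * C3 + s" "0 \<le> s" "s < C3" using div_rem_exists[OF bot(2)] by blast
  have "(- i * A3, - i * B3 + - j * C3) \<in> bottom_lattice" using bot(3) by blast
  then have "(0, 0, 0, 0, - i * A3, - i * B3 + - j * C3) \<in> D" by (simp add: bottom_lattice_def)
  from closed(2)[OF y this] show ?thesis using that i j by simp
qed

text \<open>With \<open>k\<close> the content of the top lattice,
  \<open>mid_characterization\<close> exhibits the middle lattice as a rational multiple of the
  primitive lattice \<open>\<Lambda>\<close>, and primitivity makes the factor an integer
  \<open>m\<close>. Together with \<open>bottom_leading\<close> this fixes the diagonal of the bottom
  lattice. Lifting the generators of the top and the middle lattice to \<open>D\<close> gives an image
  of \<open>\<theta>\<close> inside \<open>D\<close>. It is all of \<open>D\<close>, because a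
  representative from \<open>coset_box\<close> that is in \<open>D\<close> has to vanish, one lattice
  at a time.\<close>

theorem eq_range_\<theta>:
  obtains sh q where "valid_shape sh" "q \<in> lift_box sh" "D = range (\<theta> sh q)"
proof -
  obtain A B C A2 B2 C2 A3 B3 C3 where
    top: "A > 0" "0 \<le> B" "B < C" "\<And>x y. (x, y) \<in> top_lattice \<longleftrightarrow> (\<exists>i j. x = i * A \<and> y = i * B + j * C)" and
    mid: "A2 > 0" "0 \<le> B2" "B2 < C2" "\<And>x y. (x, y) \<in> mid_lattice \<longleftrightarrow> (\<exists>i j. x = i * A2 \<and> y = i * B2 + j * C2)" and
    bot: "A3 > 0" "0 \<le> B3" "B3 < C3" "\<And>x y. (x, y) \<in> bottom_lattice \<longleftrightarrow> (\<exists>i j. x = i * A3 \<and> y = i * B3 + j * C3)"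
    by (rule lattices_normal_form) (rule that; assumption)
  have pos: "C > 0" "C2 > 0" "C3 > 0" using top mid bot by linarith+
  note char = mid_scaled[OF top(1) pos(1) top(4) mid(1) pos(2) mid(4) bot(1) pos(3) bot(4)]
    and onto = mid_onto[OF top(1) pos(1) top(4) mid(1) pos(2) mid(4) bot(1) pos(3) bot(4)]
  define k where "k = gcd A (gcd B C)"
  have k: "k > 0" using top(1) by (simp add: k_def)
  obtain a b c where abc: "A = k * a" "B = k * b" "C = k * c"
    by (metis k_def dvd_def gcd_dvd1 gcd_dvd2 dvd_trans)
  have "k * gcd a (gcd b c) = k" using k k_def unfolding abc by (simp add: gcd_mult_left abs_mult)
  then have prim: "gcd a (gcd b c) = 1" using k by simp
  have abc_pos: "a > 0" "0 \<le> b" "b < c" "c > 0"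
    using top pos(1) k unfolding abc by (auto simp: zero_less_mult_iff zero_le_mult_iff)
  have AB: "(A, B) \<in> top_lattice" "(0, C) \<in> top_lattice"
    using top(4) by (metis add.right_neutral add.left_neutral mult_zero_left mult_1)+
  \<comment> \<open>The middle lattice contains \<open>C3 / (A C)\<close> times the top generators,
    so these are integral vectors.\<close>
  have "k * a * c dvd C3 * a" "k * a * c dvd C3 * b" "k * a * c dvd C3 * c"
  proof -
    have *: "k * a * c dvd C3 * y" if "A * C * v = C3 * (k * y)" for v y
    proof -
      have "k * (k * a * c * v) = k * (C3 * y)" using that unfolding abc by (simp add: algebra_simps)
      then have "k * a * c * v = C3 * y" using k by simp
      then show ?thesis by (metis dvd_triv_left)
    qed
    show "k * a * c dvd C3 * a" "k * a * c dvd C3 * b" "k * a * c dvd C3 * c"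
      using onto[OF AB(1)] onto[OF AB(2)] * abc by metis+
  qed
  then have "k * a * c dvd gcd (C3 * a) (gcd (C3 * b) (C3 * c))" by simp
  also have "gcd (C3 * a) (gcd (C3 * b) (C3 * c)) = C3" using prim pos(3) by (simp add: gcd_mult_left abs_mult)
  finally obtain m where m: "C3 = k * a * c * m" by (auto simp: dvd_def)
  have m_pos: "m > 0" using zero_less_mult_pos[of "k * a * c" m] pos(3) k abc_pos unfolding m by simp
  have mid': "(x, y) \<in> mid_lattice \<longleftrightarrow> (\<exists>i j. x = i * (m * a) \<and> y = i * (m * b) + j * (m * c))" for x y
  proof -
    have scale: "A * C * v = C3 * (k * y) \<longleftrightarrow> v = m * y" for v y
    proof -
      have "A * C * v = (k * k * a * c) * v" "C3 * (k * y) = (k * k * a * c) * (m * y)" unfolding abc m by (simp_all add: algebra_simps)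
      moreover have "k * k * a * c \<noteq> 0" using k abc_pos by simp
      ultimately show ?thesis by (metis mult_left_cancel)
    qed
    show ?thesis
    proof
      assume "(x, y) \<in> mid_lattice"
      then obtain l1 l2 where l: "(l1, l2) \<in> top_lattice" "A * C * x = C3 * l1" "A * C * y = C3 * l2" using char by blast
      then obtain i j where "l1 = i * A" "l2 = i * B + j * C" using top(4) by blast
      then have "l1 = k * (i * a)" "l2 = k * (i * b + j * c)" unfolding abc by (simp_all add: algebra_simps)
      then have "x = m * (i * a)" "y = m * (i * b + j * c)" using l(2,3) scale by simp_all
      then show "\<exists>i j. x = i * (m * a) \<and> y = i * (m * b) + j * (m * c)"
        by (intro exI[of _ i] exI[of _ j]) (simp add: algebra_simps)
    next
      assume "\<exists>i j. x = i * (m * a) \<and> y = i * (m * b) + j * (m * c)"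
      then obtain i j where ij: "x = m * (i * a)" "y = m * (i * b + j * c)" by (auto simp: algebra_simps)
      have "i * A = k * (i * a)" "i * B + j * C = k * (i * b + j * c)" unfolding abc by (simp_all add: algebra_simps)
      moreover have "(i * A, i * B + j * C) \<in> top_lattice" using top(4) by blast
      ultimately obtain v1 v2 where "(v1, v2) \<in> mid_lattice" "A * C * v1 = C3 * (k * (i * a))" "A * C * v2 = C3 * (k * (i * b + j * c))"
        using onto by metis
      then show "(x, y) \<in> mid_lattice" unfolding scale ij by simp
    qed
  qed
  have A3: "A3 = k * a * (k * c)" using bottom_leading[OF top(1) pos(1) top(4) bot(1,4)] abc by simp
  have C3: "C3 = k * a * (m * c)" using m by (simp add: algebra_simps)
  note bot' = bot(1) pos(3) bot(4)
  have mpos: "m * a > 0" "m * c > 0" using m_pos abc_pos by auto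
  obtain f11 f12 r1 s1 where g1: "(A, B, f11, f12, r1, s1) \<in> D" "0 \<le> f11" "f11 < m * a" "0 \<le> f12" "f12 < m * c"
    using top_reduce[OF mpos mid' AB(1)] by blast
  obtain p11 p12 where p1: "(A, B, f11, f12, p11, p12) \<in> D" "0 \<le> p11" "p11 < A3" "0 \<le> p12" "p12 < C3"
    using bottom_reduce[OF bot' g1(1)] by blast
  obtain f21 f22 r2 s2 where g2: "(0, C, f21, f22, r2, s2) \<in> D" "0 \<le> f21" "f21 < m * a" "0 \<le> f22" "f22 < m * c"
    using top_reduce[OF mpos mid' AB(2)] by blast
  obtain p21 p22 where p2: "(0, C, f21, f22, p21, p22) \<in> D" "0 \<le> p21" "p21 < A3" "0 \<le> p22" "p22 < C3"
    using bottom_reduce[OF bot' g2(1)] by blast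
  have "(m * a, m * b) \<in> mid_lattice" "(0, m * c) \<in> mid_lattice"
    using mid' by (metis add.right_neutral add.left_neutral mult_zero_left mult_1)+
  then obtain r3 s3 r4 s4 where h: "(0, 0, m * a, m * b, r3, s3) \<in> D" "(0, 0, 0, m * c, r4, s4) \<in> D"
    by (auto simp: mid_lattice_def)
  obtain p31 p32 where p3: "(0, 0, m * a, m * b, p31, p32) \<in> D" "0 \<le> p31" "p31 < A3" "0 \<le> p32" "p32 < C3"
    using bottom_reduce[OF bot' h(1)] by blast
  obtain p41 p42 where p4: "(0, 0, 0, m * c, p41, p42) \<in> D" "0 \<le> p41" "p41 < A3" "0 \<le> p42" "p42 < C3"
    using bottom_reduce[OF bot' h(2)] by blast
  define sh where "sh = (k, m, a, b, c)"
  define q where "q = ((f11, f12), (f21, f22), (p11, p12), (p21, p22), (p31, p32), (p41, p42))"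
  have valid: "valid_shape sh" using k m_pos abc_pos prim by (simp add: sh_def)
  have box: "q \<in> lift_box sh"
    using g1(2-5) g2(2-5) p1(2-5) p2(2-5) p3(2-5) p4(2-5) by (simp add: sh_def q_def Let_def A3 C3)
  have sub: "subgroup {g. \<theta> sh q g \<in> D} heis_group"
  proof (rule subgroup_heisI)
    show "hone \<in> {g. \<theta> sh q g \<in> D}" using closed(1) by (simp add: \<theta>_one)
  qed (use closed in \<open>auto simp: \<theta>_mult \<theta>_inv\<close>)
  have "\<theta> sh q g \<in> D" for g
    using heis_generated[OF sub, of g] p1(1) p2(1) p3(1) p4(1) by (simp add: sh_def q_def abc)
  moreover have "x \<in> range (\<theta> sh q)" if x: "x \<in> D" for x
  proof -
    obtain g t where gt: "t \<in> coset_box sh" "x = hmul (\<theta> sh q g) t" using \<theta>_coset_exists[OF valid] by blast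
    obtain t1 t2 t3 t4 t5 t6 where t: "t = (t1, t2, t3, t4, t5, t6)" by (rule prod_cases6)
    have tb: "0 \<le> t1" "t1 < A" "0 \<le> t2" "t2 < C" "0 \<le> t3" "t3 < m * a" "0 \<le> t4" "t4 < m * c"
      "0 \<le> t5" "t5 < A3" "0 \<le> t6" "t6 < C3" using gt(1) by (simp_all add: t sh_def abc A3 C3)
    have "hmul (hinv (\<theta> sh q g)) x = t" unfolding gt(2) by (simp add: hmul_assoc[symmetric])
    then have tD: "t \<in> D" using closed x \<open>\<And>g. \<theta> sh q g \<in> D\<close> by metis
    then have "(t1, t2) \<in> top_lattice" unfolding t top_lattice_def by blast
    then obtain i j where e: "t1 = i * A" "t2 = i * B + j * C" using top(4) by blast
    have "i = 0" by (rule div_rem_unique(1)[of i A 0 0 t1]) (use e(1) tb(1,2) top(1) in simp_all)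
    moreover from this have "j = 0"
      by (intro div_rem_unique(1)[of j C 0 0 t2]) (use e(2) tb(3,4) pos(1) in simp_all)
    ultimately have t12: "t1 = 0" "t2 = 0" using e by simp_all
    then have "(t3, t4) \<in> mid_lattice" using tD unfolding t mid_lattice_def by blast
    then obtain i j where e: "t3 = i * (m * a)" "t4 = i * (m * b) + j * (m * c)" using mid' by blast
    have "i = 0" by (rule div_rem_unique(1)[of i "m * a" 0 0 t3]) (use e(1) tb(5,6) mpos(1) in simp_all)
    moreover from this have "j = 0"
      by (intro div_rem_unique(1)[of j "m * c" 0 0 t4]) (use e(2) tb(7,8) mpos(2) in simp_all)
    ultimately have t34: "t3 = 0" "t4 = 0" using e by simp_all
    then have "(t5, t6) \<in> bottom_lattice" using tD t12 unfolding t bottom_lattice_def by blast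
    then obtain i j where e: "t5 = i * A3" "t6 = i * B3 + j * C3" using bot(4) by blast
    have "i = 0" by (rule div_rem_unique(1)[of i A3 0 0 t5]) (use e(1) tb(9,10) bot(1) in simp_all)
    moreover from this have "j = 0"
      by (intro div_rem_unique(1)[of j C3 0 0 t6]) (use e(2) tb(11,12) pos(3) in simp_all)
    ultimately have "t5 = 0" "t6 = 0" using e by simp_all
    then show ?thesis using gt(2) t t12 t34 by simp
  qed
  ultimately have "D = range (\<theta> sh q)" by blast
  then show ?thesis using that valid box by blast
qed

end

lemma range_\<theta>_lattices:
  assumes "valid_shape (k, m, a, b, c)"
  shows "(\<exists>v1 v2 w2 w1. (x, y, v1, v2, w2, w1) \<in> range (\<theta> (k, m, a, b, c) q)) \<longleftrightarrow>
      (\<exists>i j. x = i * (k * a) \<and> y = i * (k * b) + j * (k * c))"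
    and "(\<exists>w2 w1. (0, 0, x, y, w2, w1) \<in> range (\<theta> (k, m, a, b, c) q)) \<longleftrightarrow>
      (\<exists>i j. x = i * (m * a) \<and> y = i * (m * b) + j * (m * c))"
proof -
  obtain f11 f12 f21 f22 p11 p12 p21 p22 p31 p32 p41 p42
    where q: "q = ((f11, f12), (f21, f22), (p11, p12), (p21, p22), (p31, p32), (p41, p42))"
    by (rule lifts_cases)
  have pos: "k * a > 0" "k * c > 0" using assms by auto
  have mem: "\<exists>i j s l x y. g = \<theta> (k, m, a, b, c) q (i, j, s, l, x, y)" if g: "g \<in> range (\<theta> (k, m, a, b, c) q)" for g
  proof -
    obtain g' where "g = \<theta> (k, m, a, b, c) q g'" using g by (elim rangeE)
    then show ?thesis by (cases g' rule: prod_cases6) blast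
  qed
  show "(\<exists>v1 v2 w2 w1. (x, y, v1, v2, w2, w1) \<in> range (\<theta> (k, m, a, b, c) q)) \<longleftrightarrow>
      (\<exists>i j. x = i * (k * a) \<and> y = i * (k * b) + j * (k * c))" (is "?L \<longleftrightarrow> ?R")
  proof
    assume ?L
    then obtain v1 v2 w2 w1 where "(x, y, v1, v2, w2, w1) \<in> range (\<theta> (k, m, a, b, c) q)" by blast
    from mem[OF this] show ?R unfolding q by auto
  next
    assume ?R
    then obtain i j where "x = i * (k * a)" "y = i * (k * b) + j * (k * c)" by blast
    then have "\<exists>v1 v2 w2 w1. (x, y, v1, v2, w2, w1) = \<theta> (k, m, a, b, c) q (i, j, 0, 0, 0, 0)"
      by (simp add: q)
    then show ?L by (metis rangeI)
  qed
  show "(\<exists>w2 w1. (0, 0, x, y, w2, w1) \<in> range (\<theta> (k, m, a, b, c) q)) \<longleftrightarrow>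
      (\<exists>i j. x = i * (m * a) \<and> y = i * (m * b) + j * (m * c))" (is "?L \<longleftrightarrow> ?R")
  proof
    assume ?L
    then obtain w2 w1 where "(0, 0, x, y, w2, w1) \<in> range (\<theta> (k, m, a, b, c) q)" by blast
    from mem[OF this] obtain i j s l where e: "0 = i * (k * a)" "0 = i * (k * b) + j * (k * c)"
      "x = i * f11 + j * f21 + s * (m * a)" "y = i * f12 + j * f22 + s * (m * b) + l * (m * c)"
      unfolding q by auto
    have "i = 0" using e(1) pos by auto
    moreover from this have "j = 0" using e(2) pos by auto
    ultimately show ?R using e(3,4) by auto
  next
    assume ?R
    then obtain i j where "x = i * (m * a)" "y = i * (m * b) + j * (m * c)" by blast
    then have "\<theta> (k, m, a, b, c) q (0, 0, i, j, 0, 0) = (0, 0, x, y, i * p31 + j * p41, i * p32 + j * p42)"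
      by (simp add: q)
    then show ?L by (metis rangeI)
  qed
qed

text \<open>The shape is read off from the normal forms of the top and the middle lattice.
  Generators with the same leading coordinates then differ by elements of the next lattices, and the
  box contains only one reduced representative.\<close>

lemma range_\<theta>_unique:
  assumes sh: "valid_shape sh" "valid_shape sh'" and q: "q \<in> lift_box sh" "q' \<in> lift_box sh'"
    and eq: "range (\<theta> sh q) = range (\<theta> sh' q')"
  shows "sh = sh'" "q = q'"
proof -
  obtain k m a b c where s: "sh = (k, m, a, b, c)" by (rule prod_cases5)
  obtain k' m' a' b' c' where s': "sh' = (k', m', a', b', c')" by (rule prod_cases5)
  have pos: "k > 0" "m > 0" "a > 0" "0 \<le> b" "b < c" "c > 0" "k' > 0" "m' > 0" "a' > 0" "0 \<le> b'" "b' < c'" "c' > 0"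
    using sh by (auto simp: s s')
  have "k * a = k' * a' \<and> k * b = k' * b' \<and> k * c = k' * c'"
    using lattice_normal_form_unique[of "k * a" "k * b" "k * c" "k' * a'" "k' * b'" "k' * c'"]
      range_\<theta>_lattices(1)[OF sh(1)[unfolded s], of _ _ q] range_\<theta>_lattices(1)[OF sh(2)[unfolded s'], of _ _ q']
      eq pos unfolding s s' by simp
  moreover have "m * a = m' * a' \<and> m * b = m' * b' \<and> m * c = m' * c'"
    using lattice_normal_form_unique[of "m * a" "m * b" "m * c" "m' * a'" "m' * b'" "m' * c'"]
      range_\<theta>_lattices(2)[OF sh(1)[unfolded s], of _ _ q] range_\<theta>_lattices(2)[OF sh(2)[unfolded s'], of _ _ q']
      eq pos unfolding s s' by simp
  moreover have "gcd (k * a) (gcd (k * b) (k * c)) = k" "gcd (k' * a') (gcd (k' * b') (k' * c')) = k'"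
    using sh pos by (simp_all add: s s' gcd_mult_left abs_mult)
  ultimately have "k = k'" by simp
  with \<open>k * a = k' * a' \<and> _\<close> have "a = a'" "b = b'" "c = c'" using pos by auto
  moreover from this \<open>m * a = m' * a' \<and> _\<close> have "m = m'" using pos by auto
  ultimately show ss': "sh = sh'" using \<open>k = k'\<close> by (simp add: s s')
  obtain f11 f12 f21 f22 p11 p12 p21 p22 p31 p32 p41 p42
    where qc: "q = ((f11, f12), (f21, f22), (p11, p12), (p21, p22), (p31, p32), (p41, p42))"
    by (rule lifts_cases)
  obtain r11 r12 r21 r22 t11 t12 t21 t22 t31 t32 t41 t42
    where qc': "q' = ((r11, r12), (r21, r22), (t11, t12), (t21, t22), (t31, t32), (t41, t42))"
    by (rule lifts_cases)
  note box = q[unfolded ss'[symmetric] s qc qc' lift_box.simps Let_def, simplified]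
  have N: "k * a > 0" "k * c > 0" "m * a > 0" "m * c > 0" "k * a * (k * c) > 0" "k * a * (m * c) > 0"
    using pos by auto
  have ex: "\<exists>i j s l x y. \<theta> sh q' g = \<theta> sh q (i, j, s, l, x, y)" for g
  proof -
    have "\<theta> sh q' g \<in> range (\<theta> sh q)" using eq ss' by auto
    then obtain g' where "\<theta> sh q' g = \<theta> sh q g'" by (elim rangeE)
    then show ?thesis by (cases g' rule: prod_cases6) blast
  qed
  note unique = div_rem_unique[of 0]
  obtain i j s1 l x y where 1: "\<theta> sh q' (1, 0, 0, 0, 0, 0) = \<theta> sh q (i, j, s1, l, x, y)" using ex by blast
  note e = 1[unfolded s qc qc', simplified]
  have "i = 1" using e pos by auto
  moreover from this have "j = 0" using e pos by auto
  ultimately have f1: "r11 = f11" "s1 = 0" using unique[of "m * a" r11 s1 f11] e box by auto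
  then have f2: "r12 = f12" "l = 0" using unique[of "m * c" r12 l f12] e box \<open>i = 1\<close> \<open>j = 0\<close> by auto
  then have p1: "t11 = p11" "x = 0" using unique[of "k * a * (k * c)" t11 x p11] e box \<open>i = 1\<close> \<open>j = 0\<close> f1 by auto
  then have p2: "t12 = p12" using unique[of "k * a * (m * c)" t12 y p12] e box \<open>i = 1\<close> \<open>j = 0\<close> f1 f2 by auto
  obtain i j s2 l x y where 2: "\<theta> sh q' (0, 1, 0, 0, 0, 0) = \<theta> sh q (i, j, s2, l, x, y)" using ex by blast
  note e = 2[unfolded s qc qc', simplified]
  have "i = 0" using e pos by auto
  moreover from this have "j = 1" using e pos by auto
  ultimately have f3: "r21 = f21" "s2 = 0" using unique[of "m * a" r21 s2 f21] e box by auto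
  then have f4: "r22 = f22" "l = 0" using unique[of "m * c" r22 l f22] e box \<open>i = 0\<close> \<open>j = 1\<close> by auto
  then have p3: "t21 = p21" "x = 0" using unique[of "k * a * (k * c)" t21 x p21] e box \<open>i = 0\<close> \<open>j = 1\<close> f3 by auto
  then have p4: "t22 = p22" using unique[of "k * a * (m * c)" t22 y p22] e box \<open>i = 0\<close> \<open>j = 1\<close> f3 f4 by auto
  obtain i j s3 l x y where 3: "\<theta> sh q' (0, 0, 1, 0, 0, 0) = \<theta> sh q (i, j, s3, l, x, y)" using ex by blast
  note e = 3[unfolded s qc qc', simplified]
  have "i = 0" using e pos by auto
  moreover from this have "j = 0" using e pos by auto
  ultimately have "s3 = 1" using e pos by auto
  then have "l = 0" using e pos \<open>i = 0\<close> \<open>j = 0\<close> by auto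
  then have p5: "t31 = p31" "x = 0" using unique[of "k * a * (k * c)" t31 x p31] e box \<open>i = 0\<close> \<open>j = 0\<close> \<open>s3 = 1\<close> by auto
  then have p6: "t32 = p32" using unique[of "k * a * (m * c)" t32 y p32] e box \<open>i = 0\<close> \<open>j = 0\<close> \<open>s3 = 1\<close> \<open>l = 0\<close> by auto
  obtain i j s4 l x y where 4: "\<theta> sh q' (0, 0, 0, 1, 0, 0) = \<theta> sh q (i, j, s4, l, x, y)" using ex by blast
  note e = 4[unfolded s qc qc', simplified]
  have "i = 0" using e pos by auto
  moreover from this have "j = 0" using e pos by auto
  ultimately have "s4 = 0" using e pos by auto
  then have "l = 1" using e pos \<open>i = 0\<close> \<open>j = 0\<close> by auto
  then have p7: "t41 = p41" "x = 0" using unique[of "k * a * (k * c)" t41 x p41] e box \<open>i = 0\<close> \<open>j = 0\<close> \<open>s4 = 0\<close> by auto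
  then have p8: "t42 = p42" using unique[of "k * a * (m * c)" t42 y p42] e box \<open>i = 0\<close> \<open>j = 0\<close> \<open>s4 = 0\<close> \<open>l = 1\<close> by auto
  show "q = q'" using f1 f2 f3 f4 p1 p2 p3 p4 p5 p6 p7 p8 by (simp add: qc qc')
qed


section \<open>Counting the pro-isomorphic subgroups\<close>

definition heis_copies :: "nat \<Rightarrow> heis set set" where
  "heis_copies n = (\<lambda>(sh, q). range (\<theta> sh q)) ` {(sh, q). valid_shape sh \<and> q \<in> lift_box sh \<and> shape_index sh = int n}"

lemma bij_betw_rcosets_image:
  assumes "group_iso G H \<phi> \<psi>" "subgroup \<Delta> G"
  shows "bij_betw (image \<phi>) (rcosets\<^bsub>G\<^esub> \<Delta>) (rcosets\<^bsub>H\<^esub> (\<phi> ` \<Delta>))"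
proof -
  interpret group_iso G H \<phi> \<psi> by fact
  interpret G: group G by (rule D)
  have \<Delta>: "\<Delta> \<subseteq> carrier G" using assms(2) by (rule subgroup.subset)
  have im: "\<phi> ` (\<Delta> #>\<^bsub>G\<^esub> x) = \<phi> ` \<Delta> #>\<^bsub>H\<^esub> \<phi> x" if "x \<in> carrier G" for x
  proof -
    have "\<phi> (d \<otimes>\<^bsub>G\<^esub> x) = \<phi> d \<otimes>\<^bsub>H\<^esub> \<phi> x" if "d \<in> \<Delta>" for d
      using \<phi> \<Delta> that \<open>x \<in> carrier G\<close> by (auto simp: hom_def)
    then show ?thesis by (simp add: r_coset_def image_UN)
  qed
  have inj: "inj_on \<phi> (carrier G)" using \<psi>\<phi> by (rule inj_on_inverseI)
  have "rcosets\<^bsub>G\<^esub> \<Delta> \<subseteq> Pow (carrier G)" using G.rcosets_part_G[OF assms(2)] by blast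
  then have "inj_on (image \<phi>) (rcosets\<^bsub>G\<^esub> \<Delta>)" using inj_on_image_Pow[OF inj] inj_on_subset by blast
  moreover have "image \<phi> ` (rcosets\<^bsub>G\<^esub> \<Delta>) = rcosets\<^bsub>H\<^esub> (\<phi> ` \<Delta>)"
  proof
    show "image \<phi> ` (rcosets\<^bsub>G\<^esub> \<Delta>) \<subseteq> rcosets\<^bsub>H\<^esub> (\<phi> ` \<Delta>)"
    proof
      fix C assume "C \<in> image \<phi> ` (rcosets\<^bsub>G\<^esub> \<Delta>)"
      then obtain x where "x \<in> carrier G" "C = \<phi> ` (\<Delta> #>\<^bsub>G\<^esub> x)" by (auto simp: RCOSETS_def)
      then show "C \<in> rcosets\<^bsub>H\<^esub> (\<phi> ` \<Delta>)" using im closed(1) by (auto simp: RCOSETS_def)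
    qed
    show "rcosets\<^bsub>H\<^esub> (\<phi> ` \<Delta>) \<subseteq> image \<phi> ` (rcosets\<^bsub>G\<^esub> \<Delta>)"
    proof
      fix C assume "C \<in> rcosets\<^bsub>H\<^esub> (\<phi> ` \<Delta>)"
      then obtain y where y: "y \<in> carrier H" "C = \<phi> ` \<Delta> #>\<^bsub>H\<^esub> y" by (auto simp: RCOSETS_def)
      then have "C = \<phi> ` (\<Delta> #>\<^bsub>G\<^esub> \<psi> y)" using im[of "\<psi> y"] closed \<phi>\<psi> by simp
      then show "C \<in> image \<phi> ` (rcosets\<^bsub>G\<^esub> \<Delta>)" using closed(2)[OF y(1)] by (auto simp: RCOSETS_def)
    qed
  qed
  ultimately show ?thesis by (simp add: bij_betw_def)
qed

text \<open>Reduction modulo \<open>p\<close> is a finite quotient of \<open>G\<close>, so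
  \<open>\<Delta>\<close> has it as well, and the classification applies to the image of
  \<open>\<Delta>\<close>.\<close>

lemma heis_copy_of_proiso:
  assumes iso: "group_iso G heis_group \<phi> \<psi>" and n: "n > 0" and \<Delta>: "\<Delta> \<in> proiso_subgroups G n"
  shows "\<phi> ` \<Delta> \<in> heis_copies n"
proof -
  interpret group_iso G heis_group \<phi> \<psi> by fact
  have sub: "subgroup \<Delta> G" and card: "card (rcosets\<^bsub>G\<^esub> \<Delta>) = n" and prof: "iso_profinite_completions (G\<lparr>carrier := \<Delta>\<rparr>) G"
    using \<Delta> by (auto simp: proiso_subgroups_def)
  have \<Delta>G: "\<Delta> \<subseteq> carrier G" using sub by (rule subgroup.subset)
  interpret hom: group_hom G heis_group \<phi>
    using D G \<phi> by (simp add: group_hom_def group_hom_axioms_def)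
  have subim: "subgroup (\<phi> ` \<Delta>) heis_group" using hom.subgroup_img_is_subgroup[OF sub] .
  have cardim: "card (rcosets\<^bsub>heis_group\<^esub> (\<phi> ` \<Delta>)) = n"
    using bij_betw_same_card[OF bij_betw_rcosets_image[OF iso sub]] card by simp
  have "has_heis_quotients (\<phi> ` \<Delta>)"
    unfolding has_heis_quotients_def
  proof (intro allI impI)
    fix p :: int assume p: "prime p"
    have surj: "(heis_mod p \<circ> \<phi>) ` carrier G = carrier (heis_mod_group p)"
    proof -
      have "\<phi> ` carrier G = UNIV" using \<phi>\<psi> closed(2) by (metis UNIV_eq_I heis_group_simps(1) imageI iso_tuple_UNIV_I)
      then show ?thesis by (metis image_comp heis_mod_group_simps(1))
    qed
    have "\<exists>\<rho>\<in>hom (G\<lparr>carrier := \<Delta>\<rparr>) (heis_mod_group p). \<rho> ` carrier (G\<lparr>carrier := \<Delta>\<rparr>) = carrier (heis_mod_group p)"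
    proof (rule iso_profinite_imp_same_finite_quotients[OF _ D group_heis_mod _ prof _ surj])
      show "group (G\<lparr>carrier := \<Delta>\<rparr>)" using subgroup.subgroup_is_group[OF sub D] .
      show "finite (carrier (heis_mod_group p))" using finite_heis_mod_group prime_gt_0_int[OF p] by blast
      show "heis_mod p \<circ> \<phi> \<in> hom G (heis_mod_group p)" using Group.hom_compose[OF \<phi> heis_mod_hom] .
    qed
    then obtain \<rho> where \<rho>: "\<rho> \<in> hom (G\<lparr>carrier := \<Delta>\<rparr>) (heis_mod_group p)" "\<rho> ` \<Delta> = range (heis_mod p)" by auto
    have round_trip: "\<psi> ` \<phi> ` \<Delta> = \<Delta>"
    proof -
      have "(\<lambda>x. \<psi> (\<phi> x)) ` \<Delta> = (\<lambda>x. x) ` \<Delta>" using \<psi>\<phi> \<Delta>G by (intro image_cong) auto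
      then show ?thesis by (simp add: image_image)
    qed
    have "\<psi> \<in> hom (heis_group\<lparr>carrier := \<phi> ` \<Delta>\<rparr>) (G\<lparr>carrier := \<Delta>\<rparr>)"
    proof (rule homI)
      fix x y assume "x \<in> carrier (heis_group\<lparr>carrier := \<phi> ` \<Delta>\<rparr>)" "y \<in> carrier (heis_group\<lparr>carrier := \<phi> ` \<Delta>\<rparr>)"
      then show "\<psi> x \<in> carrier (G\<lparr>carrier := \<Delta>\<rparr>)" using imageI[of x "\<phi> ` \<Delta>" \<psi>] round_trip by simp
      show "\<psi> (x \<otimes>\<^bsub>heis_group\<lparr>carrier := \<phi> ` \<Delta>\<rparr>\<^esub> y) = \<psi> x \<otimes>\<^bsub>G\<lparr>carrier := \<Delta>\<rparr>\<^esub> \<psi> y"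
        using hom_mult[OF \<psi>, of x y] by simp
    qed
    then have "\<rho> \<circ> \<psi> \<in> hom (heis_group\<lparr>carrier := \<phi> ` \<Delta>\<rparr>) (heis_mod_group p)"
      using Group.hom_compose \<rho>(1) by blast
    moreover have "(\<rho> \<circ> \<psi>) ` \<phi> ` \<Delta> = range (heis_mod p)" by (metis image_comp round_trip \<rho>(2))
    ultimately show "\<exists>\<rho>\<in>hom (heis_group\<lparr>carrier := \<phi> ` \<Delta>\<rparr>) (heis_mod_group p). \<rho> ` \<phi> ` \<Delta> = range (heis_mod p)" by blast
  qed
  moreover have "finite (rcosets\<^bsub>heis_group\<^esub> (\<phi> ` \<Delta>))" using cardim n card_ge_0_finite by metis
  ultimately have "good_heis_subgroup (\<phi> ` \<Delta>)"
    using subim by (simp add: good_heis_subgroup_def good_heis_subgroup_axioms_def finite_index_heis_subgroup_def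
        finite_index_heis_subgroup_axioms_def heis_subgroup_def)
  then obtain sh q where "valid_shape sh" "q \<in> lift_box sh" "\<phi> ` \<Delta> = range (\<theta> sh q)"
    by (rule good_heis_subgroup.eq_range_\<theta>)
  moreover from this have "nat (shape_index sh) = n" using card_rcosets_range_\<theta> cardim by simp
  then have "shape_index sh = int n" using n by auto
  ultimately have "(sh, q) \<in> {(sh, q). valid_shape sh \<and> q \<in> lift_box sh \<and> shape_index sh = int n}" by simp
  then have "(\<lambda>(sh, q). range (\<theta> sh q)) (sh, q) \<in> heis_copies n" unfolding heis_copies_def by (rule imageI)
  then show ?thesis using \<open>\<phi> ` \<Delta> = range (\<theta> sh q)\<close> by simp
qed

text \<open>An image of \<open>\<theta>\<close> is isomorphic to the whole group through
  \<open>\<theta>\<close>, so the completions are isomorphic too.\<close>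

lemma proiso_of_heis_copy:
  assumes iso: "group_iso G heis_group \<phi> \<psi>" and E: "E \<in> heis_copies n"
  shows "\<psi> ` E \<in> proiso_subgroups G n"
proof -
  interpret group_iso G heis_group \<phi> \<psi> by fact
  obtain sh q where sh: "valid_shape sh" "shape_index sh = int n" and E: "E = range (\<theta> sh q)"
    using E by (auto simp: heis_copies_def)
  interpret inv: group_iso heis_group G \<psi> \<phi> by (rule swap)
  interpret hom: group_hom heis_group G \<psi>
    using D G \<psi> by (simp add: group_hom_def group_hom_axioms_def)
  have subE: "subgroup E heis_group" unfolding E by (rule subgroup_range_\<theta>)
  have sub: "subgroup (\<psi> ` E) G" using hom.subgroup_img_is_subgroup[OF subE] .
  have card: "card (rcosets\<^bsub>G\<^esub> (\<psi> ` E)) = n"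
    using bij_betw_same_card[OF bij_betw_rcosets_image[OF swap subE]] card_rcosets_range_\<theta>[OF sh(1), of q] sh(2)
    by (simp add: E)
  define \<tau> where "\<tau> = inv_into UNIV (\<theta> sh q)"
  have \<tau>: "\<tau> (\<theta> sh q g) = g" for g using inj_\<theta>[OF sh(1)] by (simp add: \<tau>_def)
  have "group_iso (G\<lparr>carrier := \<psi> ` E\<rparr>) G (\<psi> \<circ> \<tau> \<circ> \<phi>) (\<psi> \<circ> \<theta> sh q \<circ> \<phi>)"
  proof (rule group_iso.intro)
    show "group (G\<lparr>carrier := \<psi> ` E\<rparr>)" using subgroup.subgroup_is_group[OF sub D] .
    show "group G" by (rule D)
    have \<theta>hom: "\<theta> sh q \<in> hom heis_group (heis_group\<lparr>carrier := E\<rparr>)"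
      by (rule homI) (simp_all add: E \<theta>_mult)
    have \<tau>hom: "\<tau> \<in> hom (heis_group\<lparr>carrier := E\<rparr>) heis_group"
    proof (rule homI)
      fix x y assume "x \<in> carrier (heis_group\<lparr>carrier := E\<rparr>)" "y \<in> carrier (heis_group\<lparr>carrier := E\<rparr>)"
      then have "x \<in> range (\<theta> sh q)" "y \<in> range (\<theta> sh q)" by (simp_all add: E)
      then obtain g h where "x = \<theta> sh q g" "y = \<theta> sh q h" by (elim rangeE)
      then show "\<tau> (x \<otimes>\<^bsub>heis_group\<lparr>carrier := E\<rparr>\<^esub> y) = \<tau> x \<otimes>\<^bsub>heis_group\<^esub> \<tau> y"
        by (simp add: \<theta>_mult[symmetric] \<tau>)
    qed simp
    have \<phi>hom: "\<phi> \<in> hom (G\<lparr>carrier := \<psi> ` E\<rparr>) (heis_group\<lparr>carrier := E\<rparr>)"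
      using \<phi> subgroup.subset[OF sub] \<phi>\<psi> by (auto simp: hom_def subset_iff)
    have \<psi>hom: "\<psi> \<in> hom (heis_group\<lparr>carrier := E\<rparr>) (G\<lparr>carrier := \<psi> ` E\<rparr>)"
      using \<psi> by (auto simp: hom_def)
    show "\<psi> \<circ> \<tau> \<circ> \<phi> \<in> hom (G\<lparr>carrier := \<psi> ` E\<rparr>) G"
      using Group.hom_compose[OF \<phi>hom Group.hom_compose[OF \<tau>hom \<psi>]] by (simp add: comp_assoc)
    show "\<psi> \<circ> \<theta> sh q \<circ> \<phi> \<in> hom G (G\<lparr>carrier := \<psi> ` E\<rparr>)"
      using Group.hom_compose[OF \<phi> Group.hom_compose[OF \<theta>hom \<psi>hom]] by (simp add: comp_assoc)
    show "(\<psi> \<circ> \<theta> sh q \<circ> \<phi>) ((\<psi> \<circ> \<tau> \<circ> \<phi>) x) = x" if x: "x \<in> carrier (G\<lparr>carrier := \<psi> ` E\<rparr>)" for x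
    proof -
      have "x \<in> \<psi> ` range (\<theta> sh q)" using x E by simp
      then obtain e where e: "x = \<psi> e" "e \<in> range (\<theta> sh q)" by (rule imageE)
      from e(2) obtain g where "e = \<theta> sh q g" by (rule rangeE)
      with e(1) have "x = \<psi> (\<theta> sh q g)" by simp
      then show ?thesis using \<phi>\<psi> \<tau> by simp
    qed
    show "(\<psi> \<circ> \<tau> \<circ> \<phi>) ((\<psi> \<circ> \<theta> sh q \<circ> \<phi>) y) = y" if "y \<in> carrier G" for y
      using that \<phi>\<psi> \<tau> \<psi>\<phi> by simp
  qed
  then have "iso_profinite_completions (G\<lparr>carrier := \<psi> ` E\<rparr>) G" by (rule group_iso.iso_profinite)
  then show ?thesis using sub card by (simp add: proiso_subgroups_def)
qed

lemma proiso_count_eq_card_copies: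
  assumes iso: "group_iso G heis_group \<phi> \<psi>" and n: "n > 0"
  shows "proiso_count G n = card (heis_copies n)"
proof -
  interpret group_iso G heis_group \<phi> \<psi> by fact
  have "bij_betw (image \<phi>) (proiso_subgroups G n) (heis_copies n)"
  proof (rule bij_betwI[where g = "image \<psi>"])
    show "image \<phi> \<in> proiso_subgroups G n \<rightarrow> heis_copies n" using heis_copy_of_proiso[OF iso n] by blast
    show "image \<psi> \<in> heis_copies n \<rightarrow> proiso_subgroups G n" using proiso_of_heis_copy[OF iso] by blast
    show "\<psi> ` \<phi> ` \<Delta> = \<Delta>" if "\<Delta> \<in> proiso_subgroups G n" for \<Delta>
    proof -
      have "\<Delta> \<subseteq> carrier G" using that by (auto simp: proiso_subgroups_def dest: subgroup.subset)
      then have "(\<lambda>x. \<psi> (\<phi> x)) ` \<Delta> = (\<lambda>x. x) ` \<Delta>" using \<psi>\<phi> by (intro image_cong) auto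
      then show ?thesis by (simp add: image_image)
    qed
    show "\<phi> ` \<psi> ` E = E" for E using \<phi>\<psi> by (simp add: image_image)
  qed
  then show ?thesis using bij_betw_same_card by (auto simp: proiso_count_def)
qed

definition valid_shapes :: "nat \<Rightarrow> (nat \<times> nat \<times> nat \<times> nat \<times> nat) set" where
  "valid_shapes n = {(k, m, a, b, c). k > 0 \<and> m > 0 \<and> a > 0 \<and> b < c \<and> gcd a (gcd b c) = 1 \<and> m ^ 3 * k ^ 5 * (a * c) ^ 4 = n}"

lemma valid_shapes_bound:
  assumes "n > 0" "(k, m, a, b, c) \<in> valid_shapes n"
  shows "k \<le> n" "m \<le> n" "a \<le> n" "b \<le> n" "c \<le> n"
proof -
  have n: "m ^ 3 * k ^ 5 * (a * c) ^ 4 = n" and bc: "b < c" using assms(2) by (auto simp: valid_shapes_def)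
  have dvd: "m dvd n" "k dvd n" "a dvd n" "c dvd n" unfolding n[symmetric]
    by (simp_all add: dvd_mult dvd_mult2 dvd_power power_mult_distrib)
  then show "k \<le> n" "m \<le> n" "a \<le> n" "c \<le> n" using assms(1) by (auto intro: dvd_imp_le)
  then show "b \<le> n" using bc by simp
qed

lemma finite_valid_shapes: "n > 0 \<Longrightarrow> finite (valid_shapes n)"
  by (rule finite_subset[of _ "{..n} \<times> {..n} \<times> {..n} \<times> {..n} \<times> {..n}"])
    (use valid_shapes_bound in \<open>auto simp del: One_nat_def\<close>)

text \<open>By \<open>range_\<theta>_unique\<close> the copies correspond to the pairs of a shape
  and lifts in its box.\<close>

lemma card_heis_copies:
  assumes n: "n > 0"
  shows "card (heis_copies n) = (\<Sum>(k, m, a, b, c)\<in>valid_shapes n. m ^ 8 * k ^ 12 * (a * c) ^ 10)"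
proof -
  let ?i = "\<lambda>(k :: nat, m :: nat, a :: nat, b :: nat, c :: nat). (int k, int m, int a, int b, int c)"
  let ?Sh = "{sh. valid_shape sh \<and> shape_index sh = int n}"
  have inj: "inj_on (\<lambda>(sh, q). range (\<theta> sh q)) {(sh, q). valid_shape sh \<and> q \<in> lift_box sh \<and> shape_index sh = int n}"
  proof (rule inj_onI)
    fix x y
    assume xy: "x \<in> {(sh, q). valid_shape sh \<and> q \<in> lift_box sh \<and> shape_index sh = int n}"
      "y \<in> {(sh, q). valid_shape sh \<and> q \<in> lift_box sh \<and> shape_index sh = int n}"
      "(case x of (sh, q) \<Rightarrow> range (\<theta> sh q)) = (case y of (sh, q) \<Rightarrow> range (\<theta> sh q))"
    obtain sh q where x: "x = (sh, q)" by (rule prod.exhaust)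
    obtain sh' q' where y: "y = (sh', q')" by (rule prod.exhaust)
    show "x = y" using range_\<theta>_unique[of sh sh' q q'] xy unfolding x y by simp
  qed
  have gcd: "gcd a (gcd b c) = 1 \<longleftrightarrow> gcd (int a) (gcd (int b) (int c)) = 1" for a b c :: nat by (metis gcd_int_int_eq of_nat_1_eq_iff of_nat_1)
  have img: "?Sh = ?i ` valid_shapes n"
  proof
    show "?Sh \<subseteq> ?i ` valid_shapes n"
    proof
      fix sh assume "sh \<in> ?Sh"
      then have sh: "valid_shape sh" "shape_index sh = int n" by auto
      obtain k m a b c where s: "sh = (k, m, a, b, c)" by (rule prod_cases5)
      define v where "v = (nat k, nat m, nat a, nat b, nat c)"
      have pos: "k > 0" "m > 0" "a > 0" "b \<ge> 0" "c > 0" "b < c" using sh(1) by (auto simp: s)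
      have "int (nat m ^ 3 * nat k ^ 5 * (nat a * nat c) ^ 4) = int n"
        using sh(2) pos by (simp add: s)
      then have "nat m ^ 3 * nat k ^ 5 * (nat a * nat c) ^ 4 = n" by (simp only: of_nat_eq_iff)
      then have "v \<in> valid_shapes n" using sh(1) pos gcd[of "nat a" "nat b" "nat c"] by (simp add: v_def valid_shapes_def s)
      moreover have "sh = ?i v" using pos by (simp add: v_def s)
      ultimately show "sh \<in> ?i ` valid_shapes n" by blast
    qed
    show "?i ` valid_shapes n \<subseteq> ?Sh" using gcd by (auto simp: valid_shapes_def)
  qed
  have inji: "inj_on ?i (valid_shapes n)" by (auto simp: inj_on_def)
  have fin: "finite ?Sh" unfolding img using finite_valid_shapes[OF n] by simp
  have "{(sh, q). valid_shape sh \<and> q \<in> lift_box sh \<and> shape_index sh = int n} = Sigma ?Sh lift_box" by auto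
  then have "card (heis_copies n) = card (Sigma ?Sh lift_box)"
    unfolding heis_copies_def using card_image[OF inj] by simp
  also have "\<dots> = (\<Sum>sh\<in>?Sh. card (lift_box sh))" using fin finite_lift_box by (simp add: card_SigmaI)
  also have "\<dots> = (\<Sum>v\<in>valid_shapes n. card (lift_box (?i v)))" unfolding img by (simp add: sum.reindex[OF inji])
  also have "\<dots> = (\<Sum>(k, m, a, b, c)\<in>valid_shapes n. m ^ 8 * k ^ 12 * (a * c) ^ 10)"
  proof (rule sum.cong[OF HOL.refl])
    fix v assume v: "v \<in> valid_shapes n"
    obtain k m a b c where vc: "v = (k, m, a, b, c)" by (rule prod_cases5)
    have "valid_shape (int k, int m, int a, int b, int c)" using v gcd by (auto simp: vc valid_shapes_def)
    then show "card (lift_box (?i v)) = (case v of (k, m, a, b, c) \<Rightarrow> m ^ 8 * k ^ 12 * (a * c) ^ 10)"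
      using card_lift_box[of "int k" "int m" "int a" "int b" "int c"] by (simp only: vc prod.case nat_int)
  qed
  finally show ?thesis .
qed


section \<open>Primitive lattices of given determinant\<close>

lemma square_part_square_mult_squarefree:
  fixes j q :: nat
  assumes "j > 0" "squarefree q"
  shows "square_part (j ^ 2 * q) = j"
proof -
  have "x dvd j" if x: "x ^ 2 dvd j ^ 2 * q" for x
  proof -
    define g where "g = gcd x j"
    have g: "g > 0" using assms(1) by (simp add: g_def)
    obtain x' j' where xj: "x = x' * g" "j = j' * g" "coprime x' j'"
      using gcd_coprime_exists[of x j] g unfolding g_def by auto
    have "g ^ 2 * x' ^ 2 dvd g ^ 2 * (j' ^ 2 * q)" using x unfolding xj by (simp add: power_mult_distrib ac_simps)
    then have "x' ^ 2 dvd j' ^ 2 * q" using g by simp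
    then have "x' ^ 2 dvd q" using xj(3) by (simp add: coprime_dvd_mult_right_iff)
    then have "x' = 1" using squarefreeD[OF assms(2)] by simp
    then show ?thesis by (simp add: xj)
  qed
  then have "square_part (j ^ 2 * q) dvd j" using dvd_square_part_iff by blast
  moreover have "j dvd square_part (j ^ 2 * q)" by (simp add: dvd_square_part_iff)
  ultimately show ?thesis by (rule dvd_antisym)
qed

text \<open>Each positive integer is a square times a squarefree number in exactly one way. The same
  bijection serves for primitive lattices and for the sum over squarefree numbers.\<close>

lemma bij_betw_square_squarefree:
  "bij_betw (\<lambda>(j, q). j ^ 2 * q) ({j. j > 0} \<times> {q. squarefree q}) {n :: nat. n > 0}"
proof (rule bij_betwI[where g = "\<lambda>n. (square_part n, squarefree_part n)"])
  show "(\<lambda>(j, q). j ^ 2 * q) \<in> {j. j > 0} \<times> {q. squarefree q} \<rightarrow> {n :: nat. n > 0}"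
    by (auto intro!: Nat.gr0I)
  show "(\<lambda>n. (square_part n, squarefree_part n)) \<in> {n :: nat. n > 0} \<rightarrow> {j. j > 0} \<times> {q. squarefree q}"
    by (auto intro!: Nat.gr0I)
  show "(case (square_part n, squarefree_part n) of (j, q) \<Rightarrow> j ^ 2 * q) = n" for n :: nat
    using squarefree_decompose[of n] by (simp add: mult.commute)
  fix x :: "nat \<times> nat" assume x: "x \<in> {j. j > 0} \<times> {q. squarefree q}"
  obtain j q where jq: "x = (j, q)" "j > 0" "squarefree q" using x by auto
  have s: "square_part (j ^ 2 * q) = j" using square_part_square_mult_squarefree jq by blast
  have "j ^ 2 * q = squarefree_part (j ^ 2 * q) * j ^ 2" using squarefree_decompose[of "j ^ 2 * q"] s by simp
  then have "squarefree_part (j ^ 2 * q) = q" using jq(2) by simp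
  then show "(square_part (case x of (j, q) \<Rightarrow> j ^ 2 * q), squarefree_part (case x of (j, q) \<Rightarrow> j ^ 2 * q)) = x"
    using s jq by simp
qed

text \<open>The primitive lattices of determinant \<open>n\<close> in Hermite normal form.\<close>

definition prim_forms :: "nat \<Rightarrow> (nat \<times> nat \<times> nat) set" where
  "prim_forms n = {(a, b, c). b < c \<and> gcd a (gcd b c) = 1 \<and> a * c = n}"

definition sqfree_pairs :: "nat \<Rightarrow> (nat \<times> nat) set" where
  "sqfree_pairs n = {(q, e). squarefree q \<and> q * e = n}"

lemma mult_eq_bounds: "(x :: nat) * y = n \<Longrightarrow> n > 0 \<Longrightarrow> x \<le> n \<and> y \<le> n"
  by (metis dvd_imp_le dvd_triv_left dvd_triv_right)

lemma finite_pairs: "n > 0 \<Longrightarrow> finite {(x :: nat, y). x * y = n}"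
  by (rule finite_subset[of _ "{..n} \<times> {..n}"]) (auto dest: mult_eq_bounds)

lemma finite_prim_forms: "n > 0 \<Longrightarrow> finite (prim_forms n)"
proof (rule finite_subset[of _ "{..n} \<times> {..n} \<times> {..n}"])
  assume n: "n > 0"
  have "a \<le> n \<and> b \<le> n \<and> c \<le> n" if "b < c" "a * c = n" for a b c
    using mult_eq_bounds[of a c n] n that by linarith
  then show "prim_forms n \<subseteq> {..n} \<times> {..n} \<times> {..n}" unfolding prim_forms_def by blast
qed auto

lemma finite_sqfree_pairs: "n > 0 \<Longrightarrow> finite (sqfree_pairs n)"
  by (rule finite_subset[OF _ finite_pairs]) (auto simp: sqfree_pairs_def)

lemma finite_square_pairs: "n > 0 \<Longrightarrow> finite {(j :: nat, d). j ^ 2 * d = n}"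
proof (rule finite_subset[of _ "{..n} \<times> {..n}"])
  assume n: "n > 0"
  have "j \<le> n" "d \<le> n" if jd: "j ^ 2 * d = n" for j d
  proof -
    have "j * (j * d) = n" using jd by (simp add: power2_eq_square mult.assoc)
    then show "j \<le> n" "d \<le> n" using mult_eq_bounds[of j "j * d" n] mult_eq_bounds[of "j ^ 2" d n] n jd by auto
  qed
  then show "{(j, d). j ^ 2 * d = n} \<subseteq> {..n} \<times> {..n}" by auto
qed auto

text \<open>Each lattice is \<open>j\<close> times a primitive lattice for a unique
  \<open>j\<close>, and this multiplies the determinant by \<open>j\<^sup>2\<close>. Both sides count
  the matrices with \<open>a c = n\<close> and \<open>0 \<le> b < c\<close>.\<close>

lemma sum_prim_forms_scaled:
  assumes n: "n > 0"
  shows "(\<Sum>(j, d)\<in>{(j, d). j ^ 2 * d = n}. card (prim_forms d)) = (\<Sum>(a, c)\<in>{(a, c). a * c = n}. c)"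
proof -
  let ?J = "{(j :: nat, d :: nat). j ^ 2 * d = n}" and ?T = "{(a :: nat, b :: nat, c :: nat). b < c \<and> a * c = n}"
  have Jpos: "j > 0 \<and> d > 0" if "(j, d) \<in> ?J" for j d using that n by (auto intro!: Nat.gr0I)
  have "(\<Sum>(j, d)\<in>?J. card (prim_forms d)) = card (Sigma ?J (\<lambda>(j, d). prim_forms d))"
    using finite_square_pairs[OF n] Jpos finite_prim_forms
    by (subst card_SigmaI) (auto intro!: sum.cong)
  also have "\<dots> = card ?T"
  proof (rule bij_betw_same_card, rule bij_betwI[where g =
        "\<lambda>(a, b, c). let g = gcd a (gcd b c) in ((g, n div g ^ 2), (a div g, b div g, c div g))"])
    let ?f = "\<lambda>((j :: nat, d :: nat), (a :: nat, b :: nat, c :: nat)). (j * a, j * b, j * c)"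
    let ?g = "\<lambda>(a, b, c). let g = gcd a (gcd b c) in ((g, n div g ^ 2), (a div g, b div g, c div g))"
    show "?f \<in> Sigma ?J (\<lambda>(j, d). prim_forms d) \<rightarrow> ?T"
    proof
      fix x assume x: "x \<in> Sigma ?J (\<lambda>(j, d). prim_forms d)"
      obtain j d a b c where xc: "x = ((j, d), (a, b, c))" by (metis surj_pair)
      have jd: "(j, d) \<in> ?J" and abc: "b < c" "a * c = d" using x by (auto simp: xc prim_forms_def)
      then show "?f x \<in> ?T" using Jpos[OF jd] by (auto simp: xc power2_eq_square)
    qed
    show "?g (?f x) = x" if x: "x \<in> Sigma ?J (\<lambda>(j, d). prim_forms d)" for x
    proof -
      obtain j d a b c where xc: "x = ((j, d), (a, b, c))" by (metis surj_pair)
      have jd: "(j, d) \<in> ?J" and abc: "gcd a (gcd b c) = 1" using x by (auto simp: xc prim_forms_def)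
      have "gcd (j * a) (gcd (j * b) (j * c)) = j" using abc by (simp add: gcd_mult_distrib_nat[symmetric])
      moreover have "n div j ^ 2 = d" using jd Jpos[OF jd] by auto
      ultimately show ?thesis using Jpos[OF jd] by (simp add: xc Let_def)
    qed
    have main: "?g t \<in> Sigma ?J (\<lambda>(j, d). prim_forms d) \<and> ?f (?g t) = t" if t: "t \<in> ?T" for t
    proof -
        obtain a b c where tc: "t = (a, b, c)" by (metis surj_pair)
        define g where "g = gcd a (gcd b c)"
        have bc: "b < c" "a * c = n" using t by (auto simp: tc)
        then have g: "g > 0" by (simp add: g_def)
        obtain a' b' c' where abc: "a = g * a'" "b = g * b'" "c = g * c'"
          by (metis g_def dvd_def gcd_dvd1 gcd_dvd2 dvd_trans)
        have "g * gcd a' (gcd b' c') = g"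
          using g_def unfolding abc by (simp add: gcd_mult_distrib_nat)
        then have prim: "gcd a' (gcd b' c') = 1" using g by simp
        have n': "n = g ^ 2 * (a' * c')" using bc(2) unfolding abc by (simp add: power2_eq_square ac_simps)
        have nd: "n div g ^ 2 = a' * c'" unfolding n' using g by simp
        have "?g t = ((g, a' * c'), (a', b', c'))"
          using g nd unfolding tc by (simp add: Let_def g_def[symmetric]) (simp add: abc)
        moreover have "b' < c'" using bc(1) g unfolding abc by simp
        ultimately show ?thesis using prim n' by (simp add: prim_forms_def tc abc)
    qed
    show "?g \<in> ?T \<rightarrow> Sigma ?J (\<lambda>(j, d). prim_forms d)" by (rule Pi_I) (rule main[THEN conjunct1])
    show "?f (?g t) = t" if "t \<in> ?T" for t by (rule main[OF that, THEN conjunct2])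
  qed
  also have "?T = (\<lambda>((a, c), b). (a, b, c)) ` Sigma {(a, c). a * c = n} (\<lambda>(a, c). {..<c})" by (auto simp: image_iff)
  also have "card \<dots> = card (Sigma {(a, c). a * c = n} (\<lambda>(a, c). {..<c}))"
    by (rule card_image) (auto simp: inj_on_def)
  also have "\<dots> = (\<Sum>(a, c)\<in>{(a, c). a * c = n}. c)"
    using finite_pairs[OF n] by (subst card_SigmaI) (auto intro!: sum.cong)
  finally show ?thesis .
qed

text \<open>In \<open>n = a c\<close> write \<open>a = j\<^sup>2 q\<close> with squarefree
  \<open>q\<close>, and put \<open>e = c\<close>.\<close>

lemma sum_sqfree_pairs_scaled:
  assumes n: "n > 0"
  shows "(\<Sum>(j, d)\<in>{(j, d). j ^ 2 * d = n}. \<Sum>(q, e)\<in>sqfree_pairs d. e) = (\<Sum>(a, c)\<in>{(a, c). a * c = n}. c)"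
proof -
  let ?J = "{(j :: nat, d :: nat). j ^ 2 * d = n}"
  have Jpos: "j > 0 \<and> d > 0" if "(j, d) \<in> ?J" for j d using that n by (auto intro!: Nat.gr0I)
  have "(\<Sum>(j, d)\<in>?J. \<Sum>(q, e)\<in>sqfree_pairs d. e) = (\<Sum>x\<in>?J. \<Sum>y\<in>(case x of (j, d) \<Rightarrow> sqfree_pairs d). snd y)"
    by (auto intro!: sum.cong simp: case_prod_beta)
  also have "\<dots> = (\<Sum>(x, y)\<in>Sigma ?J (\<lambda>(j, d). sqfree_pairs d). snd y)"
    by (rule sum.Sigma) (use finite_square_pairs[OF n] finite_sqfree_pairs Jpos in auto)
  also have "\<dots> = (\<Sum>(a, c)\<in>{(a, c). a * c = n}. c)"
  proof -
    define to where "to = (\<lambda>((j :: nat, d :: nat), (q :: nat, e :: nat)). (j ^ 2 * q, e))"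
    define from_pair where "from_pair = (\<lambda>(a :: nat, c :: nat). ((square_part a, squarefree_part a * c), (squarefree_part a, c)))"
    have to: "from_pair (to x) = x \<and> to x \<in> {(a, c). a * c = n} \<and> snd (to x) = snd (snd x)"
      if x: "x \<in> Sigma ?J (\<lambda>(j, d). sqfree_pairs d)" for x
    proof -
      obtain j d q e where xc: "x = ((j, d), (q, e))" by (metis surj_pair)
      have h: "j > 0" "squarefree q" "q * e = d" "j ^ 2 * d = n" using x Jpos[of j d] by (auto simp: xc sqfree_pairs_def)
      have s: "square_part (j ^ 2 * q) = j" using square_part_square_mult_squarefree h by blast
      have "j ^ 2 * q = squarefree_part (j ^ 2 * q) * j ^ 2" using squarefree_decompose[of "j ^ 2 * q"] s by simp
      then have "squarefree_part (j ^ 2 * q) = q" using h(1) by simp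
      then show ?thesis using h s by (auto simp: xc to_def from_pair_def)
    qed
    have from_pair: "to (from_pair y) = y \<and> from_pair y \<in> Sigma ?J (\<lambda>(j, d). sqfree_pairs d)"
      if y: "y \<in> {(a, c). a * c = n}" for y
    proof -
      obtain a c where yc: "y = (a, c)" by (metis surj_pair)
      have dec: "square_part a ^ 2 * squarefree_part a = a" using squarefree_decompose[of a] by (simp add: mult.commute)
      then show ?thesis using y by (auto simp: yc to_def from_pair_def sqfree_pairs_def mult.assoc[symmetric])
    qed
    show ?thesis
    proof (rule sum.reindex_bij_witness[where i = from_pair and j = to])
      fix x assume x: "x \<in> Sigma ?J (\<lambda>(j, d). sqfree_pairs d)"
      show "from_pair (to x) = x" by (rule to[OF x, THEN conjunct1])
      show "to x \<in> {(a, c). a * c = n}" by (rule to[OF x, THEN conjunct2, THEN conjunct1])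
      show "(case to x of (a, c) \<Rightarrow> c) = (case x of (x, y) \<Rightarrow> snd y)" using to[OF x] by (simp add: case_prod_beta)
    next
      fix y :: "nat \<times> nat" assume y: "y \<in> {(a, c). a * c = n}"
      show "to (from_pair y) = y" by (rule from_pair[OF y, THEN conjunct1])
      show "from_pair y \<in> Sigma ?J (\<lambda>(j, d). sqfree_pairs d)" by (rule from_pair[OF y, THEN conjunct2])
    qed
  qed
  finally show ?thesis .
qed

text \<open>Both sides have the same sums over \<open>j\<^sup>2 d = n\<close>. By induction the
  terms with \<open>j > 1\<close> agree, hence so does the one with \<open>j = 1\<close>.\<close>

lemma card_prim_forms: "n > 0 \<Longrightarrow> card (prim_forms n) = (\<Sum>(q, e)\<in>sqfree_pairs n. e)"
proof (induction n rule: less_induct)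
  case (less n)
  let ?J = "{(j :: nat, d :: nat). j ^ 2 * d = n}"
  let ?S = "\<lambda>d. \<Sum>(q, e)\<in>sqfree_pairs d. e"
  have fin: "finite ?J" by (rule finite_square_pairs[OF less.prems])
  have mem: "(1, n) \<in> ?J" by simp
  have rest: "(\<Sum>(j, d)\<in>?J - {(1, n)}. card (prim_forms d)) = (\<Sum>(j, d)\<in>?J - {(1, n)}. ?S d)"
  proof (rule sum.cong[OF HOL.refl])
    fix x assume x: "x \<in> ?J - {(1, n)}"
    obtain j d where xc: "x = (j, d)" by (metis surj_pair)
    have jd: "j ^ 2 * d = n" "(j, d) \<noteq> (1, n)" using x by (auto simp: xc)
    then have pos: "j > 0" "d > 0" using less.prems by (auto intro!: Nat.gr0I)
    have "j \<noteq> 1" using jd by auto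
    then have "1 < j ^ 2" using pos by (intro one_less_power) auto
    then have "d < n" using pos jd(1) by (metis mult_strict_right_mono nat_mult_1)
    then show "(case x of (j, d) \<Rightarrow> card (prim_forms d)) = (case x of (j, d) \<Rightarrow> ?S d)"
      using less.IH pos by (simp add: xc)
  qed
  have "(\<Sum>(j, d)\<in>?J. card (prim_forms d)) = (\<Sum>(j, d)\<in>?J. ?S d)"
    using sum_prim_forms_scaled[OF less.prems] sum_sqfree_pairs_scaled[OF less.prems] by simp
  then show ?case using rest by (simp add: sum.remove[OF fin mem])
qed


section \<open>The counting formula\<close>

text \<open>The index set of the counting formula; \<open>q e\<close> is the determinant \<open>a
  c\<close> of the primitive lattice.\<close>

definition quads :: "nat \<Rightarrow> (nat \<times> nat \<times> nat \<times> nat) set" where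
  "quads n = {(m, k, q, e). squarefree q \<and> m ^ 3 * k ^ 5 * (q * e) ^ 4 = n}"

lemma quads_bound:
  assumes "n > 0" "(m, k, q, e) \<in> quads n"
  shows "0 < m \<and> m \<le> n \<and> 0 < k \<and> k \<le> n \<and> 0 < q \<and> q \<le> n \<and> 0 < e \<and> e \<le> n"
proof -
  have n: "m ^ 3 * k ^ 5 * (q * e) ^ 4 = n" using assms(2) by (auto simp: quads_def)
  have dvd: "m dvd n" "k dvd n" "q dvd n" "e dvd n" unfolding n[symmetric]
    by (simp_all add: dvd_mult dvd_mult2 dvd_power power_mult_distrib)
  then show ?thesis using assms(1) by (auto intro!: dvd_imp_le Nat.gr0I)
qed

lemma finite_quads: "n > 0 \<Longrightarrow> finite (quads n)"
proof (rule finite_subset[of _ "{..n} \<times> {..n} \<times> {..n} \<times> {..n}"])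
  assume n: "n > 0"
  show "quads n \<subseteq> {..n} \<times> {..n} \<times> {..n} \<times> {..n}"
  proof
    fix x assume x: "x \<in> quads n"
    obtain m k q e where xc: "x = (m, k, q, e)" by (metis surj_pair)
    show "x \<in> {..n} \<times> {..n} \<times> {..n} \<times> {..n}" using quads_bound[OF n] x by (simp add: xc)
  qed
qed auto

lemma sum_valid_shapes:
  assumes n: "n > 0"
  shows "(\<Sum>(k, m, a, b, c)\<in>valid_shapes n. m ^ 8 * k ^ 12 * (a * c) ^ 10) =
         (\<Sum>(m, k, q, e)\<in>quads n. m ^ 8 * k ^ 12 * q ^ 10 * e ^ 11)"
proof -
  let ?K = "{(m :: nat, k :: nat, d :: nat). m ^ 3 * k ^ 5 * d ^ 4 = n}"
  have bound: "0 < m \<and> m \<le> n \<and> 0 < k \<and> k \<le> n \<and> 0 < d \<and> d \<le> n" if "(m, k, d) \<in> ?K" for m k d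
    using quads_bound[OF n, of m k 1 d] that by (simp add: quads_def)
  have finK: "finite ?K"
    by (rule finite_subset[of _ "{..n} \<times> {..n} \<times> {..n}"]) (use bound in auto)
  define h where "h = (\<lambda>(m :: nat, k :: nat, d :: nat). m ^ 8 * k ^ 12 * d ^ 10)"
  have "(\<Sum>(k, m, a, b, c)\<in>valid_shapes n. m ^ 8 * k ^ 12 * (a * c) ^ 10) =
      (\<Sum>(x, y)\<in>Sigma ?K (\<lambda>(m, k, d). prim_forms d). h x)"
  proof -
    define to where "to = (\<lambda>(k :: nat, m :: nat, a :: nat, b :: nat, c :: nat). ((m, k, a * c), (a, b, c)))"
    define from_pair where "from_pair = (\<lambda>((m :: nat, k :: nat, d :: nat), (a :: nat, b :: nat, c :: nat)). (k, m, a, b, c))"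
    show ?thesis
  proof (rule sum.reindex_bij_witness[where j = to and i = from_pair])
    fix v assume v: "v \<in> valid_shapes n"
    obtain k m a b c where vc: "v = (k, m, a, b, c)" by (rule prod_cases5)
    show "from_pair (to v) = v" by (simp add: vc to_def from_pair_def)
    show "to v \<in> Sigma ?K (\<lambda>(m, k, d). prim_forms d)"
      using v by (simp add: vc valid_shapes_def prim_forms_def to_def)
    show "(case to v of (x, y) \<Rightarrow> h x) = (case v of (k, m, a, b, c) \<Rightarrow> m ^ 8 * k ^ 12 * (a * c) ^ 10)"
      by (simp add: vc h_def to_def)
  next
    fix y assume y: "y \<in> Sigma ?K (\<lambda>(m, k, d). prim_forms d)"
    obtain m k d a b c where yc: "y = ((m, k, d), (a, b, c))" by (metis surj_pair)
    have mem: "(m, k, d) \<in> ?K" "b < c" "gcd a (gcd b c) = 1" "a * c = d" using y by (auto simp: yc prim_forms_def)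
    show "to (from_pair y) = y" using mem by (simp add: yc to_def from_pair_def)
    have "a > 0" using bound[OF mem(1)] mem(4) by (auto intro!: Nat.gr0I)
    then show "from_pair y \<in> valid_shapes n"
      using mem bound[OF mem(1)] by (simp add: yc valid_shapes_def from_pair_def)
  qed
  qed
  also have "\<dots> = (\<Sum>x\<in>?K. \<Sum>y\<in>(case x of (m, k, d) \<Rightarrow> prim_forms d). h x)"
    by (rule sum.Sigma[symmetric]) (use finK bound finite_prim_forms in auto)
  also have "\<dots> = (\<Sum>x\<in>?K. \<Sum>y\<in>(case x of (m, k, d) \<Rightarrow> sqfree_pairs d). h x * snd y)"
  proof (rule sum.cong[OF HOL.refl])
    fix x assume x: "x \<in> ?K"
    obtain m k d where xc: "x = (m, k, d)" by (metis surj_pair)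
    have "card (prim_forms d) = (\<Sum>y\<in>sqfree_pairs d. snd y)"
      using card_prim_forms[of d] bound x by (simp add: xc case_prod_beta)
    then show "(\<Sum>y\<in>(case x of (m, k, d) \<Rightarrow> prim_forms d). h x) = (\<Sum>y\<in>(case x of (m, k, d) \<Rightarrow> sqfree_pairs d). h x * snd y)"
      by (simp add: xc sum_distrib_left[symmetric])
  qed
  also have "\<dots> = (\<Sum>(x, y)\<in>Sigma ?K (\<lambda>(m, k, d). sqfree_pairs d). h x * snd y)"
    by (rule sum.Sigma) (use finK bound finite_sqfree_pairs in auto)
  also have "\<dots> = (\<Sum>(m, k, q, e)\<in>quads n. m ^ 8 * k ^ 12 * q ^ 10 * e ^ 11)"
  proof -
    define to where "to = (\<lambda>((m :: nat, k :: nat, d :: nat), (q :: nat, e :: nat)). (m, k, q, e))"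
    define from_quad where "from_quad = (\<lambda>(m :: nat, k :: nat, q :: nat, e :: nat). ((m, k, q * e), (q, e)))"
    show ?thesis
  proof (rule sum.reindex_bij_witness[where i = from_quad and j = to])
    fix x assume x: "x \<in> Sigma ?K (\<lambda>(m, k, d). sqfree_pairs d)"
    obtain m k d q e where xc: "x = ((m, k, d), (q, e))" by (metis surj_pair)
    have mem: "(m, k, d) \<in> ?K" "squarefree q" "q * e = d" using x by (auto simp: xc sqfree_pairs_def)
    show "from_quad (to x) = x" using mem by (simp add: xc to_def from_quad_def)
    show "to x \<in> quads n" using mem by (simp add: xc quads_def to_def)
    have "e ^ 11 = e ^ 10 * e" using power_Suc2[of e 10] by simp
    then have "m ^ 8 * k ^ 12 * q ^ 10 * e ^ 11 = h (m, k, d) * e"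
      unfolding mem(3)[symmetric] by (simp only: h_def prod.case power_mult_distrib mult.assoc)
    then show "(case to x of (m, k, q, e) \<Rightarrow> m ^ 8 * k ^ 12 * q ^ 10 * e ^ 11) = (case x of (x, y) \<Rightarrow> h x * snd y)"
      by (simp add: xc to_def)
  next
    fix y assume y: "y \<in> quads n"
    obtain m k q e where yc: "y = (m, k, q, e)" by (metis surj_pair)
    show "to (from_quad y) = y" by (simp add: yc to_def from_quad_def)
    show "from_quad y \<in> Sigma ?K (\<lambda>(m, k, d). sqfree_pairs d)"
      using y by (simp add: yc quads_def sqfree_pairs_def from_quad_def)
  qed
  qed
  finally show ?thesis .
qed

theorem proiso_count_\<Gamma>_t2:
  assumes "n > 0"
  shows "proiso_count \<Gamma>_t2 n = (\<Sum>(m, k, q, e)\<in>quads n. m ^ 8 * k ^ 12 * q ^ 10 * e ^ 11)"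
proof -
  obtain \<phi> \<psi> where h: "\<phi> \<in> hom \<Gamma>_t2 heis_group" "\<psi> \<in> hom heis_group \<Gamma>_t2"
    "\<And>x. x \<in> carrier \<Gamma>_t2 \<Longrightarrow> \<psi> (\<phi> x) = x" "\<And>y. \<phi> (\<psi> y) = y"
    by (rule \<Gamma>_t2_iso_heis) (rule that; assumption)
  have "group \<Gamma>_t2" unfolding \<Gamma>_t2_def by (rule group_presented)
  then have "group_iso \<Gamma>_t2 heis_group \<phi> \<psi>" using h group_heis by (intro group_iso.intro)
  from proiso_count_eq_card_copies[OF this assms] show ?thesis
    unfolding card_heis_copies[OF assms] sum_valid_shapes[OF assms] .
qed


section \<open>Meromorphic continuation of the Riemann zeta function\<close>

text \<open>Iterated differences of \<open>z \<mapsto> z\<^sup>-\<^sup>s\<close>. The sign is such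
  that they are positive for real positive \<open>s\<close> and \<open>z\<close>.\<close>

primrec fdiff :: "nat \<Rightarrow> complex \<Rightarrow> complex \<Rightarrow> complex" where
  "fdiff 0 s z = z powr (- s)"
| "fdiff (Suc k) s z = fdiff k s z - fdiff k s (z + 1)"

lemma fdiff_has_field_derivative:
  assumes "Re z > 0"
  shows "(fdiff k s has_field_derivative - s * fdiff k (s + 1) z) (at z)"
  using assms
proof (induction k arbitrary: z)
  case 0
  have "z \<notin> \<real>\<^sub>\<le>\<^sub>0" using 0 by (auto simp: complex_nonpos_Reals_iff)
  then have "((\<lambda>z. z powr (- s)) has_field_derivative - s * z powr (- s - 1)) (at z)"
    using has_field_derivative_powr by blast
  moreover have "fdiff 0 s = (\<lambda>z. z powr (- s))" by (simp add: fun_eq_iff)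
  ultimately show ?case by simp
next
  case (Suc k)
  have shift: "((\<lambda>z. fdiff k s (z + 1)) has_field_derivative - s * fdiff k (s + 1) (z + 1)) (at z)"
    using Suc.IH[of "z + 1"] Suc.prems by (simp add: DERIV_shift)
  have "fdiff (Suc k) s = (\<lambda>z. fdiff k s z - fdiff k s (z + 1))" by (simp add: fun_eq_iff)
  then show ?case
    using DERIV_diff[OF Suc.IH[OF Suc.prems] shift] by (simp add: algebra_simps)
qed

lemma closed_segment_of_realE:
  fixes z :: complex
  assumes "z \<in> closed_segment (of_real x) (of_real (x + 1))"
  obtains y where "z = of_real y" "x \<le> y"
  using assms closed_segment_of_real[of x "x + 1", where ?'a = complex]
  by (auto simp: closed_segment_eq_real_ivl)

text \<open>The derivative of a \<open>k\<close>-th difference is \<open>- s\<close> times the same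
  difference for \<open>s + 1\<close>, so by the mean value inequality each difference gains a factor
  of order \<open>1 / x\<close>.\<close>

lemma norm_fdiff_le:
  assumes "x > 0" "Re s + real k \<ge> 0"
  shows "norm (fdiff k s (of_real x)) \<le> (\<Prod>j<k. norm (s + of_nat j)) * x powr (- Re s - real k)"
  using assms
proof (induction k arbitrary: s x)
  case 0
  then show ?case by (simp add: norm_powr_real_powr)
next
  case (Suc k)
  let ?C = "\<Prod>j<k. norm (s + 1 + of_nat j)"
  have bound: "norm (- s * fdiff k (s + 1) z) \<le> norm s * (?C * x powr (- Re s - 1 - real k))"
    if z: "z \<in> closed_segment (of_real x) (of_real (x + 1))" for z
  proof -
    obtain y where y: "z = of_real y" "x \<le> y"
      using closed_segment_of_realE[OF z] by blast
    have "norm (fdiff k (s + 1) z) \<le> ?C * y powr (- Re s - 1 - real k)"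
      using Suc.IH[of y "s + 1"] Suc.prems y by simp
    also have "\<dots> \<le> ?C * x powr (- Re s - 1 - real k)"
      using Suc.prems y by (intro mult_left_mono powr_mono2' prod_nonneg) auto
    finally show ?thesis by (simp add: norm_mult mult_left_mono)
  qed
  have "norm (fdiff k s (of_real x) - fdiff k s (of_real (x + 1)))
          \<le> norm s * (?C * x powr (- Re s - 1 - real k)) * norm (complex_of_real x - of_real (x + 1))"
  proof (rule field_differentiable_bound[where S = "closed_segment (of_real x) (of_real (x + 1))"])
    show "(fdiff k s has_field_derivative - s * fdiff k (s + 1) z)
            (at z within closed_segment (of_real x) (of_real (x + 1)))"
      if z: "z \<in> closed_segment (of_real x) (of_real (x + 1))" for z
    proof (rule has_field_derivative_at_within[OF fdiff_has_field_derivative])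
      obtain y where "z = of_real y" "x \<le> y" using closed_segment_of_realE[OF z] by blast
      then show "Re z > 0" using Suc.prems(1) by simp
    qed
  qed (rule convex_closed_segment, erule bound, simp_all)
  then have "norm (fdiff (Suc k) s (of_real x)) \<le> norm s * ?C * x powr (- Re s - real (Suc k))"
    by (simp add: mult.assoc diff_diff_eq)
  moreover have "norm s * ?C = (\<Prod>j<Suc k. norm (s + of_nat j))"
    by (subst prod.lessThan_Suc_shift) (simp add: algebra_simps)
  ultimately show ?case by metis
qed

lemma holomorphic_on_fdiff:
  assumes "Re z > 0"
  shows "(\<lambda>s. fdiff k s z) holomorphic_on A"
  using assms
proof (induction k arbitrary: z)
  case 0
  then have "z \<noteq> 0" by auto
  then show ?case by (auto intro!: holomorphic_intros)
next
  case (Suc k)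
  then show ?case by (auto intro!: holomorphic_intros)
qed

lemma summable_Suc_powr: "c < -1 \<Longrightarrow> summable (\<lambda>n. real (Suc n) powr c)"
  using summable_real_powr_iff[of c] summable_Suc_iff[of "\<lambda>n. real n powr c"] by simp

text \<open>The alternating series of \<open>k\<close>-th differences. It converges absolutely for
  \<open>Re s > 1 - k\<close>.\<close>

definition eta_tail :: "nat \<Rightarrow> complex \<Rightarrow> complex" where
  "eta_tail k s = (\<Sum>n. (-1) ^ n * fdiff k s (of_nat (Suc n)))"

lemma summable_norm_fdiff:
  assumes "Re s + real k > 1"
  shows "summable (\<lambda>n. norm ((-1) ^ n * fdiff k s (of_nat (Suc n))))"
proof (rule summable_comparison_test)
  show "summable (\<lambda>n. (\<Prod>j<k. norm (s + of_nat j)) * real (Suc n) powr (- Re s - real k))"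
    using assms by (intro summable_mult summable_Suc_powr) auto
  show "\<exists>N. \<forall>n\<ge>N. norm (norm ((-1) ^ n * fdiff k s (of_nat (Suc n))))
      \<le> (\<Prod>j<k. norm (s + of_nat j)) * real (Suc n) powr (- Re s - real k)"
  proof (intro exI allI impI)
    fix n :: nat
    show "norm (norm ((-1) ^ n * fdiff k s (of_nat (Suc n))))
      \<le> (\<Prod>j<k. norm (s + of_nat j)) * real (Suc n) powr (- Re s - real k)"
      using norm_fdiff_le[of "real (Suc n)" s k] assms by (simp add: norm_mult norm_power)
  qed
qed

lemma holomorphic_on_eta_tail: "eta_tail k holomorphic_on {s. Re s + real k > 1}"
proof (rule holomorphic_uniform_sequence)
  show "open {s. Re s + real k > 1}"
    using open_halfspace_Re_gt[of "1 - real k"] by (simp add: algebra_simps)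
  show "(\<lambda>s. \<Sum>i<n. (-1) ^ i * fdiff k s (of_nat (Suc i))) holomorphic_on {s. Re s + real k > 1}" for n
    by (intro holomorphic_intros holomorphic_on_fdiff) auto
next
  fix s0 :: complex assume "s0 \<in> {s. Re s + real k > 1}"
  then have s0: "Re s0 + real k > 1" by simp
  \<comment> \<open>Half the distance to the boundary line, for locally uniform convergence.\<close>
  define d where "d = (Re s0 + real k - 1) / 2"
  have d: "d > 0" "Re s0 - d + real k > 1" using s0 by (auto simp: d_def field_simps)
  have Re_ge: "Re s \<ge> Re s0 - d" if "s \<in> cball s0 d" for s
    using that abs_Re_le_cmod[of "s0 - s"] by (auto simp: dist_norm)
  have sub: "cball s0 d \<subseteq> {s. Re s + real k > 1}" using Re_ge d by force
  have "uniform_limit (cball s0 d) (\<lambda>n s. \<Sum>i<n. (-1) ^ i * fdiff k s (of_nat (Suc i)))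
            (\<lambda>s. \<Sum>i. (-1) ^ i * fdiff k s (of_nat (Suc i))) sequentially"
  proof (rule Weierstrass_m_test)
    show "summable (\<lambda>n. (\<Prod>j<k. norm s0 + d + real j) * real (Suc n) powr (- (Re s0 - d) - real k))"
      using d by (intro summable_mult summable_Suc_powr) auto
    fix n s assume s: "s \<in> cball s0 d"
    have nS: "norm s \<le> norm s0 + d"
      using s norm_triangle_sub[of s s0] by (auto simp: dist_norm norm_minus_commute)
    have "norm ((-1) ^ n * fdiff k s (of_nat (Suc n)))
        \<le> (\<Prod>j<k. norm (s + of_nat j)) * real (Suc n) powr (- Re s - real k)"
      using norm_fdiff_le[of "real (Suc n)" s k] sub s by (auto simp: norm_mult norm_power)
    also have "\<dots> \<le> (\<Prod>j<k. norm s0 + d + real j) * real (Suc n) powr (- (Re s0 - d) - real k)"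
    proof (intro mult_mono prod_mono conjI powr_mono prod_nonneg)
      fix j
      show "norm (s + of_nat j) \<le> norm s0 + d + real j"
        using norm_triangle_ineq[of s "of_nat j"] nS by simp
    qed (use Re_ge[OF s] d in \<open>auto intro!: add_nonneg_nonneg\<close>)
    finally show "norm ((-1) ^ n * fdiff k s (of_nat (Suc n)))
      \<le> (\<Prod>j<k. norm s0 + d + real j) * real (Suc n) powr (- (Re s0 - d) - real k)" .
  qed
  then show "\<exists>d>0. cball s0 d \<subseteq> {s. Re s + real k > 1} \<and>
     uniform_limit (cball s0 d) (\<lambda>n s. \<Sum>i<n. (-1) ^ i * fdiff k s (of_nat (Suc i))) (eta_tail k) sequentially"
    using d sub by (auto simp: eta_tail_def[abs_def])
qed

text \<open>One step of the Euler transform: the series of differences combines the alternating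
  series with its shift, which differs from its negative only by the first term.\<close>

lemma eta_tail_Suc:
  assumes "Re s + real k > 1"
  shows "eta_tail k s = (fdiff k s 1 + eta_tail (Suc k) s) / 2"
proof -
  let ?g = "\<lambda>n. fdiff k s (of_nat (Suc n))"
  have sg: "summable (\<lambda>n. (-1) ^ n * ?g n)"
    using summable_norm_cancel[OF summable_norm_fdiff[OF assms]] .
  then have sg': "summable (\<lambda>n. (-1) ^ n * ?g (Suc n))"
    using summable_minus[OF summable_Suc_iff[THEN iffD2, OF sg]] by simp
  have "(\<Sum>n. (-1) ^ n * ?g (Suc n)) = - (\<Sum>n. (-1) ^ Suc n * ?g (Suc n))"
    using sg' by (subst suminf_minus [symmetric]) (auto simp: summable_minus_iff)
  also have "\<dots> = - (eta_tail k s - ?g 0)"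
    using suminf_split_head[OF sg] by (simp add: eta_tail_def)
  finally have shifted: "(\<Sum>n. (-1) ^ n * ?g (Suc n)) = fdiff k s 1 - eta_tail k s" by simp
  have "eta_tail (Suc k) s = (\<Sum>n. (-1) ^ n * ?g n - (-1) ^ n * ?g (Suc n))"
    by (simp add: eta_tail_def algebra_simps)
  also have "\<dots> = eta_tail k s - (fdiff k s 1 - eta_tail k s)"
    unfolding shifted[symmetric] by (subst suminf_diff[OF sg sg', symmetric]) (simp add: eta_tail_def)
  finally show ?thesis by simp
qed

text \<open>The alternating zeta series after \<open>k\<close> Euler transforms.\<close>

definition eta_trans :: "nat \<Rightarrow> complex \<Rightarrow> complex" where
  "eta_trans k s = (\<Sum>j<k. fdiff j s 1 / 2 ^ Suc j) + eta_tail k s / 2 ^ k"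

lemma eta_trans_mono:
  assumes "k \<le> l" "Re s + real k > 1"
  shows "eta_trans l s = eta_trans k s"
  using assms
proof (induction l rule: dec_induct)
  case (step l)
  then have "Re s + real l > 1" by linarith
  then show ?case using step eta_tail_Suc[of s l] by (simp add: eta_trans_def field_simps)
qed simp

text \<open>The number of transforms is large enough for convergence at \<open>s\<close>. By
  \<open>dirichlet_eta_eq_eta_trans\<close> any other admissible number gives the same value, so that
  on each half plane \<open>dirichlet_eta\<close> is a single holomorphic expression.\<close>

definition dirichlet_eta :: "complex \<Rightarrow> complex" where
  "dirichlet_eta s = eta_trans (nat \<lceil>2 - Re s\<rceil>) s"

lemma dirichlet_eta_eq_eta_trans:
  assumes "Re s + real k > 1"
  shows "dirichlet_eta s = eta_trans k s"
proof -
  let ?l = "nat \<lceil>2 - Re s\<rceil>"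
  have "Re s + real ?l > 1" by linarith
  then show ?thesis
    using eta_trans_mono[of k ?l s] eta_trans_mono[of ?l k s] assms
    by (cases "k \<le> ?l") (auto simp: dirichlet_eta_def)
qed

lemma holomorphic_on_dirichlet_eta: "dirichlet_eta holomorphic_on UNIV"
proof -
  have op: "open {s. Re s + real k > 1}" for k
    using open_halfspace_Re_gt[of "1 - real k"] by (simp add: algebra_simps)
  have "dirichlet_eta holomorphic_on {s. Re s + real k > 1}" for k
  proof (rule holomorphic_transform)
    show "eta_trans k holomorphic_on {s. Re s + real k > 1}"
      unfolding eta_trans_def
      by (intro holomorphic_intros holomorphic_on_eta_tail holomorphic_on_fdiff) auto
  qed (auto simp: dirichlet_eta_eq_eta_trans)
  then have "dirichlet_eta holomorphic_on (\<Union>k. {s. Re s + real k > 1})"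
    using op by (intro holomorphic_on_UN_open) auto
  moreover have "(\<Union>k. {s. Re s + real k > 1}) = UNIV"
  proof -
    have "\<exists>k. Re s + real k > 1" for s using reals_Archimedean2[of "1 - Re s"] by (auto simp: algebra_simps)
    then show ?thesis by auto
  qed
  ultimately show ?thesis by simp
qed

lemma summable_zeta:
  assumes "Re s > 1"
  shows "summable (\<lambda>k. norm (1 / of_nat (Suc k) powr s :: complex))"
proof -
  have "norm (1 / of_nat (Suc k) powr s :: complex) = real (Suc k) powr (- Re s)" for k
    using norm_powr_real_powr[of "of_nat (Suc k)" s] by (simp add: norm_divide powr_minus divide_simps)
  then show ?thesis using assms summable_Suc_powr[of "- Re s"] by simp
qed

text \<open>The zeta series minus the alternating series is twice the sum over even integers, and
  that sum is \<open>2\<^sup>-\<^sup>s\<close> times the zeta series.\<close>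

lemma dirichlet_eta_eq_zeta:
  assumes "Re s > 1"
  shows "dirichlet_eta s = (1 - 2 powr (1 - s)) * dirichlet_series (\<lambda>_. 1) s"
proof -
  let ?f = "\<lambda>n. 1 / of_nat (Suc n) powr s :: complex"
  have sf: "summable ?f" using summable_norm_cancel[OF summable_zeta[OF assms]] .
  have eta: "dirichlet_eta s = (\<Sum>n. (-1) ^ n * ?f n)"
  proof -
    have "dirichlet_eta s = eta_tail 0 s"
      using dirichlet_eta_eq_eta_trans[of s 0] assms by (simp add: eta_trans_def)
    also have "\<dots> = (\<Sum>n. (-1) ^ n * ?f n)"
      unfolding eta_tail_def by (simp add: powr_minus divide_inverse)
    finally show ?thesis .
  qed
  have salt: "summable (\<lambda>n. (-1) ^ n * ?f n)"
    using summable_norm_fdiff[of s 0, THEN summable_norm_cancel] assms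
    by (simp add: powr_minus divide_inverse)
  have odd: "?f (2 * n + 1) = 2 powr (- s) * ?f n" for n
  proof -
    have "(of_real 2 * of_real (real (Suc n)) :: complex) powr s = of_real 2 powr s * of_real (real (Suc n)) powr s"
      by (rule powr_times_real) auto
    moreover have "(of_real 2 * of_real (real (Suc n)) :: complex) = of_nat (Suc (2 * n + 1))" by simp
    ultimately have "of_nat (Suc (2 * n + 1)) powr s = 2 powr s * (of_nat (Suc n) :: complex) powr s"
      by (simp only: of_real_of_nat_eq of_real_numeral)
    then show ?thesis by (simp only: powr_minus divide_inverse inverse_mult_distrib mult_1_left)
  qed
  have "2 * ?f (2 * n + 1) = 2 powr (1 - s) * ?f n" for n
    by (simp only: odd) (simp add: powr_diff powr_minus divide_inverse)
  then have "(\<lambda>n. 2 * ?f (2 * n + 1)) sums (2 powr (1 - s) * suminf ?f)"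
    using sums_mult[OF summable_sums[OF sf], of "2 powr (1 - s)"] by presburger
  moreover have "(\<lambda>n. (if odd n then 2 * ?f n else 0)) sums c \<longleftrightarrow> (\<lambda>n. 2 * ?f (2 * n + 1)) sums c" for c
  proof -
    have "(\<lambda>n. (\<lambda>n. if odd n then 2 * ?f n else 0) (2 * n + 1)) sums c
            \<longleftrightarrow> (\<lambda>n. if odd n then 2 * ?f n else 0) sums c"
      by (rule sums_mono_reindex) (auto simp: strict_mono_def elim!: oddE)
    then show ?thesis by simp
  qed
  ultimately have "(\<lambda>n. if odd n then 2 * ?f n else 0) sums (2 powr (1 - s) * suminf ?f)" by blast
  moreover have "(\<lambda>n. if odd n then 2 * ?f n else 0) = (\<lambda>n. ?f n - (-1) ^ n * ?f n)" by auto
  ultimately have "(\<lambda>n. ?f n - (-1) ^ n * ?f n) sums (2 powr (1 - s) * suminf ?f)" by simp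
  from sums_unique2[OF this sums_diff[OF summable_sums[OF sf] summable_sums[OF salt]]]
  have "2 powr (1 - s) * suminf ?f = suminf ?f - dirichlet_eta s" unfolding eta .
  then show ?thesis
    by (simp add: dirichlet_series_def dirichlet_term_def algebra_simps)
qed

definition zeta_cont :: "complex \<Rightarrow> complex" where
  "zeta_cont = remove_sings (\<lambda>s. dirichlet_eta s / (1 - 2 powr (1 - s)))"

lemma eta_quotient_meromorphic: "(\<lambda>s. dirichlet_eta s / (1 - 2 powr (1 - s))) meromorphic_on UNIV"
  by (intro meromorphic_intros analytic_on_imp_meromorphic_on analytic_intros)
     (use holomorphic_on_dirichlet_eta in \<open>auto simp: analytic_on_open\<close>)

lemma zeta_cont_nicely_meromorphic: "zeta_cont nicely_meromorphic_on UNIV"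
  unfolding zeta_cont_def by (intro remove_sings_nicely_meromorphic eta_quotient_meromorphic)

lemma two_powr_neq_1:
  assumes "Re s > 1" shows "2 powr (1 - s) \<noteq> (1 :: complex)"
proof
  assume "2 powr (1 - s) = (1 :: complex)"
  then have "norm (2 powr (1 - s) :: complex) = 1" by simp
  moreover have "norm (2 powr (1 - s) :: complex) = 2 powr (1 - Re s)" by (simp add: norm_powr_real_powr)
  ultimately show False using assms by simp
qed

lemma analytic_eta_quotient:
  assumes "2 powr (1 - s) \<noteq> (1 :: complex)"
  shows "(\<lambda>s. dirichlet_eta s / (1 - 2 powr (1 - s))) analytic_on {s}"
proof -
  have "dirichlet_eta analytic_on {s}"
    using holomorphic_on_dirichlet_eta by (metis analytic_on_open analytic_on_subset open_UNIV subset_UNIV)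
  then show ?thesis using assms by (auto intro!: analytic_intros)
qed

lemma zeta_cont_eq:
  assumes "2 powr (1 - s) \<noteq> (1 :: complex)"
  shows "zeta_cont s = dirichlet_eta s / (1 - 2 powr (1 - s))"
  unfolding zeta_cont_def using analytic_eta_quotient[OF assms] by simp

lemma zeta_cont_eq_series:
  assumes "Re s > 1"
  shows "zeta_cont s = dirichlet_series (\<lambda>_. 1) s"
  using two_powr_neq_1[OF assms] zeta_cont_eq dirichlet_eta_eq_zeta[OF assms] by simp

text \<open>The identity theorem makes the functions agree near every point with the point itself
  removed. The normalisation at poles and removable singularities then settles the value at the
  point.\<close>

lemma nicely_meromorphic_eqI:
  assumes f: "f nicely_meromorphic_on UNIV" and g: "g nicely_meromorphic_on UNIV"
    and eq: "\<And>s. s \<in> A \<Longrightarrow> f s = g s" and A: "open A" "A \<noteq> {}"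
  shows "f = g"
proof
  fix z
  have fm: "f meromorphic_on UNIV" and gm: "g meromorphic_on UNIV"
    using f g by (auto simp: nicely_meromorphic_on_def)
  define h where "h = remove_sings (\<lambda>s. f s - g s)"
  have hm: "(\<lambda>s. f s - g s) meromorphic_on UNIV" using fm gm by (intro meromorphic_intros)
  have hA: "h s = 0" if "s \<in> A" for s
    unfolding h_def
  proof (rule remove_sings_eqI)
    have "eventually (\<lambda>w. f w - g w = 0) (at s)"
      using eventually_at_in_open'[OF A(1) that] eq by (auto elim: eventually_mono)
    then show "(\<lambda>s. f s - g s) \<midarrow>s\<rightarrow> 0" by (simp add: tendsto_eventually)
  qed
  have "h constant_on UNIV"
    by (rule constant_on_extend_nicely_meromorphic_on[of _ _ A])
       (use hA A hm in \<open>auto simp: h_def constant_on_def intro!: remove_sings_nicely_meromorphic\<close>)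
  then have h0: "h s = 0" for s using hA A(2) by (auto simp: constant_on_def)
  have "eventually (\<lambda>s. h s = f s - g s) (at z)"
    unfolding h_def by (rule eventually_remove_sings_eq_at)
      (use hm in \<open>auto dest: meromorphic_on_isolated_singularity meromorphic_on_subset\<close>)
  then have ev: "eventually (\<lambda>s. f s = g s) (at z)" by (simp add: h0)
  show "f z = g z"
  proof (cases "is_pole f z")
    case True
    then have "is_pole g z" using is_pole_cong[OF ev HOL.refl] by simp
    moreover have "\<not> is_pole f z \<or> \<not> f \<midarrow>z\<rightarrow> f z" "\<not> is_pole g z \<or> \<not> g \<midarrow>z\<rightarrow> g z"
      unfolding is_pole_def using not_tendsto_and_filterlim_at_infinity[of "at z"] by auto
    ultimately have "f z = 0" "g z = 0"
      using True f g unfolding nicely_meromorphic_on_def by blast+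
    then show ?thesis by simp
  next
    case False
    then have "\<not> is_pole g z" using is_pole_cong[OF ev HOL.refl] by simp
    then have "f \<midarrow>z\<rightarrow> f z" "g \<midarrow>z\<rightarrow> g z" using False f g by (auto simp: nicely_meromorphic_on_def)
    then have "f \<midarrow>z\<rightarrow> g z" using tendsto_cong[OF ev] by blast
    then show ?thesis using \<open>f \<midarrow>z\<rightarrow> f z\<close> LIM_unique by blast
  qed
qed

lemma riemann_zeta_eq_zeta_cont: "riemann_zeta = zeta_cont"
  unfolding riemann_zeta_def
proof (rule the_equality)
  show "zeta_cont nicely_meromorphic_on UNIV \<and> (\<forall>s. 1 < Re s \<longrightarrow> zeta_cont s = dirichlet_series (\<lambda>_. 1) s)"
    using zeta_cont_nicely_meromorphic zeta_cont_eq_series by blast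
  fix f assume f: "f nicely_meromorphic_on UNIV \<and> (\<forall>s. 1 < Re s \<longrightarrow> f s = dirichlet_series (\<lambda>_. 1) s)"
  show "f = zeta_cont"
  proof (rule nicely_meromorphic_eqI)
    show "open {s. 1 < Re s}" by (rule open_halfspace_Re_gt)
    show "{s. 1 < Re s} \<noteq> {}" by (auto intro!: exI[of _ 2])
  qed (use f zeta_cont_nicely_meromorphic zeta_cont_eq_series in auto)
qed

lemma riemann_zeta_meromorphic: "riemann_zeta meromorphic_on UNIV"
  using zeta_cont_nicely_meromorphic by (simp add: riemann_zeta_eq_zeta_cont nicely_meromorphic_on_def)

lemma riemann_zeta_eq_suminf:
  assumes "Re s > 1"
  shows "riemann_zeta s = (\<Sum>k. 1 / of_nat (Suc k) powr s)"
  using zeta_cont_eq_series[OF assms]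
  by (simp add: riemann_zeta_eq_zeta_cont dirichlet_series_def dirichlet_term_def)

lemma riemann_zeta_analytic:
  assumes "Re s > 1" shows "riemann_zeta analytic_on {s}"
  unfolding riemann_zeta_eq_zeta_cont zeta_cont_def
  using analytic_eta_quotient[OF two_powr_neq_1[OF assms]] by (rule remove_sings_analytic_on)

lemma riemann_zeta_of_real:
  assumes "x > 1"
  shows "riemann_zeta (of_real x) = of_real (\<Sum>k. real (Suc k) powr - x)"
    and "Re (riemann_zeta (of_real x)) > 0"
proof -
  have "(1 / of_nat (Suc k) powr (of_real x) :: complex) = of_real (real (Suc k) powr - x)" for k
    using powr_of_real[of "real (Suc k)" x] by (simp add: powr_minus divide_inverse)
  moreover have sm: "summable (\<lambda>k. real (Suc k) powr - x)" using assms by (intro summable_Suc_powr) auto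
  ultimately show 1: "riemann_zeta (of_real x) = of_real (\<Sum>k. real (Suc k) powr - x)"
    using riemann_zeta_eq_suminf[of "of_real x"] assms by (simp add: suminf_of_real del: of_nat_Suc)
  have "0 < (\<Sum>k. real (Suc k) powr - x)" using sm by (intro suminf_pos) auto
  then show "Re (riemann_zeta (of_real x)) > 0" by (simp add: 1)
qed

text \<open>After one Euler transform the value is \<open>1/2\<close> plus half of an alternating
  sum whose terms have absolute values \<open>1 / ((n + 1) (n + 2))\<close>. These telescope to 1, and
  the first term is positive, so the alternating sum exceeds \<open>-1\<close>.\<close>

lemma dirichlet_eta_1_nonzero: "dirichlet_eta 1 \<noteq> 0"
proof -
  have f0: "fdiff 1 1 (of_nat (Suc n)) = of_real (1 / (real (Suc n) * real (Suc (Suc n))))" for n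
  proof -
    have "fdiff 1 1 (of_nat (Suc n)) = of_real (1 / real (Suc n) - 1 / real (Suc (Suc n)))"
      by (simp add: powr_minus divide_inverse add_ac)
    also have "1 / real (Suc n) - 1 / real (Suc (Suc n)) = 1 / (real (Suc n) * real (Suc (Suc n)))"
      by (simp add: field_simps)
    finally show ?thesis .
  qed
  have sb: "summable (\<lambda>n. 1 / (real (Suc n) * real (Suc (Suc n))))"
    using summable_norm_fdiff[of 1 1] unfolding f0 by (simp add: norm_mult norm_power norm_divide del: of_nat_Suc)
  then have sa: "summable (\<lambda>n. (-1) ^ n * (1 / (real (Suc n) * real (Suc (Suc n)))))"
    by (intro summable_comparison_test[OF _ sb]) (auto simp: abs_mult)
  have tel: "(\<lambda>n. 1 / (real (Suc n) * real (Suc (Suc n)))) sums 1"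
  proof -
    have "(\<lambda>n. 1 / real (Suc n)) \<longlonglongrightarrow> 0" using LIMSEQ_Suc[OF lim_1_over_n] by simp
    from telescope_sums'[OF this] show ?thesis
      by (simp add: divide_simps)
  qed
  have "- (\<Sum>n. (-1) ^ n * (1 / (real (Suc n) * real (Suc (Suc n))))) < (1 :: real)"
  proof -
    have "- (\<Sum>n. (-1) ^ n * (1 / (real (Suc n) * real (Suc (Suc n)))))
        = (\<Sum>n. - ((-1) ^ n * (1 / (real (Suc n) * real (Suc (Suc n))))))" by (rule suminf_minus[OF sa, symmetric])
    also have "\<dots> < (\<Sum>n. 1 / (real (Suc n) * real (Suc (Suc n))))"
    proof -
      have "0 < (\<Sum>n. 1 / (real (Suc n) * real (Suc (Suc n))) - - ((-1) ^ n * (1 / (real (Suc n) * real (Suc (Suc n))))))"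
      proof (rule suminf_pos2[where i = 0])
        show "summable (\<lambda>n. 1 / (real (Suc n) * real (Suc (Suc n))) - - ((-1) ^ n * (1 / (real (Suc n) * real (Suc (Suc n))))))"
          by (intro summable_diff summable_minus sa sb)
        show "0 \<le> 1 / (real (Suc n) * real (Suc (Suc n))) - - ((-1) ^ n * (1 / (real (Suc n) * real (Suc (Suc n)))))" for n
          by (cases "even n") auto
        show "0 < 1 / (real (Suc 0) * real (Suc (Suc 0))) - - ((-1) ^ 0 * (1 / (real (Suc 0) * real (Suc (Suc 0)))))"
          by simp
      qed
      then show ?thesis using suminf_diff[OF sb summable_minus[OF sa]] by linarith
    qed
    also have "\<dots> = 1" using tel sums_unique by metis
    finally show ?thesis .
  qed
  moreover have "eta_tail 1 1 = of_real (\<Sum>n. (-1) ^ n * (1 / (real (Suc n) * real (Suc (Suc n)))))"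
    unfolding eta_tail_def f0 using suminf_of_real[OF sa, where ?'a = complex] by simp
  moreover have "dirichlet_eta 1 = 1/2 + eta_tail 1 1 / 2"
    by (subst dirichlet_eta_eq_eta_trans[of _ 1]) (auto simp: eta_trans_def)
  ultimately have "Re (dirichlet_eta 1) > 0" by simp
  then show ?thesis by auto
qed

text \<open>The factor \<open>1 - 2\<^bsup>1-s\<^esup>\<close> has a simple zero at 1, since its
  derivative there is \<open>ln 2\<close>, while \<open>dirichlet_eta\<close> does not vanish at
  1.\<close>

lemma riemann_zeta_simple_pole:
  obtains h r where "r > 0" "h holomorphic_on ball 1 r" "h 1 \<noteq> 0"
    "\<And>s. s \<in> ball 1 r - {1} \<Longrightarrow> riemann_zeta s = h s / (s - 1)"
proof -
  let ?g = "\<lambda>s. 1 - 2 powr (1 - s) :: complex"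
  have gd: "(?g has_field_derivative of_real (ln 2)) (at 1)"
  proof -
    have "Ln 2 = complex_of_real (ln 2)" using Ln_of_real[of 2] by simp
    then have g_exp: "?g = (\<lambda>s. 1 - exp ((1 - s) * of_real (ln 2)))" by (simp add: powr_def)
    show ?thesis unfolding g_exp by (auto intro!: derivative_eq_intros)
  qed
  have g_hol: "?g holomorphic_on UNIV" by (auto intro!: holomorphic_intros)
  \<comment> \<open>The entire function \<open>(1 - 2\<^bsup>1-s\<^esup>) / (s - 1)\<close>,
    completed by its limit at 1.\<close>
  define q where "q = (\<lambda>s :: complex. if s = 1 then of_real (ln 2) else ?g s / (s - 1))"
  have "q = (\<lambda>z. if z = 1 then deriv ?g 1 else (?g z - ?g 1) / (z - 1))"
    using DERIV_imp_deriv[OF gd] by (auto simp: q_def fun_eq_iff)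
  then have q_hol: "q holomorphic_on UNIV"
    using pole_theorem_open[OF g_hol, of 1] by (auto intro!: pole_lemma_open[OF g_hol])
  have "continuous (at 1) q"
    using holomorphic_on_imp_continuous_on[OF q_hol] continuous_on_eq_continuous_at[OF open_UNIV] by blast
  moreover have "q 1 \<noteq> 0" by (simp add: q_def)
  ultimately obtain r where r: "r > 0" "\<forall>s :: complex. dist 1 s < r \<longrightarrow> q s \<noteq> 0"
    using continuous_at_avoid[of 1 q 0] by auto
  show ?thesis
  proof (rule that[of r "\<lambda>s. dirichlet_eta s / q s"])
    show "(\<lambda>s. dirichlet_eta s / q s) holomorphic_on ball 1 r"
      using r by (intro holomorphic_intros holomorphic_on_subset[OF q_hol]
          holomorphic_on_subset[OF holomorphic_on_dirichlet_eta]) auto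
    show "dirichlet_eta 1 / q 1 \<noteq> 0" using dirichlet_eta_1_nonzero by (simp add: q_def)
    fix s :: complex assume s: "s \<in> ball 1 r - {1}"
    then have "q s \<noteq> 0" "q s = ?g s / (s - 1)" using r by (auto simp: q_def)
    moreover from this have "2 powr (1 - s) \<noteq> (1 :: complex)" by auto
    ultimately show "riemann_zeta s = dirichlet_eta s / q s / (s - 1)"
      using s by (simp add: riemann_zeta_eq_zeta_cont zeta_cont_eq)
  qed (use r in auto)
qed


section \<open>The Dirichlet series as a product\<close>

lemma has_sum_times:
  fixes f :: "'a \<Rightarrow> complex" and g :: "'b \<Rightarrow> complex"
  assumes f: "(\<lambda>x. norm (f x)) summable_on A" "(f has_sum a) A" and g: "(\<lambda>x. norm (g x)) summable_on B" "(g has_sum b) B"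
  shows "(\<lambda>z. norm (case z of (x, y) \<Rightarrow> f x * g y)) summable_on A \<times> B" "((\<lambda>(x, y). f x * g y) has_sum (a * b)) (A \<times> B)"
proof -
  show abs: "(\<lambda>z. norm (case z of (x, y) \<Rightarrow> f x * g y)) summable_on A \<times> B"
    unfolding Infinite_Sum.abs_summable_on_Sigma_iff
  proof (intro conjI ballI)
    show "(\<lambda>y. norm (case (x, y) of (x, y) \<Rightarrow> f x * g y)) summable_on B" for x
      using g(1) by (simp add: norm_mult summable_on_cmult_right)
    have "(\<Sum>\<^sub>\<infinity>y\<in>B. norm (case (x, y) of (x, y) \<Rightarrow> f x * g y)) = norm (f x) * (\<Sum>\<^sub>\<infinity>y\<in>B. norm (g y))" for x
      using g(1) by (simp add: norm_mult infsum_cmult_right)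
    then show "(\<lambda>x. norm (\<Sum>\<^sub>\<infinity>y\<in>B. norm (case (x, y) of (x, y) \<Rightarrow> f x * g y))) summable_on A"
      using f(1) infsum_nonneg[of B "\<lambda>y. norm (g y)"] by (simp add: abs_mult summable_on_cmult_left)
  qed
  have "((\<lambda>y. f x * g y) has_sum (f x * b)) B" for x using g(2) by (rule has_sum_cmult_right)
  moreover have "((\<lambda>x. f x * b) has_sum (a * b)) A" using f(2) by (rule has_sum_cmult_left)
  moreover have "(\<lambda>(x, y). f x * g y) summable_on A \<times> B" using abs by (rule abs_summable_summable)
  ultimately show "((\<lambda>(x, y). f x * g y) has_sum (a * b)) (A \<times> B)"
    by (intro has_sum_SigmaI) auto
qed

text \<open>The term \<open>n\<^bsup>-z\<^esup>\<close> of a Dirichlet series, as a function of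
  \<open>n\<close>.\<close>

definition npow :: "complex \<Rightarrow> nat \<Rightarrow> complex" where
  "npow z n = of_nat n powr (- z)"

lemma npow_mult: "npow z (x * y) = npow z x * npow z y"
  unfolding npow_def by (simp only: of_nat_mult) (rule powr_times_real; simp)

lemma npow_power: "j > 0 \<Longrightarrow> npow z (x ^ j) = npow (of_nat j * z) x"
proof (induction j rule: nat_induct_non_zero)
  case (Suc j)
  have "npow z (x ^ Suc j) = of_nat x powr (- z) * of_nat x powr (- (of_nat j * z))"
    using Suc by (simp add: npow_mult) (simp add: npow_def)
  also have "\<dots> = npow (of_nat (Suc j) * z) x"
    by (simp add: npow_def powr_add[symmetric] algebra_simps)
  finally show ?case .
qed simp

lemma power_times_npow:
  assumes "x > 0" shows "of_nat x ^ j * npow z x = npow (z - of_nat j) x"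
proof -
  have "of_nat x powr of_nat j = (of_nat x ^ j :: complex)" using assms by (intro powr_nat') simp
  moreover have "of_nat x powr (of_nat j + - z) = of_nat x powr of_nat j * (of_nat x powr - z :: complex)"
    by (rule powr_add)
  ultimately show ?thesis by (simp add: npow_def)
qed

lemma zeta_has_sum:
  assumes "Re z > 1"
  shows "(\<lambda>n. norm (npow z n)) summable_on {0<..}" "(npow z has_sum riemann_zeta z) {0<..}"
proof -
  have eq: "1 / of_nat (Suc k) powr z = npow z (Suc k)" for k
    by (simp add: npow_def powr_minus divide_inverse)
  have sm: "summable (\<lambda>k. norm (npow z (Suc k)))" using summable_zeta[OF assms] unfolding eq .
  have bij: "bij_betw Suc UNIV {0<..}"
    by (rule bij_betwI[where g = "\<lambda>n. n - 1"]) auto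
  have "(\<lambda>k. norm (npow z (Suc k))) summable_on UNIV"
    using sm by (subst summable_on_UNIV_nonneg_real_iff) auto
  then show "(\<lambda>n. norm (npow z n)) summable_on {0<..}" using summable_on_reindex_bij_betw[OF bij, of "\<lambda>n. norm (npow z n)"] by simp
  have "((\<lambda>k. npow z (Suc k)) has_sum riemann_zeta z) UNIV"
    using norm_summable_imp_has_sum[OF sm] summable_sums[OF summable_norm_cancel[OF sm]]
      riemann_zeta_eq_suminf[OF assms] unfolding eq by simp
  then show "(npow z has_sum riemann_zeta z) {0<..}" using has_sum_reindex_bij_betw[OF bij, of "npow z"] by simp
qed

text \<open>Splitting \<open>n = j\<^sup>2 q\<close> in the zeta series gives \<open>\<zeta>(z) =
  \<zeta>(2 z) \<Sum>\<^sub>q q\<^bsup>-z\<^esup>\<close>.\<close>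

lemma squarefree_has_sum:
  assumes "Re z > 1" "riemann_zeta (2 * z) \<noteq> 0"
  shows "(\<lambda>n. norm (npow z n)) summable_on {q. squarefree q}" "(npow z has_sum (riemann_zeta z / riemann_zeta (2 * z))) {q. squarefree q}"
proof -
  have sub: "{q :: nat. squarefree q} \<subseteq> {0<..}" by (auto intro!: Nat.gr0I)
  show abs: "(\<lambda>n. norm (npow z n)) summable_on {q. squarefree q}"
    using zeta_has_sum(1)[OF assms(1)] sub by (rule summable_on_subset_banach)
  then obtain c where c: "(npow z has_sum c) {q. squarefree q}"
    using abs_summable_summable summable_on_def by blast
  have "(\<lambda>j. norm (npow (2 * z) j)) summable_on {0<..}" "((\<lambda>j. npow (2 * z) j) has_sum riemann_zeta (2 * z)) {0<..}"
    using zeta_has_sum[of "2 * z"] assms(1) by simp_all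
  from has_sum_times(2)[OF this abs c]
  have "((\<lambda>(j, q). npow (2 * z) j * npow z q) has_sum (riemann_zeta (2 * z) * c)) ({0<..} \<times> {q. squarefree q})" .
  also have "(\<lambda>(j, q). npow (2 * z) j * npow z q) = (\<lambda>x. npow z (case x of (j, q) \<Rightarrow> j ^ 2 * q))"
    by (auto simp: npow_mult npow_power)
  finally have "(npow z has_sum (riemann_zeta (2 * z) * c)) {n. n > 0}"
    using has_sum_reindex_bij_betw[OF bij_betw_square_squarefree, of "npow z"] by (simp add: greaterThan_def)
  moreover have "(npow z has_sum riemann_zeta z) {n. n > 0}"
    using zeta_has_sum(2)[OF assms(1)] by (simp add: greaterThan_def)
  ultimately have "riemann_zeta (2 * z) * c = riemann_zeta z" using has_sum_unique by blast
  then have "c = riemann_zeta z / riemann_zeta (2 * z)" using assms(2) by (simp add: field_simps)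
  then show "(npow z has_sum (riemann_zeta z / riemann_zeta (2 * z))) {q. squarefree q}" using c by simp
qed

text \<open>For real part above 2 the terms with \<open>n \<ge> 2\<close> have absolute sum at most
  \<open>\<pi>\<^sup>2/6 - 1 < 1\<close>, so they cannot cancel the first term.\<close>

lemma riemann_zeta_nonzero:
  assumes "Re z > 2"
  shows "riemann_zeta z \<noteq> 0"
proof
  assume zero: "riemann_zeta z = 0"
  have sm: "summable (\<lambda>k. norm (1 / of_nat (Suc k) powr z :: complex))" using summable_zeta[of z] assms by simp
  then have sm': "summable (\<lambda>k. norm (1 / of_nat (Suc (Suc k)) powr z :: complex))" by (subst (asm) summable_Suc_iff[symmetric])
  have "(\<Sum>k. 1 / of_nat (Suc k) powr z) = 1 + (\<Sum>k. 1 / of_nat (Suc (Suc k)) powr z :: complex)"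
    using suminf_split_head[OF summable_norm_cancel[OF sm]] by simp
  moreover have "(\<Sum>k. 1 / of_nat (Suc k) powr z) = (0 :: complex)"
    using zero riemann_zeta_eq_suminf[of z] assms by simp
  ultimately have "(\<Sum>k. 1 / of_nat (Suc (Suc k)) powr z) = (- 1 :: complex)"
    by (metis add.commute add_eq_0_iff)
  then have "norm (\<Sum>k. 1 / of_nat (Suc (Suc k)) powr z :: complex) = 1"
    by (simp only: norm_minus_cancel norm_one)
  moreover have "norm (\<Sum>k. 1 / of_nat (Suc (Suc k)) powr z :: complex) \<le> (\<Sum>k. 1 / (real (Suc k) + 1) ^ 2)"
  proof (rule norm_suminf_le)
    show "norm (1 / of_nat (Suc (Suc k)) powr z :: complex) \<le> 1 / (real (Suc k) + 1) ^ 2" for k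
    proof -
      have "norm (of_nat (Suc (Suc k)) powr z :: complex) = real (Suc (Suc k)) powr Re z"
        using norm_powr_real_powr[of "of_nat (Suc (Suc k))" z] by simp
      moreover have "real (Suc (Suc k)) powr 2 \<le> real (Suc (Suc k)) powr Re z" using assms by (intro powr_mono) auto
      moreover have "real (Suc (Suc k)) powr 2 = (real (Suc k) + 1) ^ 2" using powr_numeral[of "real (Suc (Suc k))"] by (simp add: add_ac)
      ultimately show ?thesis by (simp only: norm_divide norm_one) (intro divide_left_mono; simp)
    qed
    show "summable (\<lambda>k. 1 / (real (Suc k) + 1) ^ 2)"
      using sums_summable[OF inverse_squares_sums] by (subst summable_Suc_iff) (simp add: add.commute)
  qed
  moreover have "(\<Sum>k. 1 / (real (Suc k) + 1) ^ 2) = pi ^ 2 / 6 - 1"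
    using suminf_split_head[OF sums_summable[OF inverse_squares_sums]] sums_unique[OF inverse_squares_sums] by simp
  moreover have "pi ^ 2 < 12"
  proof -
    have "pi ^ 2 \<le> (32 / 10) ^ 2" using pi_approx by (intro power_mono) auto
    then show ?thesis by (simp add: power2_eq_square)
  qed
  ultimately show False by simp
qed

text \<open>Insert the counting formula. The summand \<open>m\<^sup>8 k\<^sup>1\<^sup>2
  q\<^sup>1\<^sup>0 e\<^sup>1\<^sup>1 n\<^bsup>-s\<^esup>\<close> with \<open>n = m\<^sup>3 k\<^sup>5
  (q e)\<^sup>4\<close> factors into powers of \<open>m\<close>, \<open>k\<close>, \<open>q\<close>
  and \<open>e\<close>. For \<open>Re s > 3\<close> all four sums converge absolutely, and the product
  may be grouped by \<open>n\<close>.\<close>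

lemma count_has_sum:
  assumes "Re s > 3"
  shows "((\<lambda>n. of_nat (proiso_count \<Gamma>_t2 n) * npow s n) has_sum
     (riemann_zeta (3 * s - 8) * (riemann_zeta (5 * s - 12) * (riemann_zeta (4 * s - 10) / riemann_zeta (8 * s - 20) * riemann_zeta (4 * s - 11))))) {0<..}"
proof -
  have re: "Re (3 * s - 8) > 1" "Re (5 * s - 12) > 1" "Re (4 * s - 10) > 1" "Re (4 * s - 11) > 1" "Re (8 * s - 20) > 1"
    using assms by simp_all
  have "2 * (4 * s - 10) = 8 * s - 20" by simp
  then have nz: "riemann_zeta (2 * (4 * s - 10)) \<noteq> 0" using riemann_zeta_nonzero[of "8 * s - 20"] assms by simp
  note q = squarefree_has_sum[OF re(3) nz, unfolded \<open>2 * (4 * s - 10) = _\<close>]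
  note e = zeta_has_sum[OF re(4)] and k = zeta_has_sum[OF re(2)] and m = zeta_has_sum[OF re(1)]
  note qe = has_sum_times[OF q e]
  note kqe = has_sum_times[OF k qe]
  note mkqe = has_sum_times(2)[OF m kqe]
  let ?I = "{0<..} \<times> {0<..} \<times> {q. squarefree q} \<times> {0<..} :: (nat \<times> nat \<times> nat \<times> nat) set"
  let ?w = "\<lambda>(m, k, q, e). of_nat (m ^ 8 * k ^ 12 * q ^ 10 * e ^ 11) :: complex"
  let ?S = "riemann_zeta (3 * s - 8) * (riemann_zeta (5 * s - 12) * (riemann_zeta (4 * s - 10) / riemann_zeta (8 * s - 20) * riemann_zeta (4 * s - 11)))"
  have summand: "npow (3 * s - 8) m * (npow (5 * s - 12) k * (npow (4 * s - 10) q * npow (4 * s - 11) e)) =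
      ?w (m, k, q, e) * npow s (m ^ 3 * k ^ 5 * (q * e) ^ 4)" if "m > 0" "k > 0" "q > 0" "e > 0" for m k q e
  proof -
    have "npow (3 * s - 8) m = of_nat m ^ 8 * npow (3 * s) m" "npow (5 * s - 12) k = of_nat k ^ 12 * npow (5 * s) k"
      "npow (4 * s - 10) q = of_nat q ^ 10 * npow (4 * s) q" "npow (4 * s - 11) e = of_nat e ^ 11 * npow (4 * s) e"
      using power_times_npow[OF that(1), of 8 "3 * s"] power_times_npow[OF that(2), of 12 "5 * s"]
        power_times_npow[OF that(3), of 10 "4 * s"] power_times_npow[OF that(4), of 11 "4 * s"] by simp_all
    then show ?thesis by (simp add: npow_mult npow_power mult_ac)
  qed
  have pos: "q > 0" if "squarefree q" for q :: nat using that by (auto intro!: Nat.gr0I)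
  have "((\<lambda>(n, t). ?w t * npow s n) has_sum ?S) (Sigma {0<..} quads)"
  proof (subst has_sum_reindex_bij_witness[where i = "\<lambda>(m, k, q, e). (m ^ 3 * k ^ 5 * (q * e) ^ 4, (m, k, q, e))" and j = snd and T = ?I])
    show "((\<lambda>(m, k, q, e). npow (3 * s - 8) m * (npow (5 * s - 12) k * (npow (4 * s - 10) q * npow (4 * s - 11) e))) has_sum ?S) ?I"
      using mkqe by (rule back_subst[of "\<lambda>f. (f has_sum ?S) ?I"]) (auto simp: fun_eq_iff)
    fix x assume x: "x \<in> Sigma {0<..} quads"
    obtain n m k q e where xc: "x = (n, m, k, q, e)" by (rule prod_cases5)
    have mem: "n > 0" "(m, k, q, e) \<in> quads n" using x by (auto simp: xc)
    have b: "m > 0" "k > 0" "q > 0" "e > 0" using quads_bound[OF mem] by auto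
    show "(case snd x of (m, k, q, e) \<Rightarrow> (m ^ 3 * k ^ 5 * (q * e) ^ 4, (m, k, q, e))) = x"
      "snd x \<in> ?I"
      "(case snd x of (m, k, q, e) \<Rightarrow> npow (3 * s - 8) m * (npow (5 * s - 12) k * (npow (4 * s - 10) q * npow (4 * s - 11) e)))
        = (case x of (n, t) \<Rightarrow> ?w t * npow s n)"
      using mem b summand[OF b] by (simp_all add: xc quads_def)
  next
    fix y assume y: "y \<in> ?I"
    obtain m k q e where yc: "y = (m, k, q, e)" by (rule prod_cases4)
    show "snd (case y of (m, k, q, e) \<Rightarrow> (m ^ 3 * k ^ 5 * (q * e) ^ 4, (m, k, q, e))) = y"
      "(case y of (m, k, q, e) \<Rightarrow> (m ^ 3 * k ^ 5 * (q * e) ^ 4, (m, k, q, e))) \<in> Sigma {0<..} quads"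
      using y pos by (auto simp: yc quads_def)
  qed simp
  then show ?thesis
  proof (rule has_sum_SigmaD)
    fix n :: nat assume "n \<in> {0<..}"
    then have n: "n > 0" by simp
    have "(\<Sum>t\<in>quads n. ?w t * npow s n) = of_nat (proiso_count \<Gamma>_t2 n) * npow s n"
      unfolding proiso_count_\<Gamma>_t2[OF n] of_nat_sum sum_distrib_right by (intro sum.cong) auto
    then show "((\<lambda>t. case (n, t) of (n, t) \<Rightarrow> ?w t * npow s n) has_sum (of_nat (proiso_count \<Gamma>_t2 n) * npow s n)) (quads n)"
      using has_sum_finite[OF finite_quads[OF n], of "\<lambda>t. ?w t * npow s n"] by simp
  qed
qed


section \<open>The abscissa of convergence\<close>

text \<open>Summation by parts. Compared with the test for monotone null sequences, the hypothesis
  of bounded variation makes sense for complex \<open>c\<close>.\<close>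

lemma dedekind_test:
  fixes b c :: "nat \<Rightarrow> complex"
  assumes b: "\<And>n. norm (\<Sum>k<n. b k) \<le> M" and c: "c \<longlonglongrightarrow> 0" and dc: "summable (\<lambda>k. norm (c k - c (Suc k)))"
  shows "summable (\<lambda>k. b k * c k)"
proof -
  define B where "B n = (\<Sum>k<n. b k)" for n
  have parts: "(\<Sum>k<n. b k * c k) = B n * c n + (\<Sum>k<n. B (Suc k) * (c k - c (Suc k)))" for n
    by (induction n) (simp_all add: B_def algebra_simps)
  have "summable (\<lambda>k. B (Suc k) * (c k - c (Suc k)))"
  proof (rule summable_comparison_test[OF _ summable_mult[OF dc, of M]], intro exI allI impI)
    fix k
    show "norm (B (Suc k) * (c k - c (Suc k))) \<le> M * norm (c k - c (Suc k))"
      unfolding norm_mult B_def by (intro mult_right_mono b) auto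
  qed
  moreover have "(\<lambda>n. B n * c n) \<longlonglongrightarrow> 0"
  proof (rule Lim_null_comparison)
    show "eventually (\<lambda>n. norm (B n * c n) \<le> M * norm (c n)) sequentially"
      unfolding norm_mult B_def by (intro always_eventually allI mult_right_mono b) auto
    show "(\<lambda>n. M * norm (c n)) \<longlonglongrightarrow> 0" using tendsto_mult_right_zero[OF tendsto_norm_zero[OF c]] .
  qed
  ultimately have "convergent (\<lambda>n. B n * c n + (\<Sum>k<n. B (Suc k) * (c k - c (Suc k))))"
    by (intro convergent_add) (auto simp: convergent_def summable_iff_convergent)
  then show ?thesis unfolding summable_iff_convergent parts .
qed

text \<open>A Dirichlet series that converges at \<open>s\<close>, perhaps only conditionally,
  converges to the right of \<open>s\<close>: the factors \<open>n\<^bsup>-(s'-s)\<^esup>\<close> tend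
  to 0 and have bounded variation, the latter by the estimate for first differences.\<close>

lemma dirichlet_summable_right:
  fixes a :: "nat \<Rightarrow> complex"
  assumes "summable (dirichlet_term a s)" "Re s < Re s'"
  shows "summable (dirichlet_term a s')"
proof -
  define d where "d = s' - s"
  have d: "Re d > 0" using assms(2) by (simp add: d_def)
  define c where "c k = fdiff 0 d (of_nat (Suc k))" for k
  have "Bseq (\<lambda>n. \<Sum>k<n. dirichlet_term a s k)"
    using assms(1) by (simp add: summable_iff_convergent convergent_imp_Bseq)
  then obtain M where M: "\<And>n. norm (\<Sum>k<n. dirichlet_term a s k) \<le> M" by (auto simp: Bseq_def)
  have "(\<lambda>k. norm (c k)) \<longlonglongrightarrow> 0"
  proof -
    have "norm (c k) = real (Suc k) powr - Re d" for k
      using norm_powr_real_powr[of "of_nat (Suc k)" "- d"] by (simp add: c_def)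
    moreover have "(\<lambda>k. real (Suc k) powr - Re d) \<longlonglongrightarrow> 0"
      using d by (intro LIMSEQ_Suc[of "\<lambda>k. real k powr - Re d"] tendsto_neg_powr filterlim_real_sequentially) auto
    ultimately show ?thesis by simp
  qed
  then have c0: "c \<longlonglongrightarrow> 0" by (rule tendsto_norm_zero_cancel)
  have "norm (c k - c (Suc k)) = norm ((-1) ^ k * fdiff 1 d (of_nat (Suc k)))" for k
    by (simp add: c_def norm_mult norm_power add_ac)
  then have "summable (\<lambda>k. norm (c k - c (Suc k)))" using summable_norm_fdiff[of d 1] d by simp
  from dedekind_test[OF M c0 this] have "summable (\<lambda>k. dirichlet_term a s k * c k)" .
  moreover have "dirichlet_term a s k * c k = dirichlet_term a s' k" for k
  proof -
    have "of_nat (Suc k) powr s' = of_nat (Suc k) powr s * (of_nat (Suc k) powr d :: complex)"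
      by (simp add: d_def powr_add[symmetric] del: of_nat_Suc)
    then show ?thesis by (simp add: dirichlet_term_def c_def powr_minus divide_inverse del: of_nat_Suc)
  qed
  ultimately show ?thesis by simp
qed

text \<open>The contribution of \<open>k = q = e = 1\<close>.\<close>

lemma proiso_count_cube:
  assumes "m > 0" shows "m ^ 8 \<le> proiso_count \<Gamma>_t2 (m ^ 3)"
proof -
  have "(m, 1, 1, 1) \<in> quads (m ^ 3)" by (simp add: quads_def)
  then have "(\<lambda>(m, k, q, e). m ^ 8 * k ^ 12 * q ^ 10 * e ^ 11) (m, 1, 1, 1) \<le> (\<Sum>(m, k, q, e)\<in>quads (m ^ 3). m ^ 8 * k ^ 12 * q ^ 10 * e ^ 11)"
    using finite_quads[of "m ^ 3"] assms by (intro member_le_sum) auto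
  then show ?thesis using proiso_count_\<Gamma>_t2[of "m ^ 3"] assms by simp
qed

text \<open>The terms at the cubes \<open>n = m\<^sup>3\<close> are at least \<open>m\<^sup>8 /
  m\<^sup>9\<close>, so they already dominate the harmonic series.\<close>

lemma not_summable_at_3: "\<not> summable (dirichlet_term (\<lambda>n. of_nat (proiso_count \<Gamma>_t2 n)) 3)"
proof
  assume sm: "summable (dirichlet_term (\<lambda>n. of_nat (proiso_count \<Gamma>_t2 n)) 3)"
  define f where "f k = real (proiso_count \<Gamma>_t2 (Suc k)) / real (Suc k) ^ 3" for k
  have f0: "f k \<ge> 0" for k by (simp add: f_def)
  have "dirichlet_term (\<lambda>n. of_nat (proiso_count \<Gamma>_t2 n)) 3 k = of_real (f k)" for k
  proof -
    have "(of_nat (Suc k) :: complex) powr 3 = of_nat (Suc k) ^ 3"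
      using powr_nat'[of "of_nat (Suc k) :: complex" 3] by (simp del: of_nat_Suc)
    then show ?thesis by (simp only: dirichlet_term_def f_def of_real_divide of_real_power of_real_of_nat_eq)
  qed
  then have "dirichlet_term (\<lambda>n. of_nat (proiso_count \<Gamma>_t2 n)) 3 = (\<lambda>k. of_real (f k))" by (rule ext)
  then have smf: "summable f" using sm summable_of_real_iff by metis
  \<comment> \<open>Terms are indexed from 0, so the cube \<open>(m + 1)\<^sup>3\<close> sits at
    this position.\<close>
  define g where "g m = Suc m ^ 3 - 1" for m :: nat
  have Suc_g: "Suc (g m) = Suc m ^ 3" for m by (simp add: g_def)
  have "inj g"
  proof (rule injI)
    fix x y assume "g x = g y"
    then have "Suc x ^ 3 = Suc y ^ 3" unfolding Suc_g[symmetric] by (rule arg_cong)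
    then have "Suc x = Suc y" by (rule power_eq_imp_eq_base) auto
    then show "x = y" by (rule Suc_inject)
  qed
  then have sfg: "summable (f \<circ> g)" using f0 smf by (intro summable_reindex) auto
  have le: "1 / real (Suc m) \<le> (f \<circ> g) m" for m
  proof -
    define x where "x = real (Suc m)"
    have x: "x > 0" by (simp add: x_def)
    have fg: "(f \<circ> g) m = real (proiso_count \<Gamma>_t2 (Suc m ^ 3)) / (x ^ 3) ^ 3" by (simp only: comp_apply f_def Suc_g of_nat_power x_def)
    have "real (Suc m ^ 8) \<le> real (proiso_count \<Gamma>_t2 (Suc m ^ 3))"
      using proiso_count_cube[of "Suc m"] by (simp only: of_nat_le_iff zero_less_Suc)
    then have "x ^ 8 / (x ^ 3) ^ 3 \<le> (f \<circ> g) m" unfolding fg x_def[symmetric] of_nat_power using x by (intro divide_right_mono) auto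
    moreover have "(x ^ 3) ^ 3 = x * x ^ 8" by (simp flip: power_mult power_Suc)
    ultimately show ?thesis using x by (simp add: x_def del: of_nat_Suc)
  qed
  have "summable (\<lambda>m. 1 / real (Suc m))"
  proof (rule summable_comparison_test'[OF sfg, of 0])
    fix m :: nat
    show "norm (1 / real (Suc m)) \<le> (f \<circ> g) m" using le[of m] by (simp del: of_nat_Suc comp_apply)
  qed
  then have "summable (\<lambda>m. 1 / real m)" by (rule iffD1[OF summable_Suc_iff[of "\<lambda>m. 1 / real m"]])
  then show False using not_summable_harmonic[where ?'a = real] by (simp add: divide_inverse)
qed

lemma count_sums:
  assumes "Re s > 3"
  shows "dirichlet_term (\<lambda>n. of_nat (proiso_count \<Gamma>_t2 n)) s sums
     (riemann_zeta (3 * s - 8) * riemann_zeta (4 * s - 11) * riemann_zeta (5 * s - 12) * riemann_zeta (4 * s - 10) / riemann_zeta (8 * s - 20))"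
proof -
  have bij: "bij_betw Suc UNIV {0<..}" by (rule bij_betwI[where g = "\<lambda>n. n - 1"]) auto
  have "((\<lambda>k. of_nat (proiso_count \<Gamma>_t2 (Suc k)) * npow s (Suc k)) has_sum
     (riemann_zeta (3 * s - 8) * (riemann_zeta (5 * s - 12) * (riemann_zeta (4 * s - 10) / riemann_zeta (8 * s - 20) * riemann_zeta (4 * s - 11))))) UNIV"
    using count_has_sum[OF assms] has_sum_reindex_bij_betw[OF bij, of "\<lambda>n. of_nat (proiso_count \<Gamma>_t2 n) * npow s n"] by simp
  from has_sum_imp_sums[OF this] show ?thesis
    by (simp add: dirichlet_term_def[abs_def] npow_def powr_minus divide_inverse mult_ac)
qed

text \<open>Convergence at a point with real part below 3 would imply convergence at 3, by
  \<open>dirichlet_summable_right\<close>.\<close>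

lemma abscissa_count: "abscissa_of_convergence (\<lambda>n. of_nat (proiso_count \<Gamma>_t2 n)) = 3"
  unfolding abscissa_of_convergence_def
proof (rule antisym)
  show "Inf {ereal (Re s) |s. summable (dirichlet_term (\<lambda>n. of_nat (proiso_count \<Gamma>_t2 n)) s)} \<le> 3"
  proof (rule ereal_le_epsilon2)
    fix e :: real assume e: "0 < e"
    have "summable (dirichlet_term (\<lambda>n. of_nat (proiso_count \<Gamma>_t2 n)) (of_real (3 + e)))"
      using count_sums[of "of_real (3 + e)"] e sums_summable by force
    then have "Inf {ereal (Re s) |s. summable (dirichlet_term (\<lambda>n. of_nat (proiso_count \<Gamma>_t2 n)) s)} \<le> ereal (Re (of_real (3 + e)))"
      by (intro Inf_lower) blast
    then show "Inf {ereal (Re s) |s. summable (dirichlet_term (\<lambda>n. of_nat (proiso_count \<Gamma>_t2 n)) s)} \<le> 3 + ereal e"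
      by simp
  qed
  show "3 \<le> Inf {ereal (Re s) |s. summable (dirichlet_term (\<lambda>n. of_nat (proiso_count \<Gamma>_t2 n)) s)}"
  proof (rule Inf_greatest)
    fix x assume "x \<in> {ereal (Re s) |s. summable (dirichlet_term (\<lambda>n. of_nat (proiso_count \<Gamma>_t2 n)) s)}"
    then obtain s where s: "x = ereal (Re s)" "summable (dirichlet_term (\<lambda>n. of_nat (proiso_count \<Gamma>_t2 n)) s)" by blast
    have "\<not> Re s < Re 3" using dirichlet_summable_right[OF s(2), of 3] not_summable_at_3 by blast
    then show "3 \<le> x" by (simp add: s(1))
  qed
qed


section \<open>The sum of the inverse fourth powers\<close>

text \<open>The product formula of the sine at an imaginary argument.\<close>

lemma sinh_product_formula:
  assumes "x \<noteq> (0 :: real)"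
  shows "(\<lambda>n. \<Prod>k=1..n. 1 + x ^ 2 / real k ^ 2) \<longlonglongrightarrow> sinh (pi * x) / (pi * x)"
proof -
  have "(\<lambda>n. of_real pi * (\<i> * of_real x) * (\<Prod>k=1..n. 1 - (\<i> * of_real x) ^ 2 / of_nat k ^ 2))
      \<longlonglongrightarrow> sin (of_real pi * (\<i> * of_real x))"
    by (rule sin_product_formula_complex)
  also have "(\<lambda>n. of_real pi * (\<i> * of_real x) * (\<Prod>k=1..n. 1 - (\<i> * of_real x) ^ 2 / of_nat k ^ 2)) =
      (\<lambda>n. \<i> * of_real (pi * x * (\<Prod>k=1..n. 1 + x ^ 2 / real k ^ 2)))"
    by (simp add: power_mult_distrib mult_ac)
  also have "sin (of_real pi * (\<i> * of_real x)) = \<i> * of_real (sinh (pi * x))"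
  proof -
    have "sinh (of_real (pi * x) :: complex) = of_real (sinh (pi * x))"
      by (simp add: sinh_field_def exp_of_real[symmetric])
    then show ?thesis using sinh_conv_sin[of "of_real (pi * x) :: complex"] by (simp add: mult_ac)
  qed
  finally have "(\<lambda>n. - \<i> * (\<i> * of_real (pi * x * (\<Prod>k=1..n. 1 + x ^ 2 / real k ^ 2)))) \<longlonglongrightarrow> - \<i> * (\<i> * of_real (sinh (pi * x)))"
    by (rule tendsto_mult_left)
  then have "(\<lambda>n. complex_of_real (pi * x * (\<Prod>k=1..n. 1 + x ^ 2 / real k ^ 2))) \<longlonglongrightarrow> of_real (sinh (pi * x))"
    by (simp add: mult.assoc[symmetric] del: of_real_mult of_real_prod)
  then have "(\<lambda>n. pi * x * (\<Prod>k=1..n. 1 + x ^ 2 / real k ^ 2)) \<longlonglongrightarrow> sinh (pi * x)"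
    by (simp only: tendsto_of_real_iff)
  from tendsto_divide[OF this tendsto_const[of "pi * x"]] show ?thesis using assms by simp
qed

text \<open>Multiplying the products for \<open>sin (\<pi> x)\<close> and \<open>sinh (\<pi>
  x)\<close> gives the product of \<open>1 - x\<^sup>4 / k\<^sup>4\<close>. Telescoping its partial
  products \<open>P x n\<close> expresses the limit \<open>R x\<close> as \<open>1 - x\<^sup>4 \<Sum>
  P x n / (n + 1)\<^sup>4\<close>. As \<open>x\<close> tends to 0 the coefficients \<open>P x
  n\<close> tend to 1 boundedly, and \<open>(1 - R x) / x\<^sup>4\<close> tends to
  \<open>\<pi>\<^sup>4 / 90\<close> by Taylor expansion.\<close>

lemma inverse_fourth_powers_sums: "(\<lambda>n. 1 / real (Suc n) ^ 4) sums (pi ^ 4 / 90)"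
proof -
  define P where "P x n = (\<Prod>k=1..n. 1 - x ^ 4 / real k ^ 4)" for x :: real and n
  define R where "R x = sin (pi * x) * sinh (pi * x) / (pi * x) ^ 2" for x :: real
  have P_lim: "P x \<longlonglongrightarrow> R x" if "x \<noteq> 0" for x
  proof -
    have "(\<lambda>n. (\<Prod>k=1..n. 1 - x ^ 2 / real k ^ 2) * (\<Prod>k=1..n. 1 + x ^ 2 / real k ^ 2))
        \<longlonglongrightarrow> sin (pi * x) / (pi * x) * (sinh (pi * x) / (pi * x))"
      by (intro tendsto_mult sin_product_formula_real' sinh_product_formula that)
    moreover have "(1 - x ^ 2 / real k ^ 2) * (1 + x ^ 2 / real k ^ 2) = 1 - x ^ 4 / real k ^ 4" for k
      by (simp add: algebra_simps power_divide power4_eq_xxxx power2_eq_square)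
    ultimately show ?thesis
      by (simp add: prod.distrib[symmetric] P_def[abs_def] R_def power2_eq_square)
  qed
  have sums: "(\<lambda>n. P x n / real (Suc n) ^ 4) sums ((1 - R x) / x ^ 4)" if "x \<noteq> 0" for x
  proof -
    have "(\<lambda>n. P x n - P x (Suc n)) sums (P x 0 - R x)" by (rule telescope_sums'[OF P_lim[OF that]])
    moreover have "P x n - P x (Suc n) = x ^ 4 * (P x n / real (Suc n) ^ 4)" for n
      by (simp add: P_def prod.nat_ivl_Suc' algebra_simps)
    moreover have "P x 0 = 1" by (simp add: P_def)
    ultimately have "(\<lambda>n. x ^ 4 * (P x n / real (Suc n) ^ 4)) sums (1 - R x)" by simp
    from sums_divide[OF this, of "x ^ 4"] that show ?thesis by simp
  qed
  have P_le: "\<bar>P x n\<bar> \<le> 1" if "\<bar>x\<bar> < 1" for x n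
  proof -
    have "\<bar>1 - x ^ 4 / real k ^ 4\<bar> \<le> 1" if "k \<ge> 1" for k
    proof -
      have "x ^ 4 \<le> 1" using power_le_one[of "\<bar>x\<bar>" 4] \<open>\<bar>x\<bar> < 1\<close> by (simp add: power_even_abs)
      also have "1 \<le> real k ^ 4" using that by (intro one_le_power) simp
      finally show ?thesis using that by (simp add: divide_le_eq_1 abs_le_iff)
    qed
    then show ?thesis unfolding P_def abs_prod by (intro prod_le_1) auto
  qed
  have sm: "summable (\<lambda>n. 1 / real (Suc n) ^ 4)"
    using inverse_power_summable[of 4, where ?'a = real] by (subst summable_Suc_iff) (simp add: inverse_eq_divide)
  have "((\<lambda>x. \<Sum>n. P x n / real (Suc n) ^ 4) \<longlongrightarrow> (\<Sum>n. 1 / real (Suc n) ^ 4)) (at_right 0)"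
  proof (rule tannerys_theorem[THEN conjunct2, THEN conjunct2])
    show "((\<lambda>x. P x n / real (Suc n) ^ 4) \<longlongrightarrow> 1 / real (Suc n) ^ 4) (at_right 0)" for n
    proof -
      have "((\<lambda>x. P x n / real (Suc n) ^ 4) \<longlongrightarrow> P 0 n / real (Suc n) ^ 4) (at_right 0)"
        unfolding P_def by (intro tendsto_intros) auto
      then show ?thesis by (simp add: P_def)
    qed
    have "eventually (\<lambda>x :: real. x \<in> {0<..<1}) (at_right 0)" by (rule eventually_at_right_real) simp
    then have "eventually (\<lambda>x. \<forall>n. norm (P x n / real (Suc n) ^ 4) \<le> 1 / real (Suc n) ^ 4) (at_right 0)"
      by eventually_elim (auto intro!: divide_right_mono P_le)
    then have "eventually (\<lambda>(n, x). \<forall>n. norm (P x n / real (Suc n) ^ 4) \<le> 1 / real (Suc n) ^ 4) (sequentially \<times>\<^sub>F at_right 0)"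
      unfolding case_prod_beta by (rule eventually_compose_filterlim[OF _ filterlim_snd])
    then show "eventually (\<lambda>(n, x). norm (P x n / real (Suc n) ^ 4) \<le> 1 / real (Suc n) ^ 4) (sequentially \<times>\<^sub>F at_right 0)"
      by eventually_elim auto
  qed (use sm in auto)
  moreover have "eventually (\<lambda>x. (\<Sum>n. P x n / real (Suc n) ^ 4) = (1 - R x) / x ^ 4) (at_right 0)"
    using eventually_at_right_less[of "0 :: real"] by eventually_elim (rule sums_unique[OF sums, symmetric], simp)
  ultimately have "((\<lambda>x. (1 - R x) / x ^ 4) \<longlongrightarrow> (\<Sum>n. 1 / real (Suc n) ^ 4)) (at_right 0)"
    using tendsto_cong by fast
  moreover have "((\<lambda>x. (1 - R x) / x ^ 4) \<longlongrightarrow> pi ^ 4 / 90) (at_right 0)"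
  proof -
    have "((\<lambda>y :: real. (1 - sin y * ((exp y - exp (- y)) / 2) / y ^ 2) / y ^ 4) \<longlongrightarrow> 1 / 90) (at_right 0)"
      by real_asymp
    moreover have "filterlim (\<lambda>x. pi * x) (at_right 0) (at_right 0)"
      by real_asymp
    ultimately have "((\<lambda>x. (1 - sin (pi * x) * ((exp (pi * x) - exp (- (pi * x))) / 2) / (pi * x) ^ 2) / (pi * x) ^ 4)
        \<longlongrightarrow> 1 / 90) (at_right 0)" by (rule filterlim_compose)
    then have "((\<lambda>x. (1 - R x) / (pi * x) ^ 4) \<longlongrightarrow> 1 / 90) (at_right 0)" by (simp add: R_def sinh_field_def)
    from tendsto_mult_left[OF this, of "pi ^ 4"] show ?thesis by (simp add: power_mult_distrib)
  qed
  ultimately have total: "(\<Sum>n. 1 / real (Suc n) ^ 4) = pi ^ 4 / 90"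
    by (rule tendsto_unique[OF trivial_limit_at_right_real])
  from summable_sums[OF sm] show ?thesis unfolding total .
qed


section \<open>Functions growing like \<open>x\<^sup>3 ln x\<close>\<close>

text \<open>\<open>U x \<sim> A x\<^sup>3 ln x\<close>, together with what is needed to sum dilates
  of \<open>U\<close>: a bound that is uniform in \<open>x\<close>, and vanishing below 1, which
  leaves only finitely many nonzero dilates. The factor \<open>1 + ln x\<close> keeps the bound valid
  near \<open>x = 1\<close>.\<close>

definition cubic_log :: "(real \<Rightarrow> real) \<Rightarrow> real \<Rightarrow> real \<Rightarrow> bool" where
  "cubic_log U A C \<longleftrightarrow> (\<forall>x<1. U x = 0) \<and> (\<forall>x\<ge>1. \<bar>U x\<bar> \<le> C * (x ^ 3 * (1 + ln x))) \<and>
     ((\<lambda>x. U x / (x ^ 3 * ln x)) \<longlongrightarrow> A) at_top"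

text \<open>Divide by \<open>x\<^sup>3 ln x\<close>. Each term tends to \<open>A w i / r i ^
  3\<close>, as \<open>ln (x / r i)\<close> and \<open>ln x\<close> are asymptotically equal, and it
  is bounded by a multiple of \<open>w i / r i ^ 3\<close>. Tannery's theorem allows the termwise
  limit.\<close>

lemma cubic_log_dilation_sum:
  assumes U: "cubic_log U A C" and C: "C \<ge> 0" and w: "\<And>i. w i \<ge> 0" and r: "\<And>i. r i \<ge> 1"
    and B: "(\<lambda>i. w i / r i ^ 3) sums B"
  shows "cubic_log (\<lambda>x. \<Sum>i. w i * U (x / r i)) (A * B) (C * B)"
proof -
  have zero: "U x = 0" if "x < 1" for x using U that by (auto simp: cubic_log_def)
  have bnd: "\<bar>U x\<bar> \<le> C * (x ^ 3 * (1 + ln x))" if "x \<ge> 1" for x using U that by (auto simp: cubic_log_def)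
  have lim: "((\<lambda>x. U x / (x ^ 3 * ln x)) \<longlongrightarrow> A) at_top" using U by (auto simp: cubic_log_def)
  have summand: "\<bar>w i * U (x / r i)\<bar> \<le> C * (x ^ 3 * (1 + ln x)) * (w i / r i ^ 3)" if "x \<ge> 1" for i x
  proof (cases "x / r i < 1")
    case True
    then show ?thesis using zero C w[of i] r[of i] that by simp
  next
    case False
    then have ge: "x / r i \<ge> 1" by simp
    have "ln (x / r i) \<le> ln x" using r[of i] that by (intro ln_mono) (auto simp: divide_le_eq)
    then have "\<bar>U (x / r i)\<bar> \<le> C * ((x / r i) ^ 3 * (1 + ln x))"
      using bnd[OF ge] C r[of i] that
      by (elim order_trans) (intro mult_left_mono mult_mono, auto)
    then have "w i * \<bar>U (x / r i)\<bar> \<le> w i * (C * ((x / r i) ^ 3 * (1 + ln x)))" using w by (intro mult_left_mono)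
    then show ?thesis using w[of i] by (simp add: abs_mult power_divide mult_ac)
  qed
  have sB: "summable (\<lambda>i. w i / r i ^ 3)" and suB: "(\<Sum>i. w i / r i ^ 3) = B" using B sums_iff by blast+
  have small: "(\<Sum>i. w i * U (x / r i)) = 0" if "x < 1" for x
  proof -
    have "x / r i < 1" for i using r[of i] that by (simp add: divide_less_eq)
    then show ?thesis using zero by simp
  qed
  moreover have "\<bar>\<Sum>i. w i * U (x / r i)\<bar> \<le> C * B * (x ^ 3 * (1 + ln x))" if x: "x \<ge> 1" for x
  proof -
    have sm: "summable (\<lambda>i. C * (x ^ 3 * (1 + ln x)) * (w i / r i ^ 3))" by (intro summable_mult sB)
    have "norm (\<Sum>i. w i * U (x / r i)) \<le> (\<Sum>i. C * (x ^ 3 * (1 + ln x)) * (w i / r i ^ 3))"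
      by (rule norm_suminf_le[OF _ sm]) (use summand[OF x] in simp)
    also have "\<dots> = C * (x ^ 3 * (1 + ln x)) * B" using suminf_mult[OF sB] suB by simp
    finally show ?thesis by (simp add: mult_ac)
  qed
  moreover have "((\<lambda>x. (\<Sum>i. w i * U (x / r i)) / (x ^ 3 * ln x)) \<longlongrightarrow> A * B) at_top"
  proof -
    define f where "f i x = w i * U (x / r i) / (x ^ 3 * ln x)" for i x
    have f_lim: "(f i \<longlongrightarrow> A * (w i / r i ^ 3)) at_top" for i
    proof -
      have ri: "r i > 0" using r[of i] by linarith
      have "filterlim (\<lambda>x. x / r i) at_top at_top" using ri by real_asymp
      from filterlim_compose[OF lim this]
      have 1: "((\<lambda>x. U (x / r i) / ((x / r i) ^ 3 * ln (x / r i))) \<longlongrightarrow> A) at_top" .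
      have 2: "((\<lambda>x. ln (x / r i) / ln x) \<longlongrightarrow> 1) at_top" using ri by real_asymp
      have "((\<lambda>x. w i / r i ^ 3 * (U (x / r i) / ((x / r i) ^ 3 * ln (x / r i)) * (ln (x / r i) / ln x))) \<longlongrightarrow> w i / r i ^ 3 * (A * 1)) at_top"
        by (intro tendsto_intros 1 2)
      moreover have "eventually (\<lambda>x. w i / r i ^ 3 * (U (x / r i) / ((x / r i) ^ 3 * ln (x / r i)) * (ln (x / r i) / ln x)) = f i x) at_top"
        using eventually_gt_at_top[of "r i"]
      proof eventually_elim
        case (elim x)
        then have "ln (x / r i) > 0" using ri by (simp add: ln_gt_zero_iff less_divide_eq)
        then show ?case using ri by (simp add: f_def power_divide field_simps)
      qed
      ultimately have "(f i \<longlongrightarrow> w i / r i ^ 3 * (A * 1)) at_top" using tendsto_cong by fast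
      then show ?thesis by (simp add: mult_ac)
    qed
    have f_bound: "norm (f i x) \<le> 2 * C * (w i / r i ^ 3)" if x: "x \<ge> exp 1" for i x
    proof -
      have x1: "x \<ge> 1" using x exp_ge_add_one_self[of 1] by linarith
      have ln1: "ln x \<ge> 1" using x x1 by (simp add: ln_ge_iff)
      have pos: "x ^ 3 * ln x > 0" using x1 ln1 by (intro mult_pos_pos zero_less_power) linarith+
      have "\<bar>w i * U (x / r i)\<bar> \<le> C * (x ^ 3 * (1 + ln x)) * (w i / r i ^ 3)" by (rule summand[OF x1])
      also have "\<dots> \<le> C * (x ^ 3 * (2 * ln x)) * (w i / r i ^ 3)"
        using C w[of i] r[of i] ln1 x1 by (intro mult_right_mono mult_left_mono) auto
      finally have "\<bar>w i * U (x / r i)\<bar> \<le> 2 * C * (w i / r i ^ 3) * (x ^ 3 * ln x)" by (simp add: mult_ac)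
      then have "\<bar>w i * U (x / r i)\<bar> / (x ^ 3 * ln x) \<le> 2 * C * (w i / r i ^ 3)" using pos by (simp add: pos_divide_le_eq)
      moreover have "norm (f i x) = \<bar>w i * U (x / r i)\<bar> / (x ^ 3 * ln x)" using pos by (simp add: f_def abs_div)
      ultimately show ?thesis by simp
    qed
    have "((\<lambda>x. \<Sum>i. f i x) \<longlongrightarrow> (\<Sum>i. A * (w i / r i ^ 3))) at_top"
    proof (rule tannerys_theorem[THEN conjunct2, THEN conjunct2])
      show "(f i \<longlongrightarrow> A * (w i / r i ^ 3)) at_top" for i by (rule f_lim)
      have "eventually (\<lambda>x. \<forall>i. norm (f i x) \<le> 2 * C * (w i / r i ^ 3)) at_top"
        using eventually_ge_at_top[of "exp 1"] by eventually_elim (use f_bound in blast)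
      then have "eventually (\<lambda>z. \<forall>i. norm (f i (snd z)) \<le> 2 * C * (w i / r i ^ 3)) (sequentially \<times>\<^sub>F at_top)"
        by (rule eventually_compose_filterlim[OF _ filterlim_snd])
      then show "eventually (\<lambda>(i, x). norm (f i x) \<le> 2 * C * (w i / r i ^ 3)) (sequentially \<times>\<^sub>F at_top)"
        by eventually_elim auto
      show "summable (\<lambda>i. 2 * C * (w i / r i ^ 3))" by (intro summable_mult sB)
    qed simp
    moreover have "(\<Sum>i. A * (w i / r i ^ 3)) = A * B" using suminf_mult[OF sB] suB by simp
    moreover have "eventually (\<lambda>x. (\<Sum>i. f i x) = (\<Sum>i. w i * U (x / r i)) / (x ^ 3 * ln x)) at_top"
      using eventually_ge_at_top[of 1]
    proof eventually_elim
      case (elim x)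
      have "summable (\<lambda>i. w i * U (x / r i))"
        by (rule summable_comparison_test[OF _ summable_mult[OF sB, of "C * (x ^ 3 * (1 + ln x))"]])
          (use summand[OF elim] in auto)
      then show ?case unfolding f_def by (rule suminf_divide)
    qed
    ultimately show ?thesis using tendsto_cong by fastforce
  qed
  ultimately show ?thesis by (simp add: cubic_log_def)
qed

lemma power9_diff_bounds:
  fixes x :: real
  assumes "x \<ge> 0"
  shows "9 * x ^ 8 \<le> (x + 1) ^ 9 - x ^ 9" "(x + 1) ^ 9 - x ^ 9 \<le> 9 * (x + 1) ^ 8"
proof -
  have "\<exists>z>x. z < x + 1 \<and> (x + 1) ^ 9 - x ^ 9 = (x + 1 - x) * (9 * z ^ 8)"
    by (rule MVT2) (auto intro!: derivative_eq_intros)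
  then obtain z where z: "x < z" "z < x + 1" "(x + 1) ^ 9 - x ^ 9 = 9 * z ^ 8" by auto
  have "x ^ 8 \<le> z ^ 8" "z ^ 8 \<le> (x + 1) ^ 8" using z assms by (auto intro!: power_mono)
  then show "9 * x ^ 8 \<le> (x + 1) ^ 9 - x ^ 9" "(x + 1) ^ 9 - x ^ 9 \<le> 9 * (x + 1) ^ 8" using z(3) by linarith+
qed

lemma sum_eighth_powers_bounds:
  "real n ^ 9 / 9 \<le> (\<Sum>m=1..n. real m ^ 8)" "(\<Sum>m=1..n. real m ^ 8) \<le> real n ^ 9 / 9 + real n ^ 8"
proof -
  have "real n ^ 9 / 9 \<le> (\<Sum>m=1..n. real m ^ 8) \<and> (\<Sum>m=1..n. real m ^ 8) \<le> real n ^ 9 / 9 + real n ^ 8"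
  proof (induction n)
    case (Suc n)
    have sum_Suc: "(\<Sum>m=1..Suc n. real m ^ 8) = (\<Sum>m=1..n. real m ^ 8) + (real n + 1) ^ 8"
      and real_Suc: "real (Suc n) = real n + 1" by (simp_all add: add.commute)
    show ?case using Suc power9_diff_bounds[of "real n"] unfolding sum_Suc real_Suc by linarith
  qed simp
  then show "real n ^ 9 / 9 \<le> (\<Sum>m=1..n. real m ^ 8)" "(\<Sum>m=1..n. real m ^ 8) \<le> real n ^ 9 / 9 + real n ^ 8" by auto
qed

lemma le_nat_floor_iff:
  assumes "t \<ge> 0" shows "real m \<le> t \<longleftrightarrow> m \<le> nat \<lfloor>t\<rfloor>"
  using assms by (metis le_nat_floor of_nat_floor of_nat_le_iff order_trans)

text \<open>The innermost sum of the counting function, over \<open>m\<close>.\<close>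

definition cube_sum :: "real \<Rightarrow> real" where
  "cube_sum y = (\<Sum>m | 0 < m \<and> real m ^ 3 \<le> y. real m ^ 8)"

text \<open>Comparison of \<open>\<Sum> m\<^sup>8\<close> with the integral of
  \<open>x\<^sup>8\<close>.\<close>

lemma cube_sum_estimate:
  assumes "t \<ge> 1"
  shows "\<bar>cube_sum (t ^ 3) - t ^ 9 / 9\<bar> \<le> t ^ 8"
proof -
  define n where "n = nat \<lfloor>t\<rfloor>"
  have n: "real n \<le> t" "t < real n + 1" using assms by (auto simp: n_def)
  have "{m. 0 < m \<and> real m ^ 3 \<le> t ^ 3} = {1..n}"
  proof -
    have "real m ^ 3 \<le> t ^ 3 \<longleftrightarrow> m \<le> n" for m
    proof -
      have "real m ^ 3 \<le> t ^ 3 \<longleftrightarrow> real m \<le> t" using assms by (intro power_mono_iff) auto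
      also have "\<dots> \<longleftrightarrow> m \<le> n" unfolding n_def using assms by (intro le_nat_floor_iff) simp
      finally show ?thesis .
    qed
    then show ?thesis by (simp only: set_eq_iff mem_Collect_eq atLeastAtMost_iff Suc_le_eq One_nat_def simp_thms)
  qed
  then have c: "cube_sum (t ^ 3) = (\<Sum>m=1..n. real m ^ 8)" by (simp add: cube_sum_def)
  have "real n ^ 9 \<le> t ^ 9" "real n ^ 8 \<le> t ^ 8" using n by (auto intro!: power_mono)
  moreover have "t ^ 9 - 9 * t ^ 8 \<le> (t - 1) ^ 9" using power9_diff_bounds(2)[of "t - 1"] assms by simp
  moreover have "(t - 1) ^ 9 \<le> real n ^ 9" using n assms by (intro power_mono) auto
  ultimately show ?thesis unfolding c using sum_eighth_powers_bounds[of n] by linarith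
qed

text \<open>The sum of \<open>m\<^sup>8 e\<^sup>1\<^sup>1\<close> over \<open>m\<^sup>3 e\<^sup>4
  \<le> x\<close>.\<close>

definition lattice_sum :: "real \<Rightarrow> real" where
  "lattice_sum x = (\<Sum>e | 0 < e \<and> real e ^ 4 \<le> x. real e ^ 11 * cube_sum (x / real e ^ 4))"

lemma fourth_power_le_iff:
  assumes "s \<ge> 0"
  shows "{e. 0 < e \<and> real e ^ 4 \<le> s ^ 4} = {1..nat \<lfloor>s\<rfloor>}"
proof -
  have "real m ^ 4 \<le> s ^ 4 \<longleftrightarrow> m \<le> nat \<lfloor>s\<rfloor>" for m
  proof -
    have "real m ^ 4 \<le> s ^ 4 \<longleftrightarrow> real m \<le> s" using assms by (intro power_mono_iff) auto
    also have "\<dots> \<longleftrightarrow> m \<le> nat \<lfloor>s\<rfloor>" using assms by (rule le_nat_floor_iff)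
    finally show ?thesis .
  qed
  then show ?thesis by (simp only: set_eq_iff mem_Collect_eq atLeastAtMost_iff Suc_le_eq One_nat_def simp_thms)
qed

text \<open>The term of \<open>e\<close> is \<open>s\<^sup>1\<^sup>2 / (9 e)\<close> up to
  \<open>e\<^sup>1\<^sup>1 t\<^sup>8\<close>, where \<open>t = (s / e)\<^bsup>4/3\<^esup>\<close>.
  Since \<open>t\<^sup>8\<close> is at most \<open>(s / e)\<^sup>1\<^sup>1\<close>, each of the at
  most \<open>s\<close> errors is bounded by \<open>s\<^sup>1\<^sup>1\<close>.\<close>

lemma lattice_sum_estimate:
  assumes s: "s \<ge> 1"
  shows "\<bar>lattice_sum (s ^ 4) - s ^ 12 / 9 * harm (nat \<lfloor>s\<rfloor>)\<bar> \<le> s ^ 12"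
proof -
  let ?E = "nat \<lfloor>s\<rfloor>"
  have summand: "\<bar>real e ^ 11 * cube_sum (s ^ 4 / real e ^ 4) - s ^ 12 / 9 * inverse (real e)\<bar> \<le> s ^ 11"
    if e: "e \<in> {1..?E}" for e
  proof -
    have e': "real e > 0" "real e \<le> s" using e s le_nat_floor_iff[of s e] by auto
    define u where "u = s / real e"
    have u: "u \<ge> 1" using e' by (simp add: u_def)
    define t where "t = root 3 (u ^ 4)"
    have t3: "t ^ 3 = u ^ 4" using u by (simp add: t_def)
    have t: "t \<ge> 1" using u by (simp add: t_def)
    have "(t ^ 8) ^ 3 = (t ^ 3) ^ 8" by (simp add: power_mult[symmetric])
    also have "\<dots> = u ^ 32" unfolding t3 by (simp add: power_mult[symmetric])
    also have "\<dots> \<le> u ^ 33" using u by (intro power_increasing) auto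
    also have "\<dots> = (u ^ 11) ^ 3" by (simp add: power_mult[symmetric])
    finally have t8: "t ^ 8 \<le> u ^ 11" using u by (auto dest: power_le_imp_le_base intro: power_le_imp_le_base[of "t ^ 8" 2])
    have t9: "t ^ 9 = u ^ 12"
    proof -
      have "t ^ 9 = (t ^ 3) ^ 3" by (simp add: power_mult[symmetric])
      then show ?thesis unfolding t3 by (simp add: power_mult[symmetric])
    qed
    have "\<bar>cube_sum (u ^ 4) - u ^ 12 / 9\<bar> \<le> u ^ 11"
      using cube_sum_estimate[OF t] t8 unfolding t3 t9 by linarith
    then have "real e ^ 11 * \<bar>cube_sum (u ^ 4) - u ^ 12 / 9\<bar> \<le> real e ^ 11 * u ^ 11" by (intro mult_left_mono) auto
    moreover have "real e ^ 11 * u ^ 11 = s ^ 11" using e' by (simp add: u_def power_divide)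
    moreover have "real e ^ 11 * \<bar>cube_sum (u ^ 4) - u ^ 12 / 9\<bar> = \<bar>real e ^ 11 * cube_sum (s ^ 4 / real e ^ 4) - s ^ 12 / 9 * inverse (real e)\<bar>"
    proof -
      have "real e ^ 11 * (u ^ 12 / 9) = s ^ 12 / 9 * inverse (real e)"
        using e' power_Suc[of "real e" 11] by (simp add: u_def power_divide field_simps)
      then have "real e ^ 11 * (cube_sum (u ^ 4) - u ^ 12 / 9) = real e ^ 11 * cube_sum (s ^ 4 / real e ^ 4) - s ^ 12 / 9 * inverse (real e)"
        by (simp add: right_diff_distrib) (simp add: u_def power_divide)
      then show ?thesis by (metis abs_mult abs_of_nonneg zero_le_power of_nat_0_le_iff)
    qed
    ultimately show ?thesis by simp
  qed
  have "lattice_sum (s ^ 4) - s ^ 12 / 9 * harm ?E =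
      (\<Sum>e=1..?E. real e ^ 11 * cube_sum (s ^ 4 / real e ^ 4) - s ^ 12 / 9 * inverse (real e))"
  proof -
    have s0: "0 \<le> s" using s by simp
    show ?thesis unfolding lattice_sum_def fourth_power_le_iff[OF s0] harm_def sum_distrib_left sum_subtractf ..
  qed
  also have "\<bar>\<dots>\<bar> \<le> (\<Sum>e=1..?E. s ^ 11)" by (rule order_trans[OF sum_abs sum_mono]) (rule summand)
  also have "\<dots> = real ?E * s ^ 11" by simp
  also have "\<dots> \<le> s * s ^ 11" using s by (intro mult_right_mono) auto
  finally show ?thesis by (simp add: power_Suc[symmetric] del: power_Suc)
qed

lemma harm_le_1_plus_ln: "n > 0 \<Longrightarrow> harm n \<le> 1 + ln (real n)"
proof (induction n rule: nat_induct_non_zero)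
  case (Suc n)
  have "inverse (real (Suc n)) \<le> ln (real (Suc n)) - ln (real n)"
  proof -
    have "ln (real n / real (Suc n)) \<le> real n / real (Suc n) - 1" using Suc(1) by (intro ln_le_minus_one) auto
    also have "\<dots> = - inverse (real (Suc n))" by (simp add: field_simps)
    finally show ?thesis using Suc(1) by (simp add: ln_div)
  qed
  then show ?case using Suc(2) by (simp add: harm_Suc)
qed (simp add: harm_expand)

text \<open>With \<open>s = x\<^bsup>1/4\<^esup>\<close> the harmonic number in
  \<open>lattice_sum_estimate\<close> is \<open>ln s = ln x / 4\<close> up to a bounded error. This is
  where the logarithm, and hence the double pole, comes from.\<close>

lemma cubic_log_lattice_sum: "cubic_log lattice_sum (1 / 36) 2"
proof -
  have est: "\<bar>lattice_sum x - x ^ 3 * (ln x / 36)\<bar> \<le> 10 / 9 * x ^ 3" if x: "x \<ge> 1" for x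
  proof -
    define s where "s = root 4 x"
    have s: "s \<ge> 1" "s ^ 4 = x" using x by (auto simp: s_def)
    then have s12: "s ^ 12 = x ^ 3" using power_mult[of s 4 3] by simp
    have lns: "ln s = ln x / 4" using s ln_realpow[of s 4] by simp
    define E where "E = nat \<lfloor>s\<rfloor>"
    have E: "E > 0" "real E \<le> s" "s \<le> real E + 1" using s by (auto simp: E_def)
    have "harm E \<le> 1 + ln s" using harm_le_1_plus_ln[OF E(1)] E s by (smt (verit) ln_mono of_nat_0_less_iff)
    moreover have "ln s \<le> harm E"
      using ln_le_harm[of E] E s by (smt (verit) ln_mono)
    ultimately have "\<bar>harm E - ln x / 4\<bar> \<le> 1" unfolding lns by linarith
    then have "x ^ 3 / 9 * \<bar>harm E - ln x / 4\<bar> \<le> x ^ 3 / 9 * 1" using x by (intro mult_left_mono) auto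
    then have "\<bar>x ^ 3 / 9 * harm E - x ^ 3 * (ln x / 36)\<bar> \<le> x ^ 3 / 9"
    proof -
      have eq: "x ^ 3 / 9 * harm E - x ^ 3 * (ln x / 36) = x ^ 3 / 9 * (harm E - ln x / 4)" by (simp add: algebra_simps)
      have "\<bar>x ^ 3 / 9 * harm E - x ^ 3 * (ln x / 36)\<bar> = x ^ 3 / 9 * \<bar>harm E - ln x / 4\<bar>"
        unfolding eq using x by (simp add: abs_mult)
      with \<open>x ^ 3 / 9 * \<bar>harm E - ln x / 4\<bar> \<le> x ^ 3 / 9 * 1\<close> show ?thesis by linarith
    qed
    moreover have "\<bar>lattice_sum x - x ^ 3 / 9 * harm E\<bar> \<le> x ^ 3"
      using lattice_sum_estimate[OF s(1)] unfolding s(2) s12 E_def .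
    ultimately show ?thesis by linarith
  qed
  have "lattice_sum x = 0" if "x < 1" for x
  proof -
    have "\<not> (0 < e \<and> real e ^ 4 \<le> x)" for e
    proof
      assume e: "0 < e \<and> real e ^ 4 \<le> x"
      then have "1 \<le> real e ^ 4" by (intro one_le_power) simp
      with e \<open>x < 1\<close> show False by linarith
    qed
    then have "{e. 0 < e \<and> real e ^ 4 \<le> x} = {}" by blast
    then show ?thesis unfolding lattice_sum_def by (simp only: sum.empty)
  qed
  moreover have "\<bar>lattice_sum x\<bar> \<le> 2 * (x ^ 3 * (1 + ln x))" if x: "x \<ge> 1" for x
  proof -
    have "0 \<le> x ^ 3 * ln x" "0 \<le> x ^ 3" using x by simp_all
    moreover have "x ^ 3 * (ln x / 36) = x ^ 3 * ln x / 36" "2 * (x ^ 3 * (1 + ln x)) = 2 * x ^ 3 + 2 * (x ^ 3 * ln x)"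
      by (simp_all add: distrib_left)
    ultimately show ?thesis using est[OF x] by linarith
  qed
  moreover have "((\<lambda>x. lattice_sum x / (x ^ 3 * ln x)) \<longlongrightarrow> 1 / 36) at_top"
    unfolding Lim_null[of "\<lambda>x. lattice_sum x / (x ^ 3 * ln x)"]
  proof (rule Lim_null_comparison)
    show "eventually (\<lambda>x. norm (lattice_sum x / (x ^ 3 * ln x) - 1 / 36) \<le> 10 / 9 / ln x) at_top"
      using eventually_gt_at_top[of 1]
    proof eventually_elim
      case (elim x)
      then have pos: "x ^ 3 * ln x > 0" by simp
      have "lattice_sum x / (x ^ 3 * ln x) - 1 / 36 = (lattice_sum x - x ^ 3 * (ln x / 36)) / (x ^ 3 * ln x)"
        using elim by (simp add: field_simps)
      then have "norm (lattice_sum x / (x ^ 3 * ln x) - 1 / 36) = \<bar>lattice_sum x - x ^ 3 * (ln x / 36)\<bar> / (x ^ 3 * ln x)"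
        using pos by (simp only: real_norm_def abs_divide abs_of_pos)
      also have "\<dots> \<le> 10 / 9 * x ^ 3 / (x ^ 3 * ln x)" using est[of x] pos elim by (intro divide_right_mono) auto
      also have "\<dots> = 10 / 9 / ln x" using elim by (simp add: field_simps)
      finally show ?case .
    qed
    show "((\<lambda>x :: real. 10 / 9 / ln x) \<longlongrightarrow> 0) at_top" by real_asymp
  qed
  ultimately show ?thesis by (simp add: cubic_log_def)
qed


section \<open>Partial sums of the counting function\<close>

lemma cube_sum_box:
  assumes "y \<le> real N"
  shows "cube_sum y = (\<Sum>m=1..N. if real m ^ 3 \<le> y then real m ^ 8 else 0)"
proof -
  have "{m. 0 < m \<and> real m ^ 3 \<le> y} = {m \<in> {1..N}. real m ^ 3 \<le> y}"
  proof -
    have "m \<le> N" if "0 < m" "real m ^ 3 \<le> y" for m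
    proof -
      have "real m \<le> real m ^ 3" using that(1) by (intro self_le_power) auto
      then have "real m \<le> real N" using that(2) assms by linarith
      then show ?thesis by simp
    qed
    then show ?thesis by auto
  qed
  then show ?thesis unfolding cube_sum_def by (simp only: sum.inter_filter[OF finite_atLeastAtMost])
qed

lemma lattice_sum_box:
  assumes "0 \<le> y" "y \<le> real N"
  shows "lattice_sum y = (\<Sum>e=1..N. real e ^ 11 * cube_sum (y / real e ^ 4))"
  unfolding lattice_sum_def
proof (rule sum.mono_neutral_left)
  show "{e. 0 < e \<and> real e ^ 4 \<le> y} \<subseteq> {1..N}"
  proof
    fix e assume "e \<in> {e. 0 < e \<and> real e ^ 4 \<le> y}"
    then have e: "0 < e" "real e ^ 4 \<le> y" by auto
    have "real e \<le> real e ^ 4" using e(1) by (intro self_le_power) auto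
    then have "real e \<le> real N" using e(2) assms by linarith
    then show "e \<in> {1..N}" using e(1) by simp
  qed
  show "\<forall>e\<in>{1..N} - {e. 0 < e \<and> real e ^ 4 \<le> y}. real e ^ 11 * cube_sum (y / real e ^ 4) = 0"
  proof
    fix e assume "e \<in> {1..N} - {e. 0 < e \<and> real e ^ 4 \<le> y}"
    then have e: "e > 0" "y < real e ^ 4" by auto
    then have y1: "y / real e ^ 4 < 1" by (simp add: divide_less_eq)
    have "\<not> (0 < m \<and> real m ^ 3 \<le> y / real e ^ 4)" for m
    proof
      assume m: "0 < m \<and> real m ^ 3 \<le> y / real e ^ 4"
      then have "1 \<le> real m ^ 3" by (intro one_le_power) simp
      with m y1 show False by linarith
    qed
    then have "{m. 0 < m \<and> real m ^ 3 \<le> y / real e ^ 4} = {}" by blast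
    then have "cube_sum (y / real e ^ 4) = 0" unfolding cube_sum_def by (simp only: sum.empty)
    then show "real e ^ 11 * cube_sum (y / real e ^ 4) = 0" by simp
  qed
qed simp

text \<open>The sum over squarefree \<open>q = i + 1\<close> of \<open>q\<^sup>1\<^sup>0\<close>
  times a dilate of \<open>lattice_sum\<close>. Only finitely many terms are nonzero, but an infinite
  series is what \<open>cubic_log_dilation_sum\<close> handles.\<close>

definition sqfree_sum :: "real \<Rightarrow> real" where
  "sqfree_sum x = (\<Sum>i. (if squarefree (Suc i) then real (Suc i) ^ 10 else 0) * lattice_sum (x / real (Suc i) ^ 4))"

definition count_sum :: "real \<Rightarrow> real" where
  "count_sum x = (\<Sum>i. real (Suc i) ^ 12 * sqfree_sum (x / real (Suc i) ^ 5))"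

lemma zeta_2_4: "riemann_zeta 2 = of_real (pi ^ 2 / 6)" "riemann_zeta 4 = of_real (pi ^ 4 / 90)"
proof -
  have e1: "(\<lambda>k. real (Suc k) powr - 2) = (\<lambda>n. 1 / (real n + 1) ^ 2)"
    by (simp add: powr_minus powr_numeral divide_inverse add_ac)
  have e2: "(\<Sum>n. 1 / (real n + 1) ^ 2) = pi ^ 2 / 6" using inverse_squares_sums by (simp add: sums_iff add.commute)
  show "riemann_zeta 2 = of_real (pi ^ 2 / 6)" using riemann_zeta_of_real(1)[of 2] unfolding e1 e2 by simp
  have e3: "(\<lambda>k. real (Suc k) powr - 4) = (\<lambda>n. 1 / real (Suc n) ^ 4)"
    by (simp add: powr_minus powr_numeral divide_inverse)
  have e4: "(\<Sum>n. 1 / real (Suc n) ^ 4) = pi ^ 4 / 90" using inverse_fourth_powers_sums by (simp add: sums_iff)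
  show "riemann_zeta 4 = of_real (pi ^ 4 / 90)" using riemann_zeta_of_real(1)[of 4] unfolding e3 e4 by simp
qed

text \<open>The value is \<open>\<zeta>(2) / \<zeta>(4)\<close>.\<close>

lemma sqfree_reciprocal_squares_sums: "(\<lambda>i. (if squarefree (Suc i) then 1 / real (Suc i) ^ 2 else 0)) sums (15 / pi ^ 2)"
proof -
  have "riemann_zeta 2 / riemann_zeta 4 = of_real (15 / pi ^ 2)"
    unfolding zeta_2_4 by (simp add: power4_eq_xxxx power2_eq_square field_simps)
  moreover have "riemann_zeta 4 \<noteq> 0" unfolding zeta_2_4 by simp
  ultimately have sqfree: "(npow 2 has_sum of_real (15 / pi ^ 2)) {q. squarefree q}"
    using squarefree_has_sum(2)[of 2] by simp
  have "npow 2 q = of_real (1 / real q ^ 2)" for q :: nat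
  proof -
    have "of_nat q powr of_nat 2 = (of_nat q ^ 2 :: complex)" by (rule powr_nat') simp
    then show ?thesis by (simp add: npow_def powr_minus divide_inverse)
  qed
  then have npow2: "npow 2 = (\<lambda>q. complex_of_real (1 / real q ^ 2))" by (rule ext)
  have "((\<lambda>q. complex_of_real (1 / real q ^ 2)) has_sum of_real (15 / pi ^ 2)) {q. squarefree q}"
    using sqfree unfolding npow2 .
  then have "((\<lambda>q. 1 / real q ^ 2) has_sum (15 / pi ^ 2)) {q. squarefree q}"
    by (simp only: has_sum_of_real_iff)
  also have "?this \<longleftrightarrow> ((\<lambda>q. if squarefree q then 1 / real q ^ 2 else 0) has_sum (15 / pi ^ 2)) {0<..}"
    by (rule has_sum_cong_neutral) (auto intro!: Nat.gr0I)
  also have "\<dots> \<longleftrightarrow> ((\<lambda>i. if squarefree (Suc i) then 1 / real (Suc i) ^ 2 else 0) has_sum (15 / pi ^ 2)) UNIV"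
    by (rule has_sum_reindex_bij_betw[symmetric], rule bij_betwI[where g = "\<lambda>n. n - 1"]) auto
  finally show ?thesis by (rule has_sum_imp_sums)
qed

lemma cubic_log_sqfree_sum: "cubic_log sqfree_sum (1 / 36 * (15 / pi ^ 2)) (2 * (15 / pi ^ 2))"
  unfolding sqfree_sum_def[abs_def]
proof (rule cubic_log_dilation_sum[OF cubic_log_lattice_sum])
  have "(if squarefree (Suc i) then real (Suc i) ^ 10 else 0) / (real (Suc i) ^ 4) ^ 3
      = (if squarefree (Suc i) then 1 / real (Suc i) ^ 2 else 0)" for i
  proof -
    have "(real (Suc i) ^ 4) ^ 3 = real (Suc i) ^ 10 * real (Suc i) ^ 2" by (simp only: power_mult[symmetric] power_add[symmetric]) simp
    then have "real (Suc i) ^ 10 / (real (Suc i) ^ 4) ^ 3 = 1 / real (Suc i) ^ 2"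
      by (simp only: nonzero_divide_mult_cancel_left power_not_zero of_nat_neq_0 not_False_eq_True)
    then show ?thesis by simp
  qed
  then show "(\<lambda>i. (if squarefree (Suc i) then real (Suc i) ^ 10 else 0) / (real (Suc i) ^ 4) ^ 3) sums (15 / pi ^ 2)"
    using sqfree_reciprocal_squares_sums by presburger
qed (auto intro: one_le_power)

lemma cubic_log_count_sum:
  "cubic_log count_sum (1 / 36 * (15 / pi ^ 2) * (\<Sum>k. 1 / real (Suc k) ^ 3)) (2 * (15 / pi ^ 2) * (\<Sum>k. 1 / real (Suc k) ^ 3))"
  unfolding count_sum_def[abs_def]
proof (rule cubic_log_dilation_sum[OF cubic_log_sqfree_sum])
  have "(\<lambda>k. real (Suc k) powr - 3) = (\<lambda>k. 1 / real (Suc k) ^ 3)" by (simp add: powr_minus divide_inverse powr_numeral)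
  then have sm: "summable (\<lambda>k. 1 / real (Suc k) ^ 3)" using summable_Suc_powr[of "-3"] by simp
  have "real (Suc i) ^ 12 / (real (Suc i) ^ 5) ^ 3 = 1 / real (Suc i) ^ 3" for i
  proof -
    have "(real (Suc i) ^ 5) ^ 3 = real (Suc i) ^ 12 * real (Suc i) ^ 3" by (simp only: power_mult[symmetric] power_add[symmetric]) simp
    then show ?thesis
      by (simp only: nonzero_divide_mult_cancel_left power_not_zero of_nat_neq_0 not_False_eq_True)
  qed
  then show "(\<lambda>i. real (Suc i) ^ 12 / (real (Suc i) ^ 5) ^ 3) sums (\<Sum>k. 1 / real (Suc k) ^ 3)"
    using summable_sums[OF sm] by presburger
qed (auto intro: one_le_power)

lemma cubic_log_zero: "cubic_log U A C \<Longrightarrow> x < 1 \<Longrightarrow> U x = 0"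
  by (simp add: cubic_log_def)

lemma quotient_bounds:
  assumes "0 \<le> y" "y \<le> real N" "d \<ge> 1" shows "0 \<le> y / d" "y / d \<le> real N"
proof -
  show "0 \<le> y / d" using assms by simp
  have "y / d \<le> y / 1" using assms by (intro divide_left_mono) auto
  then show "y / d \<le> real N" using assms by simp
qed

text \<open>Dilates with arguments below 1 vanish, so the series stops at \<open>N\<close>.\<close>

lemma dilation_sum_box:
  assumes "\<And>x. x < 1 \<Longrightarrow> U x = (0 :: real)" "0 \<le> y" "y \<le> real N" "j > 0"
  shows "(\<Sum>i. w (Suc i) * U (y / real (Suc i) ^ j)) = (\<Sum>k=1..N. w k * U (y / real k ^ j))"
proof -
  have "(\<Sum>i. w (Suc i) * U (y / real (Suc i) ^ j)) = (\<Sum>i<N. w (Suc i) * U (y / real (Suc i) ^ j))"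
  proof (rule suminf_finite)
    fix i assume "i \<notin> {..<N}"
    then have "real N < real (Suc i)" by simp
    also have "real (Suc i) ^ 1 \<le> real (Suc i) ^ j" using assms(4) by (intro power_increasing) auto
    finally have "y / real (Suc i) ^ j < 1" using assms(3) by (simp add: divide_less_eq)
    then show "w (Suc i) * U (y / real (Suc i) ^ j) = 0" using assms(1) by simp
  qed simp
  then show ?thesis by (simp add: sum.atLeast1_atMost_eq)
qed

text \<open>In \<open>n = m\<^sup>3 k\<^sup>5 (q e)\<^sup>4 \<le> N\<close> all four variables are
  at most \<open>N\<close>. Over this common box the summations can be exchanged freely, and the
  condition on \<open>n\<close> can be moved into the innermost sum.\<close>

lemma count_sum_eq: "count_sum (real N) = (\<Sum>n=1..N. real (proiso_count \<Gamma>_t2 n))"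
proof -
  let ?B = "{1..N} \<times> {1..N} \<times> {1..N} \<times> {1..N}"
  define weight where "weight = (\<lambda>(m :: nat, k :: nat, q :: nat, e :: nat). real (m ^ 8 * k ^ 12 * q ^ 10 * e ^ 11))"
  define P where "P = (\<lambda>(m :: nat, k :: nat, q :: nat, e :: nat). squarefree q \<and> m ^ 3 * k ^ 5 * (q * e) ^ 4 \<le> N)"
  have "(\<Sum>n=1..N. real (proiso_count \<Gamma>_t2 n)) = (\<Sum>n=1..N. \<Sum>t\<in>quads n. weight t)"
    by (rule sum.cong[OF HOL.refl]) (simp add: proiso_count_\<Gamma>_t2 weight_def case_prod_beta)
  also have "\<dots> = (\<Sum>t\<in>(\<Union>n\<in>{1..N}. quads n). weight t)"
  proof (rule sum.UNION_disjoint[symmetric])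
    show "\<forall>n\<in>{1..N}. finite (quads n)" using finite_quads by simp
    show "\<forall>n\<in>{1..N}. \<forall>n'\<in>{1..N}. n \<noteq> n' \<longrightarrow> quads n \<inter> quads n' = {}" by (auto simp: quads_def)
  qed simp
  also have "(\<Union>n\<in>{1..N}. quads n) = {t \<in> ?B. P t}"
  proof
    show "(\<Union>n\<in>{1..N}. quads n) \<subseteq> {t \<in> ?B. P t}"
    proof
      fix t assume "t \<in> (\<Union>n\<in>{1..N}. quads n)"
      then obtain n where n: "1 \<le> n" "n \<le> N" "t \<in> quads n" by auto
      obtain m k q e where tc: "t = (m, k, q, e)" by (rule prod_cases4)
      show "t \<in> {t \<in> ?B. P t}" using quads_bound[of n m k q e] n by (auto simp: tc P_def quads_def)
    qed
    show "{t \<in> ?B. P t} \<subseteq> (\<Union>n\<in>{1..N}. quads n)"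
    proof
      fix t assume t: "t \<in> {t \<in> ?B. P t}"
      obtain m k q e where tc: "t = (m, k, q, e)" by (rule prod_cases4)
      have pos: "m > 0" "k > 0" "q > 0" "e > 0" using t by (auto simp: tc)
      then have "0 < m ^ 3 * k ^ 5 * (q * e) ^ 4" by simp
      then have "m ^ 3 * k ^ 5 * (q * e) ^ 4 \<in> {1..N}" using t by (simp add: tc P_def Suc_le_eq)
      moreover have "t \<in> quads (m ^ 3 * k ^ 5 * (q * e) ^ 4)" using t by (simp add: tc P_def quads_def)
      ultimately show "t \<in> (\<Union>n\<in>{1..N}. quads n)" by blast
    qed
  qed
  also have "(\<Sum>t\<in>{t \<in> ?B. P t}. weight t) = (\<Sum>t\<in>?B. if P t then weight t else 0)"
    by (rule sum.inter_filter) simp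
  also have "\<dots> = (\<Sum>m=1..N. \<Sum>k=1..N. \<Sum>q=1..N. \<Sum>e=1..N. if P (m, k, q, e) then weight (m, k, q, e) else 0)"
    unfolding sum.cartesian_product by (rule sum.cong[OF HOL.refl]) (simp add: case_prod_beta)
  also have "\<dots> = (\<Sum>k=1..N. \<Sum>m=1..N. \<Sum>q=1..N. \<Sum>e=1..N. if P (m, k, q, e) then weight (m, k, q, e) else 0)"
    by (rule sum.swap)
  also have "\<dots> = (\<Sum>k=1..N. \<Sum>q=1..N. \<Sum>m=1..N. \<Sum>e=1..N. if P (m, k, q, e) then weight (m, k, q, e) else 0)"
    by (rule sum.cong[OF HOL.refl], rule sum.swap)
  also have "\<dots> = (\<Sum>k=1..N. \<Sum>q=1..N. \<Sum>e=1..N. \<Sum>m=1..N. if P (m, k, q, e) then weight (m, k, q, e) else 0)"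
    by (rule sum.cong[OF HOL.refl], rule sum.cong[OF HOL.refl], rule sum.swap)
  also have "\<dots> = (\<Sum>k=1..N. real k ^ 12 * (\<Sum>q=1..N. (if squarefree q then real q ^ 10 else 0) *
      (\<Sum>e=1..N. real e ^ 11 * (\<Sum>m=1..N. if real m ^ 3 \<le> real N / real k ^ 5 / real q ^ 4 / real e ^ 4 then real m ^ 8 else 0))))"
    unfolding sum_distrib_left
  proof (intro sum.cong HOL.refl)
    fix k q e m assume r: "k \<in> {1..N}" "q \<in> {1..N}" "e \<in> {1..N}" "m \<in> {1..N}"
    then have pos: "real k ^ 5 > 0" "real q ^ 4 > 0" "real e ^ 4 > 0" by simp_all
    have "real m ^ 3 \<le> real N / real k ^ 5 / real q ^ 4 / real e ^ 4 \<longleftrightarrow> real m ^ 3 * real e ^ 4 * real q ^ 4 * real k ^ 5 \<le> real N"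
      using pos by (simp add: le_divide_eq mult_ac)
    also have "\<dots> \<longleftrightarrow> real (m ^ 3 * k ^ 5 * (q * e) ^ 4) \<le> real N" by (simp add: power_mult_distrib mult_ac)
    also have "\<dots> \<longleftrightarrow> m ^ 3 * k ^ 5 * (q * e) ^ 4 \<le> N" by (rule of_nat_le_iff)
    finally show "(if P (m, k, q, e) then weight (m, k, q, e) else 0) = real k ^ 12 * ((if squarefree q then real q ^ 10 else 0) *
       (real e ^ 11 * (if real m ^ 3 \<le> real N / real k ^ 5 / real q ^ 4 / real e ^ 4 then real m ^ 8 else 0)))"
      by (simp add: P_def weight_def mult_ac)
  qed
  also have "\<dots> = (\<Sum>k=1..N. real k ^ 12 * sqfree_sum (real N / real k ^ 5))"
  proof (rule sum.cong[OF HOL.refl])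
    fix k assume k: "k \<in> {1..N}"
    define y where "y = real N / real k ^ 5"
    have y: "0 \<le> y" "y \<le> real N" using quotient_bounds[of "real N" N "real k ^ 5"] k by (auto simp: y_def intro: one_le_power)
    have "sqfree_sum y = (\<Sum>q=1..N. (if squarefree q then real q ^ 10 else 0) * lattice_sum (y / real q ^ 4))"
      unfolding sqfree_sum_def
      using dilation_sum_box[where U = lattice_sum, OF cubic_log_zero[OF cubic_log_lattice_sum] y, where j = 4 and w = "\<lambda>q. if squarefree q then real q ^ 10 else 0"] by simp
    also have "\<dots> = (\<Sum>q=1..N. (if squarefree q then real q ^ 10 else 0) *
      (\<Sum>e=1..N. real e ^ 11 * (\<Sum>m=1..N. if real m ^ 3 \<le> y / real q ^ 4 / real e ^ 4 then real m ^ 8 else 0)))"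
    proof (intro sum.cong HOL.refl arg_cong2[where f = "(*)"])
      fix q assume q: "q \<in> {1..N}"
      have yq: "0 \<le> y / real q ^ 4" "y / real q ^ 4 \<le> real N" using quotient_bounds[OF y, of "real q ^ 4"] q by (auto intro: one_le_power)
      have "cube_sum (y / real q ^ 4 / real e ^ 4) = (\<Sum>m=1..N. if real m ^ 3 \<le> y / real q ^ 4 / real e ^ 4 then real m ^ 8 else 0)"
        if "e \<in> {1..N}" for e
        using quotient_bounds[OF yq, of "real e ^ 4"] that by (intro cube_sum_box) (auto intro: one_le_power)
      then show "lattice_sum (y / real q ^ 4) = (\<Sum>e=1..N. real e ^ 11 * (\<Sum>m=1..N. if real m ^ 3 \<le> y / real q ^ 4 / real e ^ 4 then real m ^ 8 else 0))"
        unfolding lattice_sum_box[OF yq] by (intro sum.cong HOL.refl) presburger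
    qed
    finally show "real k ^ 12 * (\<Sum>q=1..N. (if squarefree q then real q ^ 10 else 0) *
      (\<Sum>e=1..N. real e ^ 11 * (\<Sum>m=1..N. if real m ^ 3 \<le> real N / real k ^ 5 / real q ^ 4 / real e ^ 4 then real m ^ 8 else 0)))
      = real k ^ 12 * sqfree_sum (real N / real k ^ 5)" unfolding y_def by simp
  qed
  also have "\<dots> = count_sum (real N)"
    unfolding count_sum_def
    using dilation_sum_box[where U = sqfree_sum, OF cubic_log_zero[OF cubic_log_sqfree_sum], where y = "real N" and N = N and j = 5 and w = "\<lambda>k. real k ^ 12"] by simp
  finally show ?thesis by simp
qed

lemma count_asymptotics:
  "(\<lambda>N. \<Sum>n=1..N. real (proiso_count \<Gamma>_t2 n)) \<sim>[at_top]
     (\<lambda>N. 5 * (\<Sum>k. 1 / real (Suc k) ^ 3) / (12 * pi\<^sup>2) * real N ^ 3 * ln (real N))"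
proof -
  define z where "z = (\<Sum>k. 1 / real (Suc k) ^ 3)"
  define c where "c = 5 * z / (12 * pi\<^sup>2)"
  have "(\<lambda>k. real (Suc k) powr - 3) = (\<lambda>k. 1 / real (Suc k) ^ 3)" by (simp add: powr_minus divide_inverse powr_numeral)
  then have sm: "summable (\<lambda>k. 1 / real (Suc k) ^ 3)" using summable_Suc_powr[of "-3"] by simp
  have "z > 0" unfolding z_def using sm by (intro suminf_pos) auto
  then have c: "c \<noteq> 0" by (simp add: c_def)
  have "((\<lambda>x. count_sum x / (x ^ 3 * ln x)) \<longlongrightarrow> c) at_top"
    using cubic_log_count_sum by (simp add: cubic_log_def c_def z_def mult_ac)
  from filterlim_compose[OF this filterlim_real_sequentially]
  have "(\<lambda>N. count_sum (real N) / (real N ^ 3 * ln (real N))) \<longlonglongrightarrow> c" .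
  from tendsto_divide[OF this tendsto_const[of c] c]
  have "(\<lambda>N. count_sum (real N) / (c * real N ^ 3 * ln (real N))) \<longlonglongrightarrow> 1" using c by (simp add: mult_ac)
  then show ?thesis unfolding count_sum_eq c_def z_def by (rule asymp_equivI')
qed


section \<open>The numerical value of the constant\<close>

text \<open>Both bounds telescope. The difference on the right of the first is \<open>1 / ((n - 1) n
  (n + 1))\<close>, and the second is \<open>4 n / (4 n\<^sup>4 + 1)\<close> by the Sophie Germain
  factorisation of \<open>4 n\<^sup>4 + 1\<close>.\<close>

lemma inverse_cube_bounds:
  fixes n :: real assumes "n > 1"
  shows "1 / n ^ 3 \<le> 1 / (2 * (n - 1) * n) - 1 / (2 * n * (n + 1))"
    and "1 / (2 * (n - 1) * n + 1) - 1 / (2 * n * (n + 1) + 1) \<le> 1 / n ^ 3"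
proof -
  have "1 / (2 * (n - 1) * n) - 1 / (2 * n * (n + 1)) = 1 / ((n - 1) * n * (n + 1))"
    using assms by (simp add: divide_simps)
  moreover have "(n - 1) * n * (n + 1) \<le> n ^ 3" "(n - 1) * n * (n + 1) > 0"
    using assms by (simp add: algebra_simps power3_eq_cube) (use assms in \<open>intro mult_pos_pos; simp\<close>)
  ultimately show "1 / n ^ 3 \<le> 1 / (2 * (n - 1) * n) - 1 / (2 * n * (n + 1))" by (simp add: frac_le)
  have pos: "2 * (n - 1) * n + 1 > 0" "2 * n * (n + 1) + 1 > 0" using assms by (auto intro!: add_pos_pos mult_pos_pos)
  have "(2 * (n - 1) * n + 1) * (2 * n * (n + 1) + 1) = 4 * n ^ 4 + 1"
    by (simp add: algebra_simps power4_eq_xxxx)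
  then have "1 / (2 * (n - 1) * n + 1) - 1 / (2 * n * (n + 1) + 1) = 4 * n / (4 * n ^ 4 + 1)"
    using pos by (simp add: diff_frac_eq) (simp add: algebra_simps)
  also have "\<dots> \<le> 4 * n / (4 * n ^ 4)" using assms by (intro divide_left_mono) (auto intro!: mult_pos_pos add_pos_pos)
  also have "\<dots> = 1 / n ^ 3" using assms by (simp add: divide_simps power4_eq_xxxx power3_eq_cube)
  finally show "1 / (2 * (n - 1) * n + 1) - 1 / (2 * n * (n + 1) + 1) \<le> 1 / n ^ 3" .
qed

text \<open>The tail is estimated by telescoping sums. The lower bound has the smaller error, so
  fewer initial terms suffice for it.\<close>

lemma zeta3_bounds:
  "(\<Sum>k. 1 / real (Suc k) ^ 3) \<le> 1.2020573" "1.2020568 \<le> (\<Sum>k. 1 / real (Suc k) ^ 3)"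
proof -
  let ?f = "\<lambda>k. 1 / real (Suc k) ^ 3"
  have "(\<lambda>k. real (Suc k) powr - 3) = ?f" by (simp add: powr_minus divide_inverse powr_numeral)
  then have sm: "summable ?f" using summable_Suc_powr[of "-3"] by simp
  have sm_shift: "summable (\<lambda>k. ?f (k + N))" for N using sm by (rule summable_ignore_initial_segment)
  have split: "(\<Sum>k. ?f k) = (\<Sum>k. ?f (k + N)) + (\<Sum>k<N. ?f k)" for N by (rule suminf_split_initial_segment[OF sm])
  define T where "T N k = 1 / (2 * real (k + N) * (real (k + N) + 1))" for N k
  define L where "L N k = 1 / (2 * real (k + N) * (real (k + N) + 1) + 1)" for N k
  have T: "(\<lambda>k. T N k - T N (Suc k)) sums (T N 0 - 0)" for N
    by (rule telescope_sums') (unfold T_def, real_asymp)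
  have L: "(\<lambda>k. L N k - L N (Suc k)) sums (L N 0 - 0)" for N
    by (rule telescope_sums') (unfold L_def, real_asymp)
  have "(\<Sum>k. ?f (k + 30)) \<le> (\<Sum>k. T 30 k - T 30 (Suc k))"
  proof (rule suminf_le[OF _ sm_shift])
    show "?f (k + 30) \<le> T 30 k - T 30 (Suc k)" for k
      using inverse_cube_bounds(1)[of "real (Suc (k + 30))"] by (simp add: T_def add_ac)
  qed (use T sums_iff in blast)
  also have "\<dots> = T 30 0" using T[of 30] by (simp add: sums_iff)
  finally have "(\<Sum>k. ?f k) \<le> T 30 0 + (\<Sum>k<30. ?f k)" using split[of 30] by simp
  also have "\<dots> \<le> 1.2020573"
    by (simp add: T_def lessThan_nat_numeral lessThan_Suc)
  finally show "(\<Sum>k. ?f k) \<le> 1.2020573" .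
  have "(\<Sum>k. L 10 k - L 10 (Suc k)) \<le> (\<Sum>k. ?f (k + 10))"
  proof (rule suminf_le[OF _ _ sm_shift])
    show "L 10 k - L 10 (Suc k) \<le> ?f (k + 10)" for k
      using inverse_cube_bounds(2)[of "real (Suc (k + 10))"] by (simp add: L_def add_ac)
  qed (use L sums_iff in blast)
  moreover have "(\<Sum>k. L 10 k - L 10 (Suc k)) = L 10 0" using L[of 10] by (simp add: sums_iff)
  ultimately have "L 10 0 + (\<Sum>k<10. ?f k) \<le> (\<Sum>k. ?f k)" using split[of 10] by simp
  moreover have "1.2020568 \<le> L 10 0 + (\<Sum>k<10. ?f k)"
    by (simp add: L_def lessThan_nat_numeral lessThan_Suc)
  ultimately show "1.2020568 \<le> (\<Sum>k. ?f k)" by linarith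
qed

lemma constant_numeric:
  "\<bar>5 * (\<Sum>k. 1 / real (Suc k) ^ 3) / (12 * pi\<^sup>2) - 0.050747\<bar> < 0.0000005"
proof -
  let ?z = "\<Sum>k. 1 / real (Suc k) ^ 3"
  have "3.1415926 \<le> pi" "pi \<le> 3.1415927" using pi_approx by simp_all
  then have p: "3.1415926\<^sup>2 \<le> pi\<^sup>2" "pi\<^sup>2 \<le> 3.1415927\<^sup>2" by (auto intro!: power_mono)
  then have p': "9.86960406 < pi\<^sup>2" "pi\<^sup>2 < 9.86960470" by (simp_all add: power2_eq_square)
  have "5 * ?z < 0.0507475 * (12 * pi\<^sup>2)" "0.0507465 * (12 * pi\<^sup>2) < 5 * ?z" using zeta3_bounds p' by simp_all
  then have "5 * ?z / (12 * pi\<^sup>2) < 0.0507475" "0.0507465 < 5 * ?z / (12 * pi\<^sup>2)"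
    by (simp_all add: pos_divide_less_eq pos_less_divide_eq)
  moreover have "\<bar>t - 0.050747\<bar> < 0.0000005" if "t < 0.0507475" "0.0507465 < t" for t :: real
  proof -
    have "t - 0.050747 < 0.0000005" "- (t - 0.050747) < 0.0000005" using that by simp_all
    then show ?thesis by (simp only: abs_less_iff)
  qed
  ultimately show ?thesis by blast
qed


section \<open>The double pole and the conclusion\<close>

lemma riemann_zeta_affine_meromorphic: "(\<lambda>s. riemann_zeta (a * s - b)) meromorphic_on UNIV"
  by (rule meromorphic_on_compose[OF riemann_zeta_meromorphic]) (auto intro!: analytic_intros)

lemma riemann_zeta_affine_holomorphic:
  assumes "\<And>s. s \<in> S \<Longrightarrow> Re (a * s - b) > 1"
  shows "(\<lambda>s. riemann_zeta (a * s - b)) holomorphic_on S"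
proof (rule analytic_imp_holomorphic)
  have "riemann_zeta analytic_on (\<lambda>s. a * s - b) ` S"
    by (subst analytic_on_analytic_at) (use assms riemann_zeta_analytic in blast)
  then have "(riemann_zeta \<circ> (\<lambda>s. a * s - b)) analytic_on S"
    by (intro analytic_on_compose analytic_intros)
  then show "(\<lambda>s. riemann_zeta (a * s - b)) analytic_on S" by (simp add: comp_def)
qed

text \<open>Near 3 the arguments \<open>3 s - 8\<close> and \<open>4 s - 11\<close> are near 1 and
  contribute the denominators \<open>3 (s - 3)\<close> and \<open>4 (s - 3)\<close>. The other zeta
  factors are holomorphic and nonzero at 3, with values \<open>\<zeta>(3)\<close>,
  \<open>\<zeta>(2)\<close> and \<open>1 / \<zeta>(4)\<close>.\<close>

lemma zeta_quotient_pole_at_3: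
  defines "F \<equiv> (\<lambda>s. riemann_zeta (3 * s - 8) * riemann_zeta (4 * s - 11) * riemann_zeta (5 * s - 12) * riemann_zeta (4 * s - 10) / riemann_zeta (8 * s - 20))"
  shows "is_pole F 3" "zorder F 3 = -2"
proof -
  obtain h :: "complex \<Rightarrow> complex" and r where r: "r > 0" and h: "h holomorphic_on ball 1 r" "h 1 \<noteq> 0"
    and zh: "\<And>s. s \<in> ball 1 r - {1} \<Longrightarrow> riemann_zeta s = h s / (s - 1)"
    using riemann_zeta_simple_pole by metis
  \<comment> \<open>Radius \<open>r / 4\<close> keeps both singular arguments in the disc around 1;
    radius \<open>1 / 8\<close> keeps \<open>8 s - 20\<close> in the half plane where
    \<open>\<zeta>\<close> has no zeros.\<close>
  define S where "S = ball (3 :: complex) (min (r / 4) (1 / 8))"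
  have S: "open S" "3 \<in> S" using r by (auto simp: S_def)
  have near: "norm (s - 3) < r / 4" "Re s > 11 / 4" if "s \<in> S" for s
  proof -
    have d: "norm (s - 3) < r / 4" "norm (s - 3) < 1 / 8" using that by (auto simp: S_def dist_norm norm_minus_commute)
    then show "norm (s - 3) < r / 4" by simp
    show "Re s > 11 / 4" using d(2) abs_Re_le_cmod[of "s - 3"] by simp
  qed
  have in_ball: "3 * s - 8 \<in> ball 1 r" "4 * s - 11 \<in> ball 1 r" if "s \<in> S" for s
  proof -
    have "norm (3 * (s - 3)) < r" "norm (4 * (s - 3)) < r"
      using near(1)[OF that] norm_ge_zero[of "s - 3"] unfolding norm_mult norm_numeral by linarith+
    moreover have "3 * (s - 3) = (3 * s - 8) - 1" "4 * (s - 3) = (4 * s - 11) - 1" by simp_all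
    ultimately show "3 * s - 8 \<in> ball 1 r" "4 * s - 11 \<in> ball 1 r"
      by (simp_all only: mem_ball dist_norm norm_minus_commute)
  qed
  define g where "g s = h (3 * s - 8) * h (4 * s - 11) * riemann_zeta (5 * s - 12) * riemann_zeta (4 * s - 10) / (12 * riemann_zeta (8 * s - 20))" for s
  have h_affine: "(\<lambda>s. h (a * s - b)) holomorphic_on S" if "\<And>s. s \<in> S \<Longrightarrow> a * s - b \<in> ball 1 r" for a b
    using holomorphic_on_compose_gen[of "\<lambda>s. a * s - b" S h "ball 1 r", unfolded comp_def] h(1) that
    by (simp add: image_subset_iff holomorphic_intros del: mem_ball)
  have "(\<lambda>s. h (3 * s - 8)) holomorphic_on S" "(\<lambda>s. h (4 * s - 11)) holomorphic_on S"
    by (rule h_affine, rule in_ball, assumption)+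
  moreover have "(\<lambda>s. riemann_zeta (5 * s - 12)) holomorphic_on S" "(\<lambda>s. riemann_zeta (4 * s - 10)) holomorphic_on S"
    "(\<lambda>s. riemann_zeta (8 * s - 20)) holomorphic_on S"
    by (rule riemann_zeta_affine_holomorphic, use near(2) in force)+
  moreover have "riemann_zeta (8 * s - 20) \<noteq> 0" if "s \<in> S" for s
    using near(2)[OF that] by (intro riemann_zeta_nonzero) simp
  ultimately have gh: "g holomorphic_on S" unfolding g_def by (intro holomorphic_intros) auto
  have nz: "riemann_zeta 3 \<noteq> 0" "riemann_zeta 2 \<noteq> 0" "riemann_zeta 4 \<noteq> 0"
    using riemann_zeta_of_real(2)[of 3] riemann_zeta_of_real(2)[of 2] riemann_zeta_of_real(2)[of 4] by auto
  then have g3: "g 3 \<noteq> 0" using h(2) by (simp add: g_def)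
  have Fg: "F s = g s / (s - 3) ^ 2" if "s \<in> S" "s \<noteq> 3" for s
  proof -
    have "riemann_zeta (3 * s - 8) = h (3 * s - 8) / (3 * (s - 3))"
      using zh[of "3 * s - 8"] in_ball(1)[OF that(1)] that(2) by simp
    moreover have "riemann_zeta (4 * s - 11) = h (4 * s - 11) / (4 * (s - 3))"
      using zh[of "4 * s - 11"] in_ball(2)[OF that(1)] that(2) by simp
    moreover have "(3 * s - 9) * (4 * s - 12) = 12 * ((s - 3) * (s - 3))" by (simp add: algebra_simps)
    ultimately show ?thesis by (simp add: F_def g_def power2_eq_square)
  qed
  show "zorder F 3 = -2"
    using Fg by (intro zorder_eqI[OF S gh g3]) (simp add: power_int_minus divide_inverse)
  have "eventually (\<lambda>s. s \<in> S - {3}) (at 3)" using S by (intro eventually_at_in_open)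
  then have "eventually (\<lambda>s. F s = g s / (s - 3) ^ 2) (at 3)" by eventually_elim (simp add: Fg)
  then show "is_pole F 3" using is_pole_basic[OF gh S g3, of 2] is_pole_cong[of F _ 3 3] by auto
qed

theorem corollary1p2:
  shows "let a = proiso_count \<Gamma>_t2;
             F = (\<lambda>s. riemann_zeta (3 * s - 8) * riemann_zeta (4 * s - 11) *
                      riemann_zeta (5 * s - 12) * riemann_zeta (4 * s - 10) /
                      riemann_zeta (8 * s - 20));
             c = 5 * Re (riemann_zeta 3) / (12 * pi\<^sup>2)
         in (\<forall>s. Re s > 3 \<longrightarrow>
               summable (dirichlet_term (\<lambda>n. of_nat (a n)) s) \<and> proiso_zeta \<Gamma>_t2 s = F s) \<and>
            F meromorphic_on UNIV \<and>
            abscissa_of_convergence (\<lambda>n. of_nat (a n)) = 3 \<and>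
            is_pole F 3 \<and> zorder F 3 = -2 \<and>
            (\<lambda>N. \<Sum>n = 1..N. real (a n)) \<sim>[at_top] (\<lambda>N. c * real N ^ 3 * ln (real N)) \<and>
            \<bar>c - 0.050747\<bar> < 0.0000005"
proof -
  have "(\<Sum>k. real (Suc k) powr - 3) = (\<Sum>k. 1 / real (Suc k) ^ 3)"
    by (simp add: powr_minus powr_numeral divide_inverse del: of_nat_Suc)
  then have zeta3: "Re (riemann_zeta 3) = (\<Sum>k. 1 / real (Suc k) ^ 3)"
    using riemann_zeta_of_real(1)[of 3] by simp
  have "summable (dirichlet_term (\<lambda>n. of_nat (proiso_count \<Gamma>_t2 n)) s) \<and> proiso_zeta \<Gamma>_t2 s =
      riemann_zeta (3 * s - 8) * riemann_zeta (4 * s - 11) * riemann_zeta (5 * s - 12) * riemann_zeta (4 * s - 10) / riemann_zeta (8 * s - 20)"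
    if "Re s > 3" for s
    using count_sums[OF that] unfolding proiso_zeta_def dirichlet_series_def by (metis sums_iff)
  moreover have "(\<lambda>s. riemann_zeta (3 * s - 8) * riemann_zeta (4 * s - 11) * riemann_zeta (5 * s - 12) * riemann_zeta (4 * s - 10) / riemann_zeta (8 * s - 20)) meromorphic_on UNIV"
    by (intro meromorphic_intros riemann_zeta_affine_meromorphic)
  ultimately show ?thesis
    unfolding Let_def zeta3
    using abscissa_count zeta_quotient_pole_at_3 count_asymptotics constant_numeric by blast
qed

end
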